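(* Let $\Omega\subseteq\mathbb{C}$ be an open set and let $\mathcal{F}\subseteq\mathbb{N}\times\mathbb{N}$ contain a sequence $(\tilde p_n,\tilde q_n)_{n\in\mathbb{N}}$ with $\tilde p_n\to+\infty$ and $\tilde q_n\to+\infty$ as $n\to+\infty$. There exists a function $f\in A^\infty(\Omega)$ with the following property: there exists a sequence $(p_n,q_n)_{n\in\mathbb{N}}$ in $\mathcal{F}$ such that for every compact set $K\subseteq\overline{\Omega}$ there is an $n(K)\in\mathbb{N}$ so that for all $n\ge n(K)$ it holds that $f\in\mathcal{D}_{p_n,q_n}(\zeta)$ for every $\zeta\in K$, and $\sup_{\zeta\in K}\sup_{z\in K}\big|[p_n/q_n]^{(\ell)}_{f,\zeta}(z)-f^{(\ell)}(z)\big|\to 0$ as $n\to+\infty$, for every $\ell=0,1,2,\dots$. The set of functions $f\in X^\infty$ with this property is $G_\delta$ and dense in $X^\infty$.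
   Context: $\overline{\Omega}$ is the closure of $\Omega$ in $\mathbb{C}$. $A^\infty(\Omega)$ is the set of $f$ holomorphic in $\Omega$ such that every derivative $f^{(\ell)}$, $\ell=0,1,2,\dots$, extends continuously to $\overline{\Omega}$ (the extension is still denoted $f^{(\ell)}$); it is a Fréchet space with the topology in which $f_m\to f$ iff $f_m^{(\ell)}\to f^{(\ell)}$ uniformly on each compact subset of $\overline{\Omega}$ for every $\ell$. $H(\overline{\Omega})$ is the set of functions holomorphic on some (varying) open set containing $\overline{\Omega}$, and $X^\infty$ is the closure of $H(\overline{\Omega})$ in $A^\infty(\Omega)$, with the induced topology. Padé approximants. Degrees $p,q$ range over $\mathbb{N}=\{0,1,2,\dots\}$. For $f\in A^\infty(\Omega)$ and $\zeta\in\overline{\Omega}$ put $a_v=f^{(v)}(\zeta)/v!$ (for $\zeta\in\partial\Omega$ defined by continuous extension), and consider the formal series $\sum_{v\ge0}a_v(z-\zeta)^v$. A Padé approximant $[p/q]_{f,\zeta}$ is a rational function of the form $P/Q$, $P(z)=\sum_{v=0}^p n_v(z-\zeta)^v$, $Q(z)=\sum_{v=0}^q d_v(z-\zeta)^v$ with $d_0=1$, whose Taylor coefficients $b_v$ at $\zeta$ satisfy $b_v=a_v$ for $v=0,\dots,p+q$. We write $f\in\mathcal{D}_{p,q}(\zeta)$ if the Hankel determinant $\det\big(a_{p-q+i+j-1}\big)_{i,j=1}^q$ is nonzero, with $a_i=0$ for $i<0$ (for $q=0$ the condition is always satisfied). In that case $[p/q]_{f,\zeta}$ exists and is unique. $[p/q]^{(\ell)}_{f,\zeta}$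 denotes its $\ell$-th derivative in $z$. The value of a rational function at a pole is taken to be $\infty$, so a finite supremum over $K$ means that there are no poles in $K$. *)

theory Defs
  imports
    "HOL-Complex_Analysis.Complex_Analysis"
    "Jordan_Normal_Form.Determinant"
begin

section \<open>The spaces of functions\<close>

text \<open>
  A function on \<open>\<Omega>\<close> is represented by its unique extensional representative (it is
  \<^const>\<open>undefined\<close> off \<open>\<Omega>\<close>), so that two functions are equal iff they agree on \<open>\<Omega>\<close>.
\<close>

definition A_inf :: "complex set \<Rightarrow> (complex \<Rightarrow> complex) set" where
  "A_inf \<Omega> = {f \<in> extensional \<Omega>. f holomorphic_on \<Omega> \<and>
     (\<forall>l::nat. \<exists>g. continuous_on (closure \<Omega>) g \<and> (\<forall>z\<in>\<Omega>. g z = (deriv ^^ l) f z))}"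

text \<open>
  The continuous extension of the \<open>l\<close>-th derivative to the closure of \<open>\<Omega>\<close>; see
  \<open>ext_deriv_eq\<close> and \<open>continuous_on_ext_deriv\<close> below.
\<close>

definition ext_deriv :: "complex set \<Rightarrow> nat \<Rightarrow> (complex \<Rightarrow> complex) \<Rightarrow> complex \<Rightarrow> complex" where
  "ext_deriv \<Omega> l f z = Lim (at z within \<Omega>) ((deriv ^^ l) f)"

definition A_inf_nbhd ::
  "complex set \<Rightarrow> (complex \<Rightarrow> complex) \<Rightarrow> complex set \<Rightarrow> nat \<Rightarrow> real \<Rightarrow> (complex \<Rightarrow> complex) set" where
  "A_inf_nbhd \<Omega> f K L \<epsilon> =
     {g \<in> A_inf \<Omega>. \<forall>l\<le>L. \<forall>z\<in>K. norm (ext_deriv \<Omega> l g z - ext_deriv \<Omega> l f z) < \<epsilon>}"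

definition A_inf_topology :: "complex set \<Rightarrow> (complex \<Rightarrow> complex) topology" where
  "A_inf_topology \<Omega> = topology (\<lambda>U. U \<subseteq> A_inf \<Omega> \<and>
     (\<forall>f\<in>U. \<exists>K L \<epsilon>. compact K \<and> K \<subseteq> closure \<Omega> \<and> \<epsilon> > 0 \<and> A_inf_nbhd \<Omega> f K L \<epsilon> \<subseteq> U))"

definition H_closure :: "complex set \<Rightarrow> (complex \<Rightarrow> complex) set" where
  "H_closure \<Omega> = {restrict h \<Omega> | h U. open U \<and> closure \<Omega> \<subseteq> U \<and> h holomorphic_on U}"

definition X_inf :: "complex set \<Rightarrow> (complex \<Rightarrow> complex) set" where
  "X_inf \<Omega> = A_inf_topology \<Omega> closure_of H_closure \<Omega>"

definition X_inf_topology :: "complex set \<Rightarrow> (complex \<Rightarrow> complex) topology" where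
  "X_inf_topology \<Omega> = subtopology (A_inf_topology \<Omega>) (X_inf \<Omega>)"


section \<open>Pad\'e approximants\<close>

text \<open>Indices are integers because the Hankel determinant uses \<open>a\<^sub>i = 0\<close> for \<open>i < 0\<close>.\<close>

definition taylor_coeff :: "complex set \<Rightarrow> (complex \<Rightarrow> complex) \<Rightarrow> complex \<Rightarrow> int \<Rightarrow> complex" where
  "taylor_coeff \<Omega> f \<zeta> i = (if i < 0 then 0 else ext_deriv \<Omega> (nat i) f \<zeta> / fact (nat i))"

text \<open>
  Matrix indices start at \<open>0\<close> here, whence \<open>i + j + 1\<close> instead of \<open>i + j - 1\<close>. For \<open>q = 0\<close> the
  determinant is \<open>1\<close>.
\<close>

definition pade_class ::
  "complex set \<Rightarrow> nat \<Rightarrow> nat \<Rightarrow> complex \<Rightarrow> (complex \<Rightarrow> complex) set" where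
  "pade_class \<Omega> p q \<zeta> = {f \<in> A_inf \<Omega>.
     Determinant.det (Matrix.mat q q
       (\<lambda>(i, j). taylor_coeff \<Omega> f \<zeta> (int p - int q + int i + int j + 1))) \<noteq> 0}"

text \<open>
  A rational function is represented by a function \<open>complex \<Rightarrow> complex\<close>. \<^const>\<open>remove_sings\<close>
  gives it the correct (finite) value at the common zeros of numerator and denominator that are
  not poles; the value \<open>0\<close> which it takes at the poles is never used, see \<open>pade_error\<close>.
\<close>

definition is_pade ::
  "complex set \<Rightarrow> (complex \<Rightarrow> complex) \<Rightarrow> complex \<Rightarrow> nat \<Rightarrow> nat \<Rightarrow> (complex \<Rightarrow> complex) \<Rightarrow> bool" where
  "is_pade \<Omega> f \<zeta> p q R \<longleftrightarrow>
     (\<exists>n d :: nat \<Rightarrow> complex. d 0 = 1 \<and>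
        R = remove_sings (\<lambda>z. (\<Sum>v\<le>p. n v * (z - \<zeta>) ^ v) / (\<Sum>v\<le>q. d v * (z - \<zeta>) ^ v))) \<and>
     (\<forall>v\<le>p + q. (deriv ^^ v) R \<zeta> / fact v = taylor_coeff \<Omega> f \<zeta> (int v))"

definition pade ::
  "complex set \<Rightarrow> (complex \<Rightarrow> complex) \<Rightarrow> complex \<Rightarrow> nat \<Rightarrow> nat \<Rightarrow> complex \<Rightarrow> complex" where
  "pade \<Omega> f \<zeta> p q = (THE R. is_pade \<Omega> f \<zeta> p q R)"

text \<open>
  \<open>\<bar>[p/q]\<^sup>(\<^sup>l\<^sup>)(z) - f\<^sup>(\<^sup>l\<^sup>)(z)\<bar>\<close>, with the value \<open>\<infinity>\<close> at the poles of \<open>[p/q]\<close>.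
\<close>

definition pade_error ::
  "complex set \<Rightarrow> (complex \<Rightarrow> complex) \<Rightarrow> nat \<Rightarrow> nat \<Rightarrow> nat \<Rightarrow> complex \<Rightarrow> complex \<Rightarrow> ennreal" where
  "pade_error \<Omega> f p q l \<zeta> z =
     (if is_pole (pade \<Omega> f \<zeta> p q) z then \<infinity>
      else ennreal (norm ((deriv ^^ l) (pade \<Omega> f \<zeta> p q) z - ext_deriv \<Omega> l f z)))"

definition pade_approximable ::
  "complex set \<Rightarrow> (nat \<times> nat) set \<Rightarrow> (complex \<Rightarrow> complex) \<Rightarrow> bool" where
  "pade_approximable \<Omega> F f \<longleftrightarrow>
     (\<exists>p q :: nat \<Rightarrow> nat. (\<forall>n. (p n, q n) \<in> F) \<and>
        (\<forall>K. compact K \<and> K \<subseteq> closure \<Omega> \<longrightarrow>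
           (\<exists>N. \<forall>n\<ge>N. \<forall>\<zeta>\<in>K. f \<in> pade_class \<Omega> (p n) (q n) \<zeta>) \<and>
           (\<forall>l. (\<lambda>n. SUP \<zeta>\<in>K. SUP z\<in>K. pade_error \<Omega> f (p n) (q n) l \<zeta> z) \<longlonglongrightarrow> 0)))"


section \<open>Basic facts on the spaces\<close>

lemma closure_open_not_trivial:
  fixes \<Omega> :: "complex set"
  assumes "open \<Omega>" "z \<in> closure \<Omega>"
  shows "at z within \<Omega> \<noteq> bot"
proof -
  have "z islimpt \<Omega>"
    using assms interior_limit_point[of z \<Omega>] by (auto simp: closure_def interior_open)
  thus ?thesis
    by (simp add: trivial_limit_within)
qed

lemma ext_deriv_unique:
  assumes "open \<Omega>" "continuous_on (closure \<Omega>) g" "\<And>z. z \<in> \<Omega> \<Longrightarrow> g z = (deriv ^^ l) f z"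
    and "z \<in> closure \<Omega>"
  shows "ext_deriv \<Omega> l f z = g z"
proof -
  have "(g \<longlongrightarrow> g z) (at z within closure \<Omega>)"
    using assms(2,4) by (simp add: continuous_on_def)
  hence "(g \<longlongrightarrow> g z) (at z within \<Omega>)"
    by (rule tendsto_within_subset) (rule closure_subset)
  moreover have "eventually (\<lambda>w. g w = (deriv ^^ l) f w) (at z within \<Omega>)"
    using assms(3) by (simp add: eventually_at_filter)
  ultimately have "((deriv ^^ l) f \<longlongrightarrow> g z) (at z within \<Omega>)"
    using tendsto_cong by fastforce
  thus ?thesis
    unfolding ext_deriv_def
    by (intro tendsto_Lim closure_open_not_trivial assms)
qed

lemma ext_deriv_eq:
  assumes "open \<Omega>" "f \<in> A_inf \<Omega>" "z \<in> \<Omega>"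
  shows "ext_deriv \<Omega> l f z = (deriv ^^ l) f z"
proof -
  obtain g where "continuous_on (closure \<Omega>) g" "\<forall>z\<in>\<Omega>. g z = (deriv ^^ l) f z"
    using assms(2) unfolding A_inf_def by blast
  thus ?thesis
    using ext_deriv_unique[OF assms(1), of g l f z] assms(3) closure_subset by auto
qed

lemma continuous_on_ext_deriv:
  assumes "open \<Omega>" "f \<in> A_inf \<Omega>"
  shows "continuous_on (closure \<Omega>) (ext_deriv \<Omega> l f)"
proof -
  obtain g where g: "continuous_on (closure \<Omega>) g" "\<forall>z\<in>\<Omega>. g z = (deriv ^^ l) f z"
    using assms(2) unfolding A_inf_def by blast
  hence "ext_deriv \<Omega> l f z = g z" if "z \<in> closure \<Omega>" for z
    using ext_deriv_unique[OF assms(1), of g l f z] that by auto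
  with g(1) show ?thesis by (simp cong: continuous_on_cong)
qed

lemma A_inf_nbhd_mono:
  assumes "K' \<subseteq> K" "L' \<le> L" "\<epsilon> \<le> \<epsilon>'"
  shows "A_inf_nbhd \<Omega> f K L \<epsilon> \<subseteq> A_inf_nbhd \<Omega> f K' L' \<epsilon>'"
proof
  fix g assume g: "g \<in> A_inf_nbhd \<Omega> f K L \<epsilon>"
  have "norm (ext_deriv \<Omega> l g z - ext_deriv \<Omega> l f z) < \<epsilon>'" if "l \<le> L'" "z \<in> K'" for l z
  proof -
    have "l \<le> L" "z \<in> K" using that assms by auto
    with g have "norm (ext_deriv \<Omega> l g z - ext_deriv \<Omega> l f z) < \<epsilon>"
      by (simp add: A_inf_nbhd_def)
    thus ?thesis using assms(3) by linarith
  qed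
  thus "g \<in> A_inf_nbhd \<Omega> f K' L' \<epsilon>'" using g by (simp add: A_inf_nbhd_def)
qed

lemma openin_A_inf_topology:
  "openin (A_inf_topology \<Omega>) U \<longleftrightarrow> U \<subseteq> A_inf \<Omega> \<and>
     (\<forall>f\<in>U. \<exists>K L \<epsilon>. compact K \<and> K \<subseteq> closure \<Omega> \<and> \<epsilon> > 0 \<and> A_inf_nbhd \<Omega> f K L \<epsilon> \<subseteq> U)"
proof -
  let ?P = "\<lambda>U f. \<exists>K L \<epsilon>. compact K \<and> K \<subseteq> closure \<Omega> \<and> \<epsilon> > 0 \<and> A_inf_nbhd \<Omega> f K L \<epsilon> \<subseteq> U"
  have int: "?P (S \<inter> T) f" if "?P S f" "?P T f" for S T f
  proof -
    from that(1) obtain K L \<epsilon> where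
      K: "compact K" "K \<subseteq> closure \<Omega>" "\<epsilon> > 0" "A_inf_nbhd \<Omega> f K L \<epsilon> \<subseteq> S"
      by (elim exE conjE)
    from that(2) obtain K' L' \<epsilon>' where
      K': "compact K'" "K' \<subseteq> closure \<Omega>" "\<epsilon>' > 0" "A_inf_nbhd \<Omega> f K' L' \<epsilon>' \<subseteq> T"
      by (elim exE conjE)
    have "A_inf_nbhd \<Omega> f (K \<union> K') (max L L') (min \<epsilon> \<epsilon>') \<subseteq> A_inf_nbhd \<Omega> f K L \<epsilon>"
      "A_inf_nbhd \<Omega> f (K \<union> K') (max L L') (min \<epsilon> \<epsilon>') \<subseteq> A_inf_nbhd \<Omega> f K' L' \<epsilon>'"
      by (intro A_inf_nbhd_mono; simp)+
    hence "A_inf_nbhd \<Omega> f (K \<union> K') (max L L') (min \<epsilon> \<epsilon>') \<subseteq> S \<inter> T"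
      using K(4) K'(4) by blast
    with K K' show ?thesis
      by (intro exI[of _ "K \<union> K'"] exI[of _ "max L L'"] exI[of _ "min \<epsilon> \<epsilon>'"] conjI)
        (simp_all add: compact_Un)
  qed
  have un: "?P (\<Union>\<K>) f" if "S \<in> \<K>" "?P S f" for \<K> S f
    proof -
    from that(2) obtain K L \<epsilon> where
      "compact K" "K \<subseteq> closure \<Omega>" "\<epsilon> > 0" "A_inf_nbhd \<Omega> f K L \<epsilon> \<subseteq> S"
      by (elim exE conjE)
    moreover from this have "A_inf_nbhd \<Omega> f K L \<epsilon> \<subseteq> \<Union>\<K>"
      using \<open>S \<in> \<K>\<close> by blast
    ultimately show ?thesis by blast
  qed
  have "istopology (\<lambda>U. U \<subseteq> A_inf \<Omega> \<and> (\<forall>f\<in>U. ?P U f))"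
    unfolding istopology_def
  proof (intro conjI allI impI ballI)
    fix S T f assume "S \<subseteq> A_inf \<Omega> \<and> (\<forall>f\<in>S. ?P S f)" "T \<subseteq> A_inf \<Omega> \<and> (\<forall>f\<in>T. ?P T f)" "f \<in> S \<inter> T"
    thus "?P (S \<inter> T) f" by (intro int) simp_all
  next
    fix \<K> f assume "\<forall>S\<in>\<K>. S \<subseteq> A_inf \<Omega> \<and> (\<forall>f\<in>S. ?P S f)" "f \<in> \<Union>\<K>"
    thus "?P (\<Union>\<K>) f" using un by (metis UnionE)
  qed auto
  from topology_inverse'[OF this] show ?thesis
    unfolding A_inf_topology_def by simp
qed

lemma topspace_A_inf_topology [simp]: "topspace (A_inf_topology \<Omega>) = A_inf \<Omega>"
proof (rule antisym)
  show "topspace (A_inf_topology \<Omega>) \<subseteq> A_inf \<Omega>"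
    using openin_A_inf_topology[of \<Omega> "topspace (A_inf_topology \<Omega>)"] by auto
  have "openin (A_inf_topology \<Omega>) (A_inf \<Omega>)"
    unfolding openin_A_inf_topology
    by (intro conjI ballI exI[of _ "{}"] exI[of _ "0::nat"] exI[of _ "1::real"])
      (auto simp: A_inf_nbhd_def)
  thus "A_inf \<Omega> \<subseteq> topspace (A_inf_topology \<Omega>)" by (rule openin_subset)
qed

lemma topspace_X_inf_topology [simp]: "topspace (X_inf_topology \<Omega>) = X_inf \<Omega>"
  unfolding X_inf_topology_def X_inf_def
  using closure_of_subset_topspace[of "A_inf_topology \<Omega>" "H_closure \<Omega>"] by auto

lemma limitin_A_inf_topology:
  assumes "\<And>m. fs m \<in> A_inf \<Omega>" "f \<in> A_inf \<Omega>"
  shows "limitin (A_inf_topology \<Omega>) fs f sequentially \<longleftrightarrow>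
    (\<forall>l K. compact K \<and> K \<subseteq> closure \<Omega> \<longrightarrow>
       uniform_limit K (\<lambda>m. ext_deriv \<Omega> l (fs m)) (ext_deriv \<Omega> l f) sequentially)"
proof safe
  fix l K assume lim: "limitin (A_inf_topology \<Omega>) fs f sequentially"
    and K: "compact K" "K \<subseteq> closure \<Omega>"
  show "uniform_limit K (\<lambda>m. ext_deriv \<Omega> l (fs m)) (ext_deriv \<Omega> l f) sequentially"
  proof (rule uniform_limitI)
    fix e :: real assume "e > 0"
    define V where "V = {g \<in> A_inf \<Omega>. \<exists>c<e. \<forall>z\<in>K. norm (ext_deriv \<Omega> l g z - ext_deriv \<Omega> l f z) \<le> c}"
    have "openin (A_inf_topology \<Omega>) V"
      unfolding openin_A_inf_topology
    proof (intro conjI ballI)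
      fix g assume "g \<in> V"
      then obtain c where c: "c < e" "\<forall>z\<in>K. norm (ext_deriv \<Omega> l g z - ext_deriv \<Omega> l f z) \<le> c"
        by (auto simp: V_def)
      have "A_inf_nbhd \<Omega> g K l ((e - c) / 2) \<subseteq> V"
      proof
        fix h assume h: "h \<in> A_inf_nbhd \<Omega> g K l ((e - c) / 2)"
        have "norm (ext_deriv \<Omega> l h z - ext_deriv \<Omega> l f z) \<le> (c + e) / 2" if "z \<in> K" for z
        proof -
          have "norm (ext_deriv \<Omega> l h z - ext_deriv \<Omega> l f z)
             \<le> norm (ext_deriv \<Omega> l h z - ext_deriv \<Omega> l g z) + norm (ext_deriv \<Omega> l g z - ext_deriv \<Omega> l f z)"
            by norm
          also have "\<dots> \<le> (e - c) / 2 + c"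
            using h c that by (intro add_mono) (auto simp: A_inf_nbhd_def less_imp_le)
          finally show ?thesis by (simp add: field_simps)
        qed
        moreover have "(c + e) / 2 < e" using c by simp
        ultimately show "h \<in> V" using h unfolding V_def A_inf_nbhd_def by blast
      qed
      thus "\<exists>K L \<epsilon>. compact K \<and> K \<subseteq> closure \<Omega> \<and> \<epsilon> > 0 \<and> A_inf_nbhd \<Omega> g K L \<epsilon> \<subseteq> V"
        using K c by (intro exI[of _ K] exI[of _ l] exI[of _ "(e - c) / 2"]) auto
    qed (auto simp: V_def)
    moreover have "f \<in> V" using \<open>e > 0\<close> assms by (auto simp: V_def intro!: exI[of _ 0])
    ultimately have "eventually (\<lambda>m. fs m \<in> V) sequentially"
      using lim by (auto simp: limitin_def)
    thus "\<forall>\<^sub>F m in sequentially. \<forall>z\<in>K. dist (ext_deriv \<Omega> l (fs m) z) (ext_deriv \<Omega> l f z) < e"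
      by eventually_elim (auto simp: V_def dist_norm intro: le_less_trans)
  qed
next
  assume *: "\<forall>l K. compact K \<and> K \<subseteq> closure \<Omega> \<longrightarrow>
       uniform_limit K (\<lambda>m. ext_deriv \<Omega> l (fs m)) (ext_deriv \<Omega> l f) sequentially"
  show "limitin (A_inf_topology \<Omega>) fs f sequentially"
    unfolding limitin_def
  proof (intro conjI allI impI)
    fix U assume "openin (A_inf_topology \<Omega>) U \<and> f \<in> U"
    then obtain K L e where K: "compact K" "K \<subseteq> closure \<Omega>" "e > 0" "A_inf_nbhd \<Omega> f K L e \<subseteq> U"
      unfolding openin_A_inf_topology by blast
    have "eventually (\<lambda>m. \<forall>l\<in>{..L}. \<forall>z\<in>K. dist (ext_deriv \<Omega> l (fs m) z) (ext_deriv \<Omega> l f z) < e) sequentially"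
      using * K by (intro eventually_ball_finite) (auto dest: uniform_limitD)
    thus "eventually (\<lambda>m. fs m \<in> U) sequentially"
    proof eventually_elim
      case (elim m)
      hence "fs m \<in> A_inf_nbhd \<Omega> f K L e"
        using assms by (auto simp: A_inf_nbhd_def dist_norm)
      with K show ?case by blast
    qed
  qed (use assms in simp)
qed

lemma H_closure_subset_A_inf:
  assumes "open \<Omega>"
  shows "H_closure \<Omega> \<subseteq> A_inf \<Omega>"
proof
  fix f assume "f \<in> H_closure \<Omega>"
  then obtain h U where hU: "f = restrict h \<Omega>" "open U" "closure \<Omega> \<subseteq> U" "h holomorphic_on U"
    by (auto simp: H_closure_def)
  have sub: "\<Omega> \<subseteq> U" using hU closure_subset by blast
  have "(deriv ^^ l) h z = (deriv ^^ l) f z" if "z \<in> \<Omega>" for l z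
    using that assms
    by (intro higher_deriv_cong_ev) (auto simp: hU(1) eventually_nhds)
  moreover have "continuous_on (closure \<Omega>) ((deriv ^^ l) h)" for l
    using hU by (meson continuous_on_subset holomorphic_higher_deriv holomorphic_on_imp_continuous_on)
  moreover have "f holomorphic_on \<Omega>"
    using holomorphic_on_subset[OF hU(4) sub] by (rule holomorphic_transform) (simp add: hU(1))
  ultimately show "f \<in> A_inf \<Omega>"
    unfolding A_inf_def using hU(1) by auto
qed

end

theory Submission
  imports Defs
begin

text \<open>
  The functions with the required property form the set \<open>X \<inter> (\<Inter>m. \<Union>(p,
  q)\<in>F. E(m, p, q))\<close>, where \<open>E(m, p, q)\<close> demands that on the
  \<open>m\<close>-th compact set of an exhaustion of the closure of \<open>\<Omega>\<close> the
  approximant \<open>[p/q]\<close> exists at all centres and is within \<open>1 / (m + 1)\<close> of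
  \<open>f\<close> together with \<open>m\<close> derivatives. Since \<open>[p/q]\<close> depends
  continuously on the Taylor coefficients where the Hankel determinant does not vanish (Cramer's rule), and
  its poles are exactly the zeros of the denominator, compactness makes \<open>E(m, p, q)\<close> open.
  For density, Runge's theorem replaces a function holomorphic near the closure of
  \<open>\<Omega>\<close> by a reduced fraction \<open>A / B\<close> without poles there; adding a
  small multiple of a monomial of degree \<open>p - degree B\<close> makes the numerator have degree
  exactly \<open>p\<close>, and such a fraction coincides with its own \<open>[p/q]\<close> approximant
  at every centre as soon as \<open>q \<ge> degree B\<close>. Baire's theorem concludes.
\<close>

section \<open>Rational approximation on compact sets\<close>

text \<open>The delicate point is that one pair \<open>(p, q)\<close> must serve all centres at
  once. For coprime \<open>A\<close> and \<open>B\<close>, a kernel vector of the Hankel matrix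
  would permit a nonconstant common multiplier of numerator and denominator;
  \<open>degree A = p\<close> leaves no space for one, whatever the centre, while \<open>q\<close>
  only has to be large. The perturbation is a monomial because adding the entire function
  \<open>c * z ^ k\<close> to \<open>A / B\<close> keeps the denominator and coprimality, and so
  creates no new pole. Runge's theorem is needed with two sets: closeness is asked on a compact
  \<open>K\<close>, yet poles must avoid the whole closure of \<Omega>, which may be unbounded and
  may contain holes of \<open>K\<close>. Such holes are filled before poles are moved, and closeness
  of derivatives is gained by working on a slightly larger compact set. The topology is given by
  seminorms on compact sets, not by a metric. Baire's argument therefore runs directly with nested
  basic neighbourhoods, inside the closed subset \<open>X_inf\<close>.\<close>

definition ratfun :: "complex set \<Rightarrow> (complex \<Rightarrow> complex) set" where
  "ratfun T = {\<lambda>z. poly A z / poly B z | A B. \<forall>z\<in>T. poly B z \<noteq> 0}"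

text \<open>\<open>T\<close> carries the ban on poles, \<open>K\<close> the uniform closeness. They
  differ because the approximants must be holomorphic near all of \<open>T\<close>, while only
  compact sets can be controlled.\<close>

definition rat_approx :: "complex set \<Rightarrow> complex set \<Rightarrow> (complex \<Rightarrow> complex) set" where
  "rat_approx T K = {f. \<forall>\<epsilon>>0. \<exists>r\<in>ratfun T. \<forall>z\<in>K. norm (f z - r z) < \<epsilon>}"

lemma ratfunI:
  assumes "\<And>z. z \<in> T \<Longrightarrow> poly B z \<noteq> 0" "f = (\<lambda>z. poly A z / poly B z)"
  shows "f \<in> ratfun T"
  using assms unfolding ratfun_def by blast

lemma ratfun_poly: "poly A \<in> ratfun T"
  by (rule ratfunI[of _ 1 _ A]) auto

lemma ratfun_kernel: "w \<notin> T \<Longrightarrow> (\<lambda>z. 1 / (w - z)) \<in> ratfun T"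
  by (rule ratfunI[of _ "[:w, -1:]" _ 1]) auto

lemma ratfun_mult:
  assumes "f \<in> ratfun T" "g \<in> ratfun T"
  shows "(\<lambda>z. f z * g z) \<in> ratfun T"
proof -
  from assms obtain A B C D where
    "f = (\<lambda>z. poly A z / poly B z)" "\<forall>z\<in>T. poly B z \<noteq> 0"
    "g = (\<lambda>z. poly C z / poly D z)" "\<forall>z\<in>T. poly D z \<noteq> 0"
    unfolding ratfun_def by blast
  thus ?thesis by (intro ratfunI[of _ "B * D" _ "A * C"]) auto
qed

lemma rat_approxE:
  assumes "f \<in> rat_approx T K" "\<epsilon> > 0"
  obtains r where "r \<in> ratfun T" "\<And>z. z \<in> K \<Longrightarrow> norm (f z - r z) < \<epsilon>"
  using assms unfolding rat_approx_def by blast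

lemma ratfun_subset_rat_approx: "ratfun T \<subseteq> rat_approx T K"
  unfolding rat_approx_def by force

text \<open>
  Sums are formed on \<open>T\<close> only: where a denominator vanishes, the junk value \<open>x / 0 = 0\<close>
  does not respect addition of fractions.
\<close>

lemma ratfun_add:
  assumes "f \<in> ratfun T" "g \<in> ratfun T"
  obtains h where "h \<in> ratfun T" "\<And>z. z \<in> T \<Longrightarrow> h z = f z + g z"
proof -
  from assms obtain A B C D where *:
    "f = (\<lambda>z. poly A z / poly B z)" "\<forall>z\<in>T. poly B z \<noteq> 0"
    "g = (\<lambda>z. poly C z / poly D z)" "\<forall>z\<in>T. poly D z \<noteq> 0"
    unfolding ratfun_def by blast
  show ?thesis
  proof
    show "(\<lambda>z. poly (A * D + B * C) z / poly (B * D) z) \<in> ratfun T"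
      by (rule ratfunI[OF _ refl]) (use * in auto)
  qed (use * in \<open>auto simp: divide_simps\<close>)
qed

section \<open>The uniform closure as an algebra, and moving poles\<close>

context
  fixes T K :: "complex set"
  assumes K: "compact K" and KT: "K \<subseteq> T"
begin

text \<open>The uniform closure is closed. Later approximations may therefore use members of
  \<open>rat_approx\<close> themselves in place of exact fractions.\<close>

lemma rat_approx_limit:
  assumes "\<And>\<epsilon>. \<epsilon> > 0 \<Longrightarrow> \<exists>g\<in>rat_approx T K. \<forall>z\<in>K. norm (f z - g z) < \<epsilon>"
  shows "f \<in> rat_approx T K"
  unfolding rat_approx_def
proof (intro CollectI allI impI)
  fix \<epsilon> :: real assume "\<epsilon> > 0"
  then obtain g where g: "g \<in> rat_approx T K" "\<forall>z\<in>K. norm (f z - g z) < \<epsilon> / 2"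
    using assms[of "\<epsilon> / 2"] by auto
  then obtain r where r: "r \<in> ratfun T" "\<And>z. z \<in> K \<Longrightarrow> norm (g z - r z) < \<epsilon> / 2"
    using rat_approxE[of g T K "\<epsilon> / 2"] \<open>\<epsilon> > 0\<close> by auto
  have "norm (f z - r z) < \<epsilon>" if "z \<in> K" for z
  proof -
    have "norm (f z - g z) + norm (g z - r z) < \<epsilon>"
      using g(2)[rule_format, OF that] r(2)[OF that] by linarith
    from norm_triangle_lt[OF this] show ?thesis by simp
  qed
  thus "\<exists>r\<in>ratfun T. \<forall>z\<in>K. norm (f z - r z) < \<epsilon>" using r(1) by blast
qed

lemma rat_approx_cong:
  assumes "f \<in> rat_approx T K" "\<And>z. z \<in> K \<Longrightarrow> g z = f z"
  shows "g \<in> rat_approx T K"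
  by (rule rat_approx_limit) (use assms in force)

lemma ratfun_bounded:
  assumes "f \<in> ratfun T"
  obtains M where "M > 0" "\<And>z. z \<in> K \<Longrightarrow> norm (f z) \<le> M"
proof -
  from assms obtain A B where *:
    "f = (\<lambda>z. poly A z / poly B z)" "\<forall>z\<in>T. poly B z \<noteq> 0"
    unfolding ratfun_def by blast
  have "continuous_on K f"
    unfolding * by (intro continuous_intros) (use * KT in auto)
  hence "bounded (f ` K)" using K compact_continuous_image compact_imp_bounded by blast
  then obtain M where "M > 0" "\<forall>x\<in>f ` K. norm x \<le> M" unfolding bounded_pos by blast
  thus ?thesis using that by blast
qed

lemma rat_approx_bounded:
  assumes "f \<in> rat_approx T K"
  obtains M where "M > 0" "\<And>z. z \<in> K \<Longrightarrow> norm (f z) \<le> M"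
proof -
  obtain r where r: "r \<in> ratfun T" "\<And>z. z \<in> K \<Longrightarrow> norm (f z - r z) < 1"
    using rat_approxE[OF assms, of 1] by auto
  obtain M where M: "M > 0" "\<And>z. z \<in> K \<Longrightarrow> norm (r z) \<le> M"
    using ratfun_bounded[OF r(1)] by metis
  show ?thesis
  proof (rule that[of "1 + M"])
    fix z assume "z \<in> K"
    hence "norm (f z - r z) + norm (r z) \<le> 1 + M"
      using r(2) M(2)[of z] by (intro add_mono) (auto intro: less_imp_le)
    thus "norm (f z) \<le> 1 + M"
      using norm_triangle_ineq[of "f z - r z" "r z"] by simp
  qed (use M in simp)
qed

lemma rat_approx_add:
  assumes "f \<in> rat_approx T K" "g \<in> rat_approx T K"
  shows "(\<lambda>z. f z + g z) \<in> rat_approx T K"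
  unfolding rat_approx_def
proof (intro CollectI allI impI)
  fix \<epsilon> :: real assume "\<epsilon> > 0"
  hence "\<epsilon> / 2 > 0" by simp
  then obtain r s where r: "r \<in> ratfun T" "\<forall>z\<in>K. norm (f z - r z) < \<epsilon> / 2"
    and s: "s \<in> ratfun T" "\<forall>z\<in>K. norm (g z - s z) < \<epsilon> / 2"
    using assms unfolding rat_approx_def by blast
  obtain h where h: "h \<in> ratfun T" "\<And>z. z \<in> T \<Longrightarrow> h z = r z + s z"
    using ratfun_add[OF r(1) s(1)] by blast
  have "norm (f z + g z - h z) < \<epsilon>" if "z \<in> K" for z
  proof -
    have "f z + g z - h z = (f z - r z) + (g z - s z)" using h that KT by auto
    moreover have "norm (f z - r z) + norm (g z - s z) < \<epsilon>"
      using r(2) s(2) that by fastforce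
    ultimately show ?thesis using norm_triangle_lt by metis
  qed
  thus "\<exists>r\<in>ratfun T. \<forall>z\<in>K. norm (f z + g z - r z) < \<epsilon>" using h by blast
qed

lemma rat_approx_mult:
  assumes f: "f \<in> rat_approx T K" and g: "g \<in> rat_approx T K"
  shows "(\<lambda>z. f z * g z) \<in> rat_approx T K"
  unfolding rat_approx_def
proof (intro CollectI allI impI)
  fix \<epsilon> :: real assume "\<epsilon> > 0"
  obtain M where M: "M > 0" "\<And>z. z \<in> K \<Longrightarrow> norm (f z) \<le> M" using rat_approx_bounded[OF f] by metis
  obtain s where s: "s \<in> ratfun T" "\<And>z. z \<in> K \<Longrightarrow> norm (g z - s z) < \<epsilon> / (2 * M)"
    using rat_approxE[OF g, of "\<epsilon> / (2 * M)"] M \<open>\<epsilon> > 0\<close> by auto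
  \<comment> \<open>\<open>s\<close> is fixed before its bound \<open>N\<close>, and
    \<open>r\<close> comes last. Both error terms then stay below \<epsilon> / 2, and no product of
    two errors appears.\<close>
  obtain N where N: "N > 0" "\<And>z. z \<in> K \<Longrightarrow> norm (s z) \<le> N" using ratfun_bounded[OF s(1)] by metis
  obtain r where r: "r \<in> ratfun T" "\<And>z. z \<in> K \<Longrightarrow> norm (f z - r z) < \<epsilon> / (2 * N)"
    using rat_approxE[OF f, of "\<epsilon> / (2 * N)"] N \<open>\<epsilon> > 0\<close> by auto
  have "norm (f z * g z - r z * s z) < \<epsilon>" if "z \<in> K" for z
  proof -
    have "norm (f z * g z - r z * s z) = norm (f z * (g z - s z) + (f z - r z) * s z)"
      by (simp add: algebra_simps)
    also have "\<dots> \<le> norm (f z) * norm (g z - s z) + norm (f z - r z) * norm (s z)"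
      by (metis norm_mult norm_triangle_ineq)
    also have "\<dots> \<le> M * norm (g z - s z) + norm (f z - r z) * N"
      using M N that by (intro add_mono mult_mono) auto
    also have "\<dots> < M * (\<epsilon> / (2 * M)) + (\<epsilon> / (2 * N)) * N"
      using M N r s that by (intro add_strict_mono mult_strict_left_mono mult_strict_right_mono) auto
    also have "\<dots> = \<epsilon>" using M N by simp
    finally show ?thesis .
  qed
  thus "\<exists>r\<in>ratfun T. \<forall>z\<in>K. norm (f z * g z - r z) < \<epsilon>"
    by (intro bexI[of _ "\<lambda>z. r z * s z"] ratfun_mult r(1) s(1)) simp
qed

lemma rat_approx_poly: "poly A \<in> rat_approx T K"
  using ratfun_poly ratfun_subset_rat_approx by blast

lemma rat_approx_const: "(\<lambda>z. c) \<in> rat_approx T K"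
  by (rule rat_approx_cong[OF rat_approx_poly[of "[:c:]"]]) simp

lemma rat_approx_cmult: "f \<in> rat_approx T K \<Longrightarrow> (\<lambda>z. c * f z) \<in> rat_approx T K"
  by (rule rat_approx_mult[OF rat_approx_const])

lemma rat_approx_power: "f \<in> rat_approx T K \<Longrightarrow> (\<lambda>z. f z ^ n) \<in> rat_approx T K"
  by (induction n) (auto intro: rat_approx_const rat_approx_mult)

lemma rat_approx_sum:
  "(\<And>i. i \<in> I \<Longrightarrow> f i \<in> rat_approx T K) \<Longrightarrow> (\<lambda>z. \<Sum>i\<in>I. f i z) \<in> rat_approx T K"
  by (induction I rule: infinite_finite_induct) (auto intro: rat_approx_const rat_approx_add)

text \<open>Partial sums of the geometric series stay in the algebra, and with ratio at most
  \<open>1 / 2\<close> the tail is at most \<open>2 * (1 / 2) ^ n\<close> on all of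
  \<open>K\<close>. This one expansion serves both poles far away and poles close to each
  other.\<close>

lemma rat_approx_geometric:
  assumes "u \<in> rat_approx T K" "\<And>z. z \<in> K \<Longrightarrow> norm (u z) \<le> 1 / 2"
  shows "(\<lambda>z. 1 / (1 - u z)) \<in> rat_approx T K"
proof (rule rat_approx_limit)
  fix \<epsilon> :: real assume "\<epsilon> > 0"
  then obtain n where n: "(1 / 2) ^ n < \<epsilon> / 2"
    using real_arch_pow_inv[of "\<epsilon> / 2" "1 / 2"] by auto
  have "norm (1 / (1 - u z) - (\<Sum>k<n. u z ^ k)) < \<epsilon>" if "z \<in> K" for z
  proof -
    have u: "norm (u z) \<le> 1 / 2" using assms that by blast
    have "1 / 2 \<le> 1 - norm (u z)" using u by simp
    also have "\<dots> \<le> norm (1 - u z)" using norm_triangle_ineq2[of 1 "u z"] by simp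
    finally have d: "norm (1 - u z) \<ge> 1 / 2" .
    hence "u z \<noteq> 1" by auto
    hence "1 / (1 - u z) - (\<Sum>k<n. u z ^ k) = u z ^ n / (1 - u z)"
      by (subst sum_gp_strict) (auto simp: divide_simps)
    also have "norm \<dots> = norm (u z) ^ n / norm (1 - u z)" by (simp add: norm_divide norm_power)
    also have "\<dots> \<le> (1 / 2) ^ n / (1 / 2)"
      using u d by (intro frac_le power_mono) auto
    also have "\<dots> < \<epsilon>" using n by simp
    finally show ?thesis .
  qed
  thus "\<exists>g\<in>rat_approx T K. \<forall>z\<in>K. norm (1 / (1 - u z) - g z) < \<epsilon>"
    by (intro bexI[of _ "\<lambda>z. \<Sum>k<n. u z ^ k"] rat_approx_sum rat_approx_power assms ballI)
qed

text \<open>Pushing the pole of the Cauchy kernel through a component of the complement of \<open>K\<close>.\<close>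

lemma rat_approx_kernel:
  assumes comp: "\<And>C. C \<in> components (- K) \<Longrightarrow> bounded C \<Longrightarrow> \<not> C \<subseteq> T"
    and w: "w \<notin> K"
  shows "(\<lambda>z. 1 / (w - z)) \<in> rat_approx T K"
proof -
  define C where "C = connected_component_set (- K) w"
  have C: "C \<in> components (- K)" "w \<in> C" "connected C" "C \<subseteq> - K"
    using w connected_component_subset[of "- K" w] by (auto simp: C_def componentsI)
  have "\<exists>v\<in>C. (\<lambda>z. 1 / (v - z)) \<in> rat_approx T K"
  proof (cases "bounded C")
    case True
    then obtain v where "v \<in> C" "v \<notin> T" using comp C by blast
    thus ?thesis using ratfun_kernel ratfun_subset_rat_approx by blast
  next
    case False
    \<comment> \<open>In an unbounded component a pole can be chosen beyond \<open>2 * M\<close>;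
      its kernel expands in powers of \<open>z / v\<close>, so polynomials approximate it.\<close>
    obtain M where M: "M > 0" "\<And>z. z \<in> K \<Longrightarrow> norm z \<le> M"
      using K compact_imp_bounded bounded_pos by metis
    obtain v where v: "v \<in> C" "norm v > 2 * M"
      using False unfolding bounded_iff by (meson not_le)
    hence "v \<noteq> 0" using M by auto
    have "(\<lambda>z. 1 / (1 - poly [:0, 1 / v:] z)) \<in> rat_approx T K"
    proof (rule rat_approx_geometric[OF rat_approx_poly])
      fix z assume "z \<in> K"
      thus "norm (poly [:0, 1 / v:] z) \<le> 1 / 2"
        using M(2)[of z] v M(1) by (simp add: norm_divide divide_simps)
    qed
    from rat_approx_cmult[OF this, of "1 / v"]
    have "(\<lambda>z. 1 / (v - z)) \<in> rat_approx T K"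
    proof (rule rat_approx_cong)
      fix z assume "z \<in> K"
      thus "1 / (v - z) = 1 / v * (1 / (1 - poly [:0, 1 / v:] z))"
        using \<open>v \<noteq> 0\<close> by (simp add: divide_simps mult.commute)
    qed
    thus ?thesis using v by blast
  qed
  then obtain v where v: "v \<in> C" "(\<lambda>z. 1 / (v - z)) \<in> rat_approx T K" by blast
  \<comment> \<open>Approximability of the kernel is a locally constant property of its pole, hence
    constant on the connected set \<open>C\<close>.\<close>
  show ?thesis
  proof (rule connected_induction_simple[where P = "\<lambda>x. (\<lambda>z. 1 / (x - z)) \<in> rat_approx T K",
        OF \<open>connected C\<close> v(1) C(2) v(2)])
    fix a assume "a \<in> C"
    hence "a \<in> - K" using C by blast
    then obtain d where d: "d > 0" "ball a d \<subseteq> - K"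
      using K compact_imp_closed by (meson open_Compl openE)
    \<comment> \<open>Two poles in \<open>ball a (d / 6)\<close> are at most \<open>d / 3\<close>
      apart and at least \<open>5 * d / 6\<close> away from \<open>K\<close>, so
      \<open>(x - y) / (x - z)\<close> has norm at most \<open>2 / 5\<close>.\<close>
    have *: "(\<lambda>z. 1 / (y - z)) \<in> rat_approx T K"
      if x: "x \<in> ball a (d / 6)" "(\<lambda>z. 1 / (x - z)) \<in> rat_approx T K" and y: "y \<in> ball a (d / 6)"
      for x y
    proof -
      have far: "norm (x - z) \<ge> 5 * d / 6" if "z \<in> K" for z
      proof -
        have "dist a z \<ge> d" using d that by (force simp: not_less[symmetric])
        thus ?thesis using x(1) dist_triangle[of a z x] by (simp add: dist_norm)
      qed
      have near: "norm (x - y) \<le> d / 3"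
        using x(1) y dist_triangle[of x y a] by (simp add: dist_norm norm_minus_commute)
      have "(\<lambda>z. 1 / (1 - (x - y) * (1 / (x - z)))) \<in> rat_approx T K"
      proof (rule rat_approx_geometric[OF rat_approx_cmult[OF x(2)]])
        fix z assume "z \<in> K"
        have "norm ((x - y) * (1 / (x - z))) = norm (x - y) / norm (x - z)"
          by (simp add: norm_divide)
        also have "\<dots> \<le> (d / 3) / (5 * d / 6)"
          using near far[OF \<open>z \<in> K\<close>] d by (intro frac_le) auto
        also have "\<dots> \<le> 1 / 2" using d by simp
        finally show "norm ((x - y) * (1 / (x - z))) \<le> 1 / 2" .
      qed
      from rat_approx_mult[OF x(2) this] show ?thesis
      proof (rule rat_approx_cong)
        fix z assume "z \<in> K"
        hence "x - z \<noteq> 0" using far[OF \<open>z \<in> K\<close>] d by auto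
        thus "1 / (y - z) = 1 / (x - z) * (1 / (1 - (x - y) * (1 / (x - z))))"
          by (simp add: divide_simps)
      qed
    qed
    show "\<exists>S. openin (top_of_set C) S \<and> a \<in> S \<and>
        (\<forall>x\<in>S. \<forall>y\<in>S. (\<lambda>z. 1 / (x - z)) \<in> rat_approx T K \<longrightarrow> (\<lambda>z. 1 / (y - z)) \<in> rat_approx T K)"
    proof (intro exI[of _ "C \<inter> ball a (d / 6)"] conjI ballI impI)
      fix x y assume "x \<in> C \<inter> ball a (d / 6)" "y \<in> C \<inter> ball a (d / 6)"
        "(\<lambda>z. 1 / (x - z)) \<in> rat_approx T K"
      thus "(\<lambda>z. 1 / (y - z)) \<in> rat_approx T K" by (intro *[of x y]) simp_all
    qed (use \<open>a \<in> C\<close> d in \<open>simp_all add: openin_open_Int\<close>)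
  qed
qed

text \<open>As the segment misses \<open>K\<close>, the integrand is uniformly continuous in
  parameter and \<open>z\<close> together. Riemann sums, which are combinations of Cauchy kernels,
  then approximate the integral uniformly on \<open>K\<close>.\<close>

lemma rat_approx_segment_integral:
  assumes kernel: "\<And>w. w \<notin> K \<Longrightarrow> (\<lambda>z. 1 / (w - z)) \<in> rat_approx T K"
    and disj: "closed_segment a b \<inter> K = {}"
    and h: "continuous_on (closed_segment a b) h"
  shows "(\<lambda>z. contour_integral (linepath a b) (\<lambda>w. h w / (w - z))) \<in> rat_approx T K"
proof -
  define g where "g = linepath a b"
  define \<phi> where "\<phi> = (\<lambda>(t, z). h (g t) * (b - a) * (1 / (g t - z)))"
  have g: "g t \<in> closed_segment a b" if "t \<in> {0..1}" for t
    using that linepath_in_path by (auto simp: g_def)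
  have gc: "continuous_on S g" for S unfolding g_def by (rule continuous_on_linepath)
  have gf: "continuous_on ({0..1} \<times> K) (\<lambda>p. g (fst p))"
    by (rule continuous_on_compose2[OF gc[of UNIV]]) (auto intro!: continuous_intros)
  moreover have "continuous_on ({0..1} \<times> K) (\<lambda>p. h (g (fst p)))"
    by (rule continuous_on_compose2[OF h gf]) (use g in auto)
  moreover have ne: "g t \<noteq> z" if "t \<in> {0..1}" "z \<in> K" for t z
    using g that disj by blast
  ultimately have cont: "continuous_on ({0..1} \<times> K) \<phi>"
    unfolding \<phi>_def case_prod_unfold by (intro continuous_intros) auto
  hence ucont: "uniformly_continuous_on ({0..1} \<times> K) \<phi>"
    by (intro compact_uniformly_continuous compact_Times K) auto
  have int: "(\<lambda>t. \<phi> (t, z)) integrable_on {c..d}" if "z \<in> K" "0 \<le> c" "d \<le> 1" for z c d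
    by (rule integrable_continuous_interval, rule continuous_on_compose2[OF cont])
      (use that in \<open>auto intro!: continuous_intros\<close>)
  have "(\<lambda>z. integral {0..1} (\<lambda>t. \<phi> (t, z))) \<in> rat_approx T K"
  proof (rule rat_approx_limit)
    fix \<epsilon> :: real assume "\<epsilon> > 0"
    \<comment> \<open>The admissible error is proportional to \<open>d - c\<close>, hence additive
      over adjacent intervals; this is what allows Bolzano's bisection to glue local
      estimates.\<close>
    define P where "P c d \<longleftrightarrow> (0 \<le> c \<and> c \<le> d \<and> d \<le> 1 \<longrightarrow> (\<exists>r\<in>rat_approx T K. \<forall>z\<in>K.
        norm (integral {c..d} (\<lambda>t. \<phi> (t, z)) - r z) \<le> \<epsilon> / 2 * (d - c)))" for c d
    have "P 0 1"
    proof (rule Bolzano)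
      fix c d e assume *: "P c d" "P d e" "c \<le> d" "d \<le> e"
      show "P c e" unfolding P_def
      proof
        assume ce: "0 \<le> c \<and> c \<le> e \<and> e \<le> 1"
        from * ce obtain r s where
          r: "r \<in> rat_approx T K" "\<forall>z\<in>K. norm (integral {c..d} (\<lambda>t. \<phi> (t, z)) - r z) \<le> \<epsilon> / 2 * (d - c)"
          and s: "s \<in> rat_approx T K" "\<forall>z\<in>K. norm (integral {d..e} (\<lambda>t. \<phi> (t, z)) - s z) \<le> \<epsilon> / 2 * (e - d)"
          unfolding P_def by force
        have "norm (integral {c..e} (\<lambda>t. \<phi> (t, z)) - (r z + s z)) \<le> \<epsilon> / 2 * (e - c)" if "z \<in> K" for z
        proof -
          have "integral {c..e} (\<lambda>t. \<phi> (t, z)) =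
              integral {c..d} (\<lambda>t. \<phi> (t, z)) + integral {d..e} (\<lambda>t. \<phi> (t, z))"
            using that ce * by (intro Henstock_Kurzweil_Integration.integral_combine[symmetric] int) auto
          hence "norm (integral {c..e} (\<lambda>t. \<phi> (t, z)) - (r z + s z)) \<le>
              norm (integral {c..d} (\<lambda>t. \<phi> (t, z)) - r z) + norm (integral {d..e} (\<lambda>t. \<phi> (t, z)) - s z)"
            by (metis add_diff_add norm_triangle_ineq)
          also have "\<dots> \<le> \<epsilon> / 2 * (d - c) + \<epsilon> / 2 * (e - d)"
            using r s that by (intro add_mono) auto
          also have "\<dots> = \<epsilon> / 2 * (e - c)" by (simp add: field_simps)
          finally show ?thesis .
        qed
        thus "\<exists>r\<in>rat_approx T K. \<forall>z\<in>K.
            norm (integral {c..e} (\<lambda>t. \<phi> (t, z)) - r z) \<le> \<epsilon> / 2 * (e - c)"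
          by (intro bexI[of _ "\<lambda>z. r z + s z"] rat_approx_add r(1) s(1) ballI)
      qed
    next
      fix x :: real assume x: "0 \<le> x" "x \<le> 1"
      obtain \<delta> where \<delta>: "\<delta> > 0" "\<And>p p'. p \<in> {0..1} \<times> K \<Longrightarrow> p' \<in> {0..1} \<times> K \<Longrightarrow>
          dist p' p < \<delta> \<Longrightarrow> dist (\<phi> p') (\<phi> p) < \<epsilon> / 2"
        using ucont \<open>\<epsilon> > 0\<close> unfolding uniformly_continuous_on_def by (metis half_gt_zero)
      \<comment> \<open>On a short interval around \<open>x\<close> the integrand is frozen at
        \<open>x\<close>, which leaves a constant multiple of a single kernel.\<close>
      have "(\<lambda>z. \<phi> (x, z)) \<in> rat_approx T K"
        unfolding \<phi>_def prod.case by (intro rat_approx_cmult kernel) (use x ne[of x] in auto)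
      hence ra: "(\<lambda>z. of_real (d - c) * \<phi> (x, z)) \<in> rat_approx T K" for c d
        by (rule rat_approx_cmult)
      have *: "norm (integral {c..d} (\<lambda>t. \<phi> (t, z)) - of_real (d - c) * \<phi> (x, z)) \<le> \<epsilon> / 2 * (d - c)"
        if cd: "c \<le> x" "x \<le> d" "d - c < \<delta>" "0 \<le> c" "d \<le> 1" and z: "z \<in> K" for c d z
      proof -
        have "((\<lambda>t. \<phi> (t, z) - \<phi> (x, z)) has_integral
            (integral {c..d} (\<lambda>t. \<phi> (t, z)) - of_real (d - c) * \<phi> (x, z))) {c..d}"
          using cd z has_integral_const_real[of "\<phi> (x, z)" c d]
          by (intro has_integral_diff integrable_integral int) (auto simp: scaleR_conv_of_real)
        moreover have "norm (\<phi> (t, z) - \<phi> (x, z)) \<le> \<epsilon> / 2" if "t \<in> {c..d}" for t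
          using \<delta>(2)[of "(x, z)" "(t, z)"] that cd z x
          by (auto simp: dist_Pair_Pair dist_norm dist_real_def less_imp_le)
        ultimately have "norm (integral {c..d} (\<lambda>t. \<phi> (t, z)) - of_real (d - c) * \<phi> (x, z))
            \<le> \<epsilon> / 2 * measure lborel {c..d}"
          using \<open>\<epsilon> > 0\<close> by (intro has_integral_bound_real) auto
        thus ?thesis using cd by simp
      qed
      thus "\<exists>\<delta>>0. \<forall>c d. c \<le> x \<and> x \<le> d \<and> d - c < \<delta> \<longrightarrow> P c d"
        unfolding P_def
      proof (intro exI[of _ \<delta>] conjI allI impI)
        fix c d assume "c \<le> x \<and> x \<le> d \<and> d - c < \<delta>" "0 \<le> c \<and> c \<le> d \<and> d \<le> 1"
        thus "\<exists>r\<in>rat_approx T K. \<forall>z\<in>K.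
            norm (integral {c..d} (\<lambda>t. \<phi> (t, z)) - r z) \<le> \<epsilon> / 2 * (d - c)"
          using * by (intro bexI[of _ "\<lambda>z. of_real (d - c) * \<phi> (x, z)"] ra ballI) simp
      qed (rule \<delta>(1))
    qed simp
    then obtain r where r: "r \<in> rat_approx T K"
      "\<forall>z\<in>K. norm (integral {0..1} (\<lambda>t. \<phi> (t, z)) - r z) \<le> \<epsilon> / 2"
      unfolding P_def by auto
    thus "\<exists>g\<in>rat_approx T K. \<forall>z\<in>K. norm (integral {0..1} (\<lambda>t. \<phi> (t, z)) - g z) < \<epsilon>"
      using \<open>\<epsilon> > 0\<close> by (intro bexI[of _ r]) (auto intro: le_less_trans)
  qed
  thus ?thesis
    unfolding contour_integral_integral by (simp add: \<phi>_def g_def mult_ac)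
qed

end

section \<open>Runge's theorem\<close>

lemma sum_diff_commute:
  fixes f :: "'a \<Rightarrow> 'b :: ab_group_add"
  assumes "finite A" "finite B"
  shows "sum f A - sum f B = sum f (A - B) - sum f (B - A)"
  using sum.Int_Diff[OF assms(1), of f B] sum.Int_Diff[OF assms(2), of f A]
  by (simp add: Int_commute)

text \<open>All four edges are oriented rightwards or upwards, the top and left ones thus with a
  minus sign. An edge shared by two grid squares is then literally the same path.\<close>

lemma contour_integral_rectpath:
  assumes "continuous_on (path_image (rectpath a b)) f" "Re a \<le> Re b" "Im a \<le> Im b"
  shows "contour_integral (rectpath a b) f =
    contour_integral (linepath a (Complex (Re b) (Im a))) f
    + contour_integral (linepath (Complex (Re b) (Im a)) b) f
    - contour_integral (linepath (Complex (Re a) (Im b)) b) f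
    - contour_integral (linepath a (Complex (Re a) (Im b))) f"
proof -
  define c d where "c = Complex (Re b) (Im a)" and "d = Complex (Re a) (Im b)"
  have "path_image (rectpath a b) =
      closed_segment a c \<union> closed_segment c b \<union> closed_segment b d \<union> closed_segment d a"
    by (simp add: rectpath_def Let_def path_image_join c_def d_def Un_assoc)
  with assms(1) have cont: "continuous_on (closed_segment a c) f" "continuous_on (closed_segment c b) f"
    "continuous_on (closed_segment b d) f" "continuous_on (closed_segment d a) f"
    by (auto intro: continuous_on_subset)
  have "contour_integral (rectpath a b) f = contour_integral (linepath a c) f +
    (contour_integral (linepath c b) f + (contour_integral (linepath b d) f + contour_integral (linepath d a) f))"
    unfolding rectpath_def Let_def c_def[symmetric] d_def[symmetric]
    using cont by (simp add: contour_integrable_continuous_linepath)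
  also have "contour_integral (linepath b d) f = - contour_integral (linepath d b) f"
    using cont by (intro contour_integral_reverse_linepath)
  also have "contour_integral (linepath d a) f = - contour_integral (linepath a d) f"
    using cont by (intro contour_integral_reverse_linepath)
  finally show ?thesis by (simp add: c_def d_def)
qed

text \<open>Comes from differentiability in \<open>z\<close> off the segment:
  \<open>Cauchy_next_derivative\<close> with exponent 1.\<close>

lemma isCont_segment_Cauchy_integral:
  assumes h: "continuous_on (closed_segment a b) h" and z: "z \<notin> closed_segment a b"
  shows "isCont (\<lambda>z. contour_integral (linepath a b) (\<lambda>w. h w / (w - z))) z"
proof -
  have "((\<lambda>z. contour_integral (linepath a b) (\<lambda>w. h w / (w - z) ^ 1)) has_field_derivative
      of_nat 1 * contour_integral (linepath a b) (\<lambda>u. h u / (u - z) ^ Suc 1)) (at z)"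
  proof (rule Cauchy_next_derivative(2)[where S = UNIV and B = "norm (b - a)"])
    fix w assume "w \<in> UNIV - path_image (linepath a b)"
    thus "((\<lambda>u. h u / (u - w) ^ 1) has_contour_integral
        contour_integral (linepath a b) (\<lambda>u. h u / (u - w) ^ 1)) (linepath a b)"
      by (intro has_contour_integral_integral contour_integrable_continuous_linepath
          continuous_intros h) auto
  qed (use assms in auto)
  thus ?thesis using DERIV_isCont by fastforce
qed

section \<open>Cauchy's formula over a square grid\<close>

context
  fixes s :: real
  assumes s: "s > 0"
begin

definition grid_pt :: "int \<times> int \<Rightarrow> complex" where
  "grid_pt p = Complex (s * fst p) (s * snd p)"

definition grid_sq :: "int \<times> int \<Rightarrow> complex set" where
  "grid_sq p = cbox (grid_pt p) (grid_pt (p + (1, 1)))"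

lemma grid_sq_iff:
  "z \<in> grid_sq p \<longleftrightarrow> s * fst p \<le> Re z \<and> Re z \<le> s * (fst p + 1) \<and> s * snd p \<le> Im z \<and> Im z \<le> s * (snd p + 1)"
  by (auto simp: grid_sq_def grid_pt_def in_cbox_complex_iff)

lemma grid_int_eqI:
  fixes i j :: int
  assumes "s * i < x" "x < s * (i + 1)" "s * j \<le> x" "x \<le> s * (j + 1)"
  shows "i = j"
proof -
  have "s * i < s * (j + 1)" "s * j < s * (i + 1)" using assms by linarith+
  hence "real_of_int i < j + 1" "real_of_int j < i + 1" using s by simp_all
  thus ?thesis by linarith
qed

lemma grid_sq_cover: "\<exists>p. z \<in> grid_sq p"
proof -
  have "z \<in> grid_sq (\<lfloor>Re z / s\<rfloor>, \<lfloor>Im z / s\<rfloor>)"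
    using floor_divide_lower[OF s, of "Re z"] floor_divide_lower[OF s, of "Im z"]
      floor_divide_upper[OF s, of "Re z"] floor_divide_upper[OF s, of "Im z"]
    by (auto simp: grid_sq_iff mult.commute)
  thus ?thesis by blast
qed

lemma grid_sq_diameter:
  assumes "z \<in> grid_sq p" "w \<in> grid_sq p"
  shows "norm (z - w) \<le> 2 * s"
proof -
  have "\<bar>Re z - Re w\<bar> \<le> s" "\<bar>Im z - Im w\<bar> \<le> s"
    using assms s by (auto simp: grid_sq_iff algebra_simps)
  thus ?thesis using cmod_le[of "z - w"] by simp
qed

lemma finite_grid_sq_meet:
  assumes "bounded K"
  shows "finite {p. grid_sq p \<inter> K \<noteq> {}}"
proof -
  obtain M where M: "\<And>z. z \<in> K \<Longrightarrow> norm z \<le> M" using assms bounded_iff by metis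
  define I where "I = {\<lfloor>- M / s\<rfloor> - 1..\<lceil>M / s\<rceil>}"
  have I: "i \<in> I" if "s * i \<le> x" "x \<le> s * (i + 1)" "\<bar>x\<bar> \<le> M" for i :: int and x
  proof -
    have "s * i \<le> M" "- M \<le> s * (i + 1)" using that by linarith+
    hence "i \<le> M / s" "- M / s \<le> i + 1" using s by (simp_all add: field_simps)
    thus ?thesis unfolding I_def by (simp; linarith)
  qed
  have "{p. grid_sq p \<inter> K \<noteq> {}} \<subseteq> I \<times> I"
  proof
    fix p assume "p \<in> {p. grid_sq p \<inter> K \<noteq> {}}"
    then obtain z where z: "z \<in> grid_sq p" "z \<in> K" by blast
    hence "\<bar>Re z\<bar> \<le> M" "\<bar>Im z\<bar> \<le> M"
      using M abs_Re_le_cmod abs_Im_le_cmod order_trans by blast+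
    hence "fst p \<in> I" "snd p \<in> I" using z I by (auto simp: grid_sq_iff)
    thus "p \<in> I \<times> I" by (cases p) auto
  qed
  thus ?thesis by (rule finite_subset) (simp add: I_def)
qed

text \<open>Cauchy's formula around the squares that meet \<open>K\<close>. An edge between two such
  squares is traversed in both directions and cancels; a surviving edge borders a square missing
  \<open>K\<close>, so it lies off \<open>K\<close> and its integral is approximable.\<close>

lemma rat_approx_holomorphic_grid:
  assumes K: "compact K" "K \<subseteq> T"
    and kernel: "\<And>w. w \<notin> K \<Longrightarrow> (\<lambda>z. 1 / (w - z)) \<in> rat_approx T K"
    and h: "h holomorphic_on U"
    and KU: "\<And>z. z \<in> K \<Longrightarrow> cball z (2 * s) \<subseteq> U"
  shows "h \<in> rat_approx T K"
proof -
  define \<S> where "\<S> = {p. grid_sq p \<inter> K \<noteq> {}}"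
  define up right :: "int \<times> int \<Rightarrow> int \<times> int"
    where "up p = p + (0, 1)" and "right p = p + (1, 0)" for p
  define H where "H p z = contour_integral (linepath (grid_pt p) (grid_pt (right p))) (\<lambda>w. h w / (w - z))" for p z
  define V where "V p z = contour_integral (linepath (grid_pt p) (grid_pt (up p))) (\<lambda>w. h w / (w - z))" for p z
  \<comment> \<open>Square \<open>p\<close> has bottom edge \<open>H p\<close>, left edge
    \<open>V p\<close>, top edge \<open>H (up p)\<close> and right edge \<open>V (right p)\<close>.
    \<open>F\<close> retains the edges that do not cancel.\<close>
  define F where "F z = (\<Sum>p\<in>\<S> - up ` \<S>. H p z) - (\<Sum>p\<in>up ` \<S> - \<S>. H p z)
      + (\<Sum>p\<in>right ` \<S> - \<S>. V p z) - (\<Sum>p\<in>\<S> - right ` \<S>. V p z)" for z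
  have fin: "finite \<S>"
    unfolding \<S>_def by (intro finite_grid_sq_meet compact_imp_bounded K)
  have sqU: "grid_sq p \<subseteq> U" if "p \<in> \<S>" for p
  proof
    fix w assume w: "w \<in> grid_sq p"
    from that obtain z where z: "z \<in> grid_sq p" "z \<in> K" by (auto simp: \<S>_def)
    from grid_sq_diameter[OF z(1) w] have "w \<in> cball z (2 * s)" by (simp add: dist_norm)
    thus "w \<in> U" using KU z by blast
  qed
  have sq_disj: "grid_sq p \<inter> K = {}" if "p \<notin> \<S>" for p using that by (simp add: \<S>_def)
  have segH: "closed_segment (grid_pt p) (grid_pt (right p)) \<subseteq> grid_sq p"
    "closed_segment (grid_pt (up p)) (grid_pt (right (up p))) \<subseteq> grid_sq p" for p
    unfolding grid_sq_def using s
    by (intro closed_segment_subset convex_box; simp add: in_cbox_complex_iff grid_pt_def up_def right_def)+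
  have segV: "closed_segment (grid_pt p) (grid_pt (up p)) \<subseteq> grid_sq p"
    "closed_segment (grid_pt (right p)) (grid_pt (up (right p))) \<subseteq> grid_sq p" for p
    unfolding grid_sq_def using s
    by (intro closed_segment_subset convex_box; simp add: in_cbox_complex_iff grid_pt_def up_def right_def)+
  have hc: "continuous_on U h" using h holomorphic_on_imp_continuous_on by blast

  have H: "H p \<in> rat_approx T K \<and> (\<forall>z\<in>K. isCont (H p) z)" if p: "p \<in> (\<S> - up ` \<S>) \<union> (up ` \<S> - \<S>)" for p
  proof -
    define e where "e = closed_segment (grid_pt p) (grid_pt (right p))"
    \<comment> \<open>The edge separates square \<open>p\<close> above from square \<open>q\<close>
      below, and exactly one of them meets \<open>K\<close>. That one keeps the edge inside
      \<open>U\<close>, the other keeps it off \<open>K\<close>.\<close>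
    obtain q where q: "p = up q" by (metis add_diff_cancel_right' diff_add_cancel up_def)
    have "p \<in> \<S> \<and> q \<notin> \<S> \<or> p \<notin> \<S> \<and> q \<in> \<S>"
      using p inj_image_mem_iff[of up q \<S>] by (auto simp: q inj_def up_def)
    moreover have "e \<subseteq> grid_sq p" "e \<subseteq> grid_sq q"
      using segH(1)[of p] segH(2)[of q] by (simp_all add: e_def q)
    ultimately have "e \<inter> K = {} \<and> e \<subseteq> U"
      using sqU[of p] sqU[of q] sq_disj[of p] sq_disj[of q] by fast
    hence e: "e \<inter> K = {}" "continuous_on e h" using hc continuous_on_subset by auto
    show ?thesis
      unfolding H_def[abs_def] using e[unfolded e_def]
      by (intro conjI ballI rat_approx_segment_integral[OF K kernel] isCont_segment_Cauchy_integral) auto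
  qed
  have V: "V p \<in> rat_approx T K \<and> (\<forall>z\<in>K. isCont (V p) z)" if p: "p \<in> (\<S> - right ` \<S>) \<union> (right ` \<S> - \<S>)" for p
  proof -
    define e where "e = closed_segment (grid_pt p) (grid_pt (up p))"
    obtain q where q: "p = right q" by (metis add_diff_cancel_right' diff_add_cancel right_def)
    have "p \<in> \<S> \<and> q \<notin> \<S> \<or> p \<notin> \<S> \<and> q \<in> \<S>"
      using p inj_image_mem_iff[of right q \<S>] by (auto simp: q inj_def right_def)
    moreover have "e \<subseteq> grid_sq p" "e \<subseteq> grid_sq q"
      using segV(1)[of p] segV(2)[of q] by (simp_all add: e_def q)
    ultimately have "e \<inter> K = {} \<and> e \<subseteq> U"
      using sqU[of p] sqU[of q] sq_disj[of p] sq_disj[of q] by fast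
    hence e: "e \<inter> K = {}" "continuous_on e h" using hc continuous_on_subset by auto
    show ?thesis
      unfolding V_def[abs_def] using e[unfolded e_def]
      by (intro conjI ballI rat_approx_segment_integral[OF K kernel] isCont_segment_Cauchy_integral) auto
  qed
  have Fra: "F \<in> rat_approx T K"
  proof -
    have "(\<lambda>z. (\<Sum>p\<in>\<S> - up ` \<S>. H p z) + (- 1) * (\<Sum>p\<in>up ` \<S> - \<S>. H p z)
      + (\<Sum>p\<in>right ` \<S> - \<S>. V p z) + (- 1) * (\<Sum>p\<in>\<S> - right ` \<S>. V p z)) \<in> rat_approx T K"
      by (intro rat_approx_add[OF K] rat_approx_cmult[OF K] rat_approx_sum[OF K]) (use H V in auto)
    thus ?thesis by (simp add: F_def[abs_def])
  qed
  have Fcont: "isCont F z" if "z \<in> K" for z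
    unfolding F_def[abs_def] by (intro continuous_intros) (use H V that in auto)

  \<comment> \<open>Off the grid lines each boundary integral is either a full Cauchy integral or
    zero. The claim covers the whole open square, also outside \<open>K\<close>, because the limit
    below may run through such points.\<close>
  have cauchy: "F z = 2 * pi * \<i> * h z" if p: "p \<in> \<S>" and z: "z \<in> box (grid_pt p) (grid_pt (p + (1, 1)))" for p z
  proof -
    have zi: "s * fst p < Re z" "Re z < s * (fst p + 1)" "s * snd p < Im z" "Im z < s * (snd p + 1)"
      using z by (auto simp: in_box_complex_iff grid_pt_def)
    have le: "Re (grid_pt q) \<le> Re (grid_pt (q + (1, 1)))" "Im (grid_pt q) \<le> Im (grid_pt (q + (1, 1)))" for q
      using s by (auto simp: grid_pt_def)
    have nz: "z \<notin> grid_sq q" if "q \<noteq> p" for q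
      using grid_int_eqI[OF zi(1,2)] grid_int_eqI[OF zi(3,4)] that
      by (auto simp: grid_sq_iff prod_eq_iff)
    have eq: "H q z + V (right q) z - H (up q) z - V q z = (if q = p then 2 * pi * \<i> * h z else 0)"
      if q: "q \<in> \<S>" for q
    proof -
      let ?R = "rectpath (grid_pt q) (grid_pt (q + (1, 1)))"
      have im: "path_image ?R \<subseteq> grid_sq q - {z}"
      proof (cases "q = p")
        case True
        thus ?thesis using z path_image_rectpath_cbox_minus_box[OF le] by (auto simp: grid_sq_def)
      next
        case False
        thus ?thesis using nz path_image_rectpath_subset_cbox[OF le] by (auto simp: grid_sq_def)
      qed
      have hol: "h holomorphic_on grid_sq q" using sqU[OF q] h holomorphic_on_subset by blast
      have cont: "continuous_on (path_image ?R) (\<lambda>w. h w / (w - z))"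
        by (intro continuous_intros continuous_on_subset[OF holomorphic_on_imp_continuous_on[OF hol]])
          (use im in auto)
      have "((\<lambda>w. h w / (w - z)) has_contour_integral (if q = p then 2 * pi * \<i> * h z else 0)) ?R"
      proof (cases "q = p")
        case True
        have "((\<lambda>w. h w / (w - z)) has_contour_integral (2 * pi * \<i> * winding_number ?R z * h z)) ?R"
          by (rule Cauchy_integral_formula_convex_simple[OF _ hol])
            (use im z True in \<open>auto simp: grid_sq_def convex_box interior_cbox\<close>)
        thus ?thesis using z True by (simp add: winding_number_rectpath)
      next
        case False
        have "((\<lambda>w. h w / (w - z)) has_contour_integral 0) ?R"
          by (rule Cauchy_theorem_convex_simple[of _ "grid_sq q"])
            (use im nz[OF False] hol in \<open>auto intro!: holomorphic_intros simp: grid_sq_def convex_box\<close>)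
        thus ?thesis using False by simp
      qed
      hence "contour_integral ?R (\<lambda>w. h w / (w - z)) = (if q = p then 2 * pi * \<i> * h z else 0)"
        by (rule contour_integral_unique)
      moreover have pts: "Complex (Re (grid_pt (q + (1, 1)))) (Im (grid_pt q)) = grid_pt (right q)"
        "Complex (Re (grid_pt q)) (Im (grid_pt (q + (1, 1)))) = grid_pt (up q)"
        "q + (1, 1) = up (right q)" "up (right q) = right (up q)"
        by (simp_all add: grid_pt_def right_def up_def prod_eq_iff)
      have "contour_integral ?R (\<lambda>w. h w / (w - z)) = H q z + V (right q) z - H (up q) z - V q z"
        unfolding contour_integral_rectpath[OF cont le] pts(1,2) H_def V_def by (simp add: pts(3,4))
      ultimately show ?thesis by simp
    qed
    have inj: "inj_on up \<S>" "inj_on right \<S>" by (auto simp: inj_on_def up_def right_def)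
    have "F z = (sum (\<lambda>p. H p z) \<S> - sum (\<lambda>p. H p z) (up ` \<S>))
        + (sum (\<lambda>p. V p z) (right ` \<S>) - sum (\<lambda>p. V p z) \<S>)"
      by (simp only: F_def sum_diff_commute[OF fin finite_imageI[OF fin]]
          sum_diff_commute[OF finite_imageI[OF fin] fin] add_diff_eq)
    also have "\<dots> = (\<Sum>q\<in>\<S>. H q z + V (right q) z - H (up q) z - V q z)"
      using inj by (simp add: sum.reindex sum.distrib sum_subtractf)
    also have "\<dots> = (\<Sum>q\<in>\<S>. if q = p then 2 * pi * \<i> * h z else 0)"
      by (intro sum.cong eq refl)
    also have "\<dots> = 2 * pi * \<i> * h z" using fin p by simp
    finally show ?thesis .
  qed
  \<comment> \<open>Points of \<open>K\<close> on grid lines are reached by continuity: the open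
    square is dense in the closed one, and the edges left in \<open>F\<close> avoid
    \<open>K\<close>.\<close>
  have "F z = 2 * pi * \<i> * h z" if z: "z \<in> K" for z
  proof -
    obtain p where p: "z \<in> grid_sq p" using grid_sq_cover by blast
    hence pS: "p \<in> \<S>" using z by (auto simp: \<S>_def)
    let ?B = "box (grid_pt p) (grid_pt (p + (1, 1)))"
    have "?B \<noteq> {}" using s by (auto simp: box_ne_empty Basis_complex_def grid_pt_def)
    hence "z \<in> closure ?B" using p by (simp add: closure_box grid_sq_def)
    then obtain u where u: "\<And>n. u n \<in> ?B" "u \<longlonglongrightarrow> z" unfolding closure_sequential by blast
    have "continuous_on (ball z (2 * s)) h"
      by (rule continuous_on_subset[OF hc]) (use KU[OF z] in auto)
    moreover have "open (ball z (2 * s))" "z \<in> ball z (2 * s)" using s by auto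
    ultimately have "isCont h z" by (simp add: continuous_on_eq_continuous_at)
    hence "(\<lambda>n. 2 * pi * \<i> * h (u n)) \<longlonglongrightarrow> 2 * pi * \<i> * h z"
      by (intro tendsto_mult tendsto_const isCont_tendsto_compose[OF _ u(2)])
    hence "(\<lambda>n. F (u n)) \<longlonglongrightarrow> 2 * pi * \<i> * h z" by (simp only: cauchy[OF pS u(1)])
    thus ?thesis by (rule LIMSEQ_unique[OF isCont_tendsto_compose[OF Fcont[OF z] u(2)]])
  qed
  from rat_approx_cong[OF K rat_approx_cmult[OF K Fra, of "1 / (2 * pi * \<i>)"]] this
  show ?thesis by simp
qed

end

text \<open>Cauchy's estimate turns uniform closeness on the \<delta>-neighbourhood
  \<open>K1\<close> into closeness of derivatives on \<open>K\<close>. Since only orders up to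
  \<open>L\<close> are asked for, one tolerance suffices.\<close>

lemma Runge_higher_deriv:
  assumes U: "open U" "T \<subseteq> U" "h holomorphic_on U" and K: "compact K" "K \<subseteq> T" and "\<epsilon> > 0"
  obtains A B where "\<And>z. z \<in> T \<Longrightarrow> poly B z \<noteq> 0"
    "\<And>l z. l \<le> L \<Longrightarrow> z \<in> K \<Longrightarrow>
      norm ((deriv ^^ l) (\<lambda>z. poly A z / poly B z) z - (deriv ^^ l) h z) < \<epsilon>"
proof -
  have KU: "K \<subseteq> U" using K U by blast
  obtain \<delta> where \<delta>: "\<delta> > 0" "(\<Union>x\<in>K. cball x \<delta>) \<subseteq> U"
    using compact_subset_open_imp_cball_epsilon_subset[OF K(1) U(1) KU] .
  define K1 where "K1 = (\<Union>x\<in>K. cball x \<delta>)"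
  have "K1 = (\<lambda>p. fst p + snd p) ` (K \<times> cball 0 \<delta>)"
  proof (intro equalityI subsetI)
    fix y assume "y \<in> K1"
    then obtain x where "x \<in> K" "y \<in> cball x \<delta>" by (auto simp: K1_def)
    thus "y \<in> (\<lambda>p. fst p + snd p) ` (K \<times> cball 0 \<delta>)"
      by (intro image_eqI[of _ _ "(x, y - x)"]) (auto simp: dist_norm norm_minus_commute)
  next
    fix y assume "y \<in> (\<lambda>p. fst p + snd p) ` (K \<times> cball 0 \<delta>)"
    then obtain x u where "x \<in> K" "norm u \<le> \<delta>" "y = x + u" by auto
    thus "y \<in> K1" unfolding K1_def by (intro UN_I[of x]) (auto simp: dist_norm)
  qed
  hence K1: "compact K1"
    using K by (auto intro!: compact_continuous_image compact_Times continuous_intros)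

  text \<open>Holes of \<open>K1\<close> in which no pole is allowed are filled; they lie in \<open>T\<close>, hence in \<open>U\<close>.\<close>

  define \<B> where "\<B> = {C \<in> components (- K1). bounded C \<and> C \<subseteq> T}"
  define K2 where "K2 = K1 \<union> \<Union>\<B>"
  have K2U: "K2 \<subseteq> U" using \<delta> U by (auto simp: K2_def K1_def \<B>_def)
  have disj: "C \<inter> \<Union>\<B> = {}" if "C \<in> components (- K1)" "C \<notin> \<B>" for C
    using that components_nonoverlap unfolding \<B>_def by blast
  \<comment> \<open>The unfilled components of \<open>- K1\<close> make up exactly
    \<open>- K2\<close>; as they are open, \<open>K2\<close> is closed.\<close>
  define X Y where "X = \<Union>(components (- K1) - \<B>)" and "Y = \<Union>\<B>"
  have "components (- K1) = (components (- K1) - \<B>) \<union> \<B>" by (auto simp: \<B>_def)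
  hence "\<Union>(components (- K1)) = X \<union> Y" unfolding X_def Y_def by (metis Union_Un_distrib)
  hence "X \<union> Y = - K1" by simp
  moreover have "X \<inter> Y = {}" unfolding X_def Y_def using disj by auto
  ultimately have "- (K1 \<union> Y) = X" by fast
  hence "- K2 = \<Union>(components (- K1) - \<B>)" by (simp add: K2_def X_def Y_def)
  moreover have "open (- K1)" using K1 compact_imp_closed by blast
  hence "open (\<Union>(components (- K1) - \<B>))" by (intro open_Union) (auto intro: open_components)
  ultimately have "closed K2" by (simp add: closed_def)
  \<comment> \<open>There may be infinitely many filled holes, but all of them lie in the bounded
    set \<open>inside K1\<close>.\<close>
  moreover have "\<Union>\<B> \<subseteq> inside K1"
  proof
    fix x assume "x \<in> \<Union>\<B>"
    then obtain C where C: "C \<in> components (- K1)" "bounded C" "x \<in> C" by (auto simp: \<B>_def)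
    hence "x \<in> - K1" using in_components_subset by blast
    moreover obtain y where "C = connected_component_set (- K1) y" using C(1) by (auto simp: components_iff)
    hence "C = connected_component_set (- K1) x" using C(3) connected_component_eq by metis
    ultimately show "x \<in> inside K1" using C by (auto simp: inside_def)
  qed
  hence "bounded K2"
    using K1 compact_imp_bounded bounded_inside bounded_subset unfolding K2_def by (metis bounded_Un)
  ultimately have K2: "compact K2" by (simp add: compact_eq_bounded_closed)

  \<comment> \<open>\<open>K1\<close> may stick out of \<open>T\<close>, so poles are kept off
    \<open>T \<union> K2\<close>. A bounded component of \<open>- K2\<close> contains an unfilled
    component of \<open>- K1\<close>, and this has a point outside \<open>T\<close>.\<close>
  have kernel: "(\<lambda>z. 1 / (w - z)) \<in> rat_approx (T \<union> K2) K2" if "w \<notin> K2" for w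
  proof (rule rat_approx_kernel[OF K2 _ _ that])
    fix C2 assume C2: "C2 \<in> components (- K2)" "bounded C2"
    then obtain x where x: "x \<in> C2" using in_components_nonempty by blast
    hence "x \<notin> K2" using C2 in_components_subset by blast
    hence "x \<in> - K1" by (auto simp: K2_def)
    define C where "C = connected_component_set (- K1) x"
    have C: "C \<in> components (- K1)" "x \<in> C" using \<open>x \<in> - K1\<close> by (auto simp: C_def componentsI)
    hence "C \<notin> \<B>" using \<open>x \<notin> K2\<close> by (auto simp: K2_def)
    hence CK: "C \<subseteq> - K2" using disj[OF C(1)] in_components_subset[OF C(1)] by (auto simp: K2_def)
    hence "C \<subseteq> C2"
      using components_maximal[OF C2(1)] in_components_connected[OF C(1)] C x by blast
    hence "\<not> C \<subseteq> T" using C(1) C2(2) \<open>C \<notin> \<B>\<close> bounded_subset by (auto simp: \<B>_def)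
    thus "\<not> C2 \<subseteq> T \<union> K2" using CK \<open>C \<subseteq> C2\<close> by blast
  qed simp
  obtain s0 where s0: "s0 > 0" "(\<Union>x\<in>K2. cball x s0) \<subseteq> U"
    using compact_subset_open_imp_cball_epsilon_subset[OF K2 U(1) K2U] .
  \<comment> \<open>The grid lemma wants discs of radius twice the mesh, whence mesh
    \<open>s0 / 2\<close>.\<close>
  have "h \<in> rat_approx (T \<union> K2) K2"
    by (rule rat_approx_holomorphic_grid[of "s0 / 2" _ _ h U]) (use s0 K2 kernel U in auto)
  \<comment> \<open>\<open>S\<close> dominates the factors \<open>fact l / \<delta> ^ l\<close> of
    Cauchy's estimate for all \<open>l \<le> L\<close>; the extra 2 in \<eta> makes the final bound
    strict.\<close>
  moreover define S where "S = (\<Sum>n\<le>L. fact n / \<delta> ^ n)"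
  have S: "fact n / \<delta> ^ n \<le> S" if "n \<le> L" for n
    unfolding S_def by (rule member_le_sum) (use that \<delta> in auto)
  hence "S > 0" using S[of 0] by simp
  moreover define \<eta> where "\<eta> = \<epsilon> / (2 * S)"
  ultimately have "\<eta> > 0" using \<open>\<epsilon> > 0\<close> by simp
  then obtain r where r: "r \<in> ratfun (T \<union> K2)" "\<And>z. z \<in> K2 \<Longrightarrow> norm (h z - r z) < \<eta>"
    using rat_approxE[OF \<open>h \<in> rat_approx (T \<union> K2) K2\<close>] by metis
  then obtain A B where AB: "r = (\<lambda>z. poly A z / poly B z)" "\<And>z. z \<in> T \<union> K2 \<Longrightarrow> poly B z \<noteq> 0"
    unfolding ratfun_def by blast
  show ?thesis
  proof
    fix l z assume l: "l \<le> L" and z: "z \<in> K"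
    have cb: "cball z \<delta> \<subseteq> K2" using z by (auto simp: K2_def K1_def)
    hence cbU: "cball z \<delta> \<subseteq> U" using K2U by blast
    have hol: "r holomorphic_on cball z \<delta>" "h holomorphic_on cball z \<delta>"
      using cb AB holomorphic_on_subset[OF U(3) cbU] by (auto intro!: holomorphic_intros)
    hence hol': "r holomorphic_on ball z \<delta>" "h holomorphic_on ball z \<delta>"
      using holomorphic_on_subset ball_subset_cball by blast+
    have near: "norm (r w - h w) < \<eta>" if "w \<in> cball z \<delta>" for w
      using r(2)[of w] that cb by (auto simp: norm_minus_commute)
    have "norm ((deriv ^^ l) (\<lambda>w. r w - h w) z) < \<epsilon>"
    proof (cases "l = 0")
      case True
      have "\<eta> \<le> \<eta> * S * 1" using S[of 0] \<open>\<eta> > 0\<close> by simp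
      also have "\<dots> < \<epsilon>" using \<open>S > 0\<close> \<open>\<epsilon> > 0\<close> by (simp add: \<eta>_def)
      finally show ?thesis using near[of z] \<delta> True by simp
    next
      case False
      have "norm ((deriv ^^ l) (\<lambda>w. r w - h w) z) \<le> fact l * \<eta> / \<delta> ^ l"
        using hol hol' near \<delta> False
        by (intro Cauchy_higher_deriv_bound[where y = 0])
          (auto intro!: holomorphic_intros continuous_intros holomorphic_on_imp_continuous_on)
      also have "\<dots> = \<eta> * (fact l / \<delta> ^ l)" by simp
      also have "\<dots> \<le> \<eta> * S" using S[OF l] \<open>\<eta> > 0\<close> by (intro mult_left_mono) auto
      also have "\<dots> < \<epsilon>" using \<open>S > 0\<close> \<open>\<epsilon> > 0\<close> by (simp add: \<eta>_def)
      finally show ?thesis .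
    qed
    also have "(deriv ^^ l) (\<lambda>w. r w - h w) z = (deriv ^^ l) r z - (deriv ^^ l) h z"
      using hol' \<delta> by (intro higher_deriv_diff[of _ "ball z \<delta>"]) auto
    finally show "norm ((deriv ^^ l) (\<lambda>z. poly A z / poly B z) z - (deriv ^^ l) h z) < \<epsilon>"
      by (simp add: AB(1))
  qed (use AB in blast)
qed

section \<open>Pad\'e fractions of formal power series\<close>

definition hankel_mat :: "nat \<Rightarrow> nat \<Rightarrow> complex fps \<Rightarrow> complex mat" where
  "hankel_mat p q F = Matrix.mat q q (\<lambda>(i, j).
     let k = int p - int q + int i + int j + 1 in if k < 0 then 0 else fps_nth F (nat k))"

text \<open>Clearing the denominator makes the Pade condition linear. Nothing is lost, because a
  series with constant term 1 is invertible.\<close>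

definition pade_fraction :: "nat \<Rightarrow> nat \<Rightarrow> complex fps \<Rightarrow> complex poly \<Rightarrow> complex poly \<Rightarrow> bool" where
  "pade_fraction p q F N Q \<longleftrightarrow> degree N \<le> p \<and> degree Q \<le> q \<and> coeff Q 0 = 1 \<and>
     (\<forall>v\<le>p + q. fps_nth (fps_of_poly Q * F) v = coeff N v)"

lemma hankel_mat_carrier [simp]: "hankel_mat p q F \<in> carrier_mat q q"
  by (simp add: hankel_mat_def)

text \<open>A Hankel row against the reversed coefficients of \<open>D\<close> is a convolution sum.
  The entries set to zero for negative index stand for the degrees of \<open>D\<close> beyond
  \<open>p + 1 + i\<close>.\<close>

lemma hankel_mat_mult_vec:
  assumes "degree D \<le> q" "coeff D 0 = 0" "i < q"
  shows "vec_index (hankel_mat p q F *\<^sub>v Matrix.vec q (\<lambda>j. coeff D (q - j))) i =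
    fps_nth (fps_of_poly D * F) (p + 1 + i)"
proof -
  let ?n = "p + 1 + i"
  have "fps_nth (fps_of_poly D * F) ?n = (\<Sum>k=0..?n. coeff D k * fps_nth F (?n - k))"
    by (simp add: fps_mult_nth)
  also have "\<dots> = (\<Sum>k=1..q. if k \<le> ?n then coeff D k * fps_nth F (?n - k) else 0)"
  proof (rule sum.mono_neutral_cong)
    fix k assume "k \<in> {0..?n} - {1..q}"
    hence "k = 0 \<or> k > degree D" using assms by auto
    thus "coeff D k * fps_nth F (?n - k) = 0" using assms by (auto simp: coeff_eq_0)
  qed auto
  also have "\<dots> = (\<Sum>j<q. if q - j \<le> ?n then coeff D (q - j) * fps_nth F (?n - (q - j)) else 0)"
    by (rule sum.reindex_bij_witness[of _ "\<lambda>j. q - j" "\<lambda>k. q - k"]) auto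
  also have "\<dots> = (\<Sum>j<q. hankel_mat p q F $$ (i, j) * coeff D (q - j))"
  proof (rule sum.cong[OF refl])
    fix j assume j: "j \<in> {..<q}"
    show "(if q - j \<le> ?n then coeff D (q - j) * fps_nth F (?n - (q - j)) else 0) =
        hankel_mat p q F $$ (i, j) * coeff D (q - j)"
    proof (cases "q - j \<le> ?n")
      case True
      hence "\<not> int p - int q + int i + int j + 1 < 0"
        "nat (int p - int q + int i + int j + 1) = ?n - (q - j)" using j by auto
      thus ?thesis using True j assms by (simp add: hankel_mat_def)
    next
      case False
      hence "int p - int q + int i + int j + 1 < 0" using j by auto
      thus ?thesis using False j assms by (simp add: hankel_mat_def)
    qed
  qed
  also have "\<dots> = vec_index (hankel_mat p q F *\<^sub>v Matrix.vec q (\<lambda>j. coeff D (q - j))) i"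
    using assms by (simp add: hankel_mat_def scalar_prod_def atLeast0LessThan)
  finally show ?thesis ..
qed

text \<open>Kernel vectors of the Hankel matrix are polynomials \<open>D\<close> without constant
  term for which \<open>D * F\<close> has a gap in the degrees \<open>p + 1\<close> to
  \<open>p + q\<close>. Nonvanishing of the determinant thus becomes a question about degrees and
  divisibility.\<close>

lemma hankel_det_nonzero_iff:
  "Determinant.det (hankel_mat p q F) \<noteq> 0 \<longleftrightarrow>
     (\<forall>D. degree D \<le> q \<and> coeff D 0 = 0 \<and> (\<forall>v\<in>{p+1..p+q}. fps_nth (fps_of_poly D * F) v = 0) \<longrightarrow> D = 0)"
  (is "?lhs \<longleftrightarrow> ?rhs")
proof
  assume det: ?lhs
  show ?rhs
  proof (intro allI impI)
    fix D assume D: "degree D \<le> q \<and> coeff D 0 = 0 \<and>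
      (\<forall>v\<in>{p+1..p+q}. fps_nth (fps_of_poly D * F) v = 0)"
    let ?v = "Matrix.vec q (\<lambda>j. coeff D (q - j))"
    have "hankel_mat p q F *\<^sub>v ?v = 0\<^sub>v q"
    proof
      fix i assume "i < dim_vec (0\<^sub>v q :: complex Matrix.vec)"
      thus "vec_index (hankel_mat p q F *\<^sub>v ?v) i = vec_index (0\<^sub>v q) i"
        using D hankel_mat_mult_vec[of D q i p F] by simp
    qed (simp add: hankel_mat_def)
    hence "?v = 0\<^sub>v q"
      using det det_0_iff_vec_prod_zero_field[OF hankel_mat_carrier] by (metis vec_carrier)
    hence *: "coeff D (q - j) = 0" if "j < q" for j
      using that by (metis index_vec index_zero_vec(1))
    have "coeff D k = 0" for k
    proof (cases "k = 0 \<or> k > q")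
      case False
      thus ?thesis using *[of "q - k"] by simp
    qed (use D in \<open>auto intro: coeff_eq_0\<close>)
    thus "D = 0" by (simp add: poly_eq_iff)
  qed
next
  assume R: ?rhs
  show ?lhs
  proof
    assume "Determinant.det (hankel_mat p q F) = 0"
    then obtain v where v: "v \<in> carrier_vec q" "v \<noteq> 0\<^sub>v q" "hankel_mat p q F *\<^sub>v v = 0\<^sub>v q"
      using det_0_iff_vec_prod_zero_field[OF hankel_mat_carrier] by blast
    define D where "D = (\<Sum>k=1..q. monom (vec_index v (q - k)) k)"
    have coeff: "coeff D k = (if k \<in> {1..q} then vec_index v (q - k) else 0)" for k
      by (simp add: D_def coeff_sum)
    have deg: "degree D \<le> q" by (rule degree_le) (simp add: coeff)
    have vD: "v = Matrix.vec q (\<lambda>j. coeff D (q - j))" using v(1) by (auto simp: coeff)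
    have "fps_nth (fps_of_poly D * F) m = 0" if "m \<in> {p+1..p+q}" for m
    proof -
      have "fps_nth (fps_of_poly D * F) (p + 1 + (m - p - 1)) = vec_index (0\<^sub>v q) (m - p - 1)"
        using hankel_mat_mult_vec[OF deg, of "m - p - 1" p F] that v(3) vD by (auto simp: coeff)
      thus ?thesis using that by auto
    qed
    hence "D = 0" using R deg by (simp add: coeff)
    hence "v = 0\<^sub>v q" using vD by auto
    thus False using v by simp
  qed
qed

text \<open>Cramer's rule, through the adjugate, for the system that kills the coefficients
  \<open>p + 1\<close> to \<open>p + q\<close> of \<open>Q * F\<close>. The explicit formula, in
  place of a chosen solution, allows continuity in \<open>F\<close> to be proved term by
  term.\<close>

definition pade_den :: "nat \<Rightarrow> nat \<Rightarrow> complex fps \<Rightarrow> complex poly" where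
  "pade_den p q F = 1 + (\<Sum>k=1..q. monom ((\<Sum>i<q. adj_mat (hankel_mat p q F) $$ (q - k, i) *
     - fps_nth F (p + 1 + i)) / Determinant.det (hankel_mat p q F)) k)"

definition pade_num :: "nat \<Rightarrow> nat \<Rightarrow> complex fps \<Rightarrow> complex poly" where
  "pade_num p q F = (\<Sum>k\<le>p. monom (fps_nth (fps_of_poly (pade_den p q F) * F) k) k)"

lemma coeff_pade_den:
  "coeff (pade_den p q F) k = (if k = 0 then 1 else if k \<le> q then (\<Sum>i<q. adj_mat (hankel_mat p q F) $$ (q - k, i) *
     - fps_nth F (p + 1 + i)) / Determinant.det (hankel_mat p q F) else 0)"
  by (auto simp: pade_den_def coeff_sum)

lemma coeff_pade_num:
  "coeff (pade_num p q F) k = (if k \<le> p then fps_nth (fps_of_poly (pade_den p q F) * F) k else 0)"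
  by (simp add: pade_num_def coeff_sum)

lemma pade_fraction_pade_num_den:
  assumes det: "Determinant.det (hankel_mat p q F) \<noteq> 0"
  shows "pade_fraction p q F (pade_num p q F) (pade_den p q F)"
proof -
  let ?M = "hankel_mat p q F" and ?Q = "pade_den p q F"
  let ?d = "Determinant.det ?M"
  define b where "b = Matrix.vec q (\<lambda>i. - fps_nth F (p + 1 + i))"
  define x where "x = (1 / ?d) \<cdot>\<^sub>v (adj_mat ?M *\<^sub>v b)"
  have adj: "adj_mat ?M \<in> carrier_mat q q" "?M * adj_mat ?M = ?d \<cdot>\<^sub>m 1\<^sub>m q"
    using adj_mat[OF hankel_mat_carrier] by auto
  have b: "b \<in> carrier_vec q" by (simp add: b_def)
  have "?M *\<^sub>v x = (1 / ?d) \<cdot>\<^sub>v ((?M * adj_mat ?M) *\<^sub>v b)"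
    unfolding x_def using adj(1) b
    by (subst mult_mat_vec[OF hankel_mat_carrier]) (auto simp: assoc_mult_mat_vec[OF hankel_mat_carrier])
  also have "(?M * adj_mat ?M) *\<^sub>v b = ?d \<cdot>\<^sub>v b"
    unfolding adj(2) using b by (intro eq_vecI) (auto simp: scalar_prod_def if_distrib if_distribR cong: if_cong)
  also have "(1 / ?d) \<cdot>\<^sub>v (?d \<cdot>\<^sub>v b) = b" using det b by (simp add: smult_smult_assoc)
  finally have Mx: "?M *\<^sub>v x = b" .
  \<comment> \<open>The solution lists the coefficients of \<open>?Q - 1\<close> from degree
    \<open>q\<close> downwards, matching the index reversal in
    \<open>hankel_mat_mult_vec\<close>.\<close>
  have x: "x = Matrix.vec q (\<lambda>j. coeff (?Q - 1) (q - j))"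
  proof
    fix j assume "j < dim_vec (Matrix.vec q (\<lambda>j. coeff (?Q - 1) (q - j)))"
    thus "vec_index x j = vec_index (Matrix.vec q (\<lambda>j. coeff (?Q - 1) (q - j))) j"
      using adj(1) by (simp add: x_def b_def coeff_pade_den scalar_prod_def atLeast0LessThan)
  qed (use adj(1) in \<open>simp add: x_def\<close>)
  have degQ: "degree ?Q \<le> q" by (rule degree_le) (simp add: coeff_pade_den)
  hence "degree (?Q - 1) \<le> q" by (intro degree_diff_le) auto
  have *: "fps_nth (fps_of_poly (?Q - 1) * F) (p + 1 + i) = - fps_nth F (p + 1 + i)" if "i < q" for i
  proof -
    have "coeff (?Q - 1) 0 = 0" by (simp add: coeff_pade_den)
    from hankel_mat_mult_vec[OF \<open>degree (?Q - 1) \<le> q\<close> this that, of p F, folded x, unfolded Mx]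
    show ?thesis using that by (simp add: b_def)
  qed
  have "fps_nth (fps_of_poly ?Q * F) v = coeff (pade_num p q F) v" if "v \<le> p + q" for v
  proof (cases "v \<le> p")
    case False
    hence "v = p + 1 + (v - p - 1)" "v - p - 1 < q" using that by auto
    with *[of "v - p - 1"] have "fps_nth (fps_of_poly (?Q - 1) * F) v = - fps_nth F v" by metis
    thus ?thesis using False by (simp add: coeff_pade_num fps_of_poly_diff algebra_simps)
  qed (simp add: coeff_pade_num)
  moreover have "degree (pade_num p q F) \<le> p" by (rule degree_le) (simp add: coeff_pade_num)
  ultimately show ?thesis using degQ by (simp add: pade_fraction_def coeff_pade_den)
qed

lemma fps_mult_nth_cong:
  fixes A B C :: "'a :: comm_ring_1 fps"
  assumes "\<And>v. v \<le> n \<Longrightarrow> fps_nth A v = fps_nth B v" "v \<le> n"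
  shows "fps_nth (C * A) v = fps_nth (C * B) v"
  unfolding fps_mult_nth by (rule sum.cong) (use assms in auto)

text \<open>Up to order \<open>p + q\<close> both products equal \<open>Q * Q' * F\<close>, and
  their degrees do not exceed \<open>p + q\<close>.\<close>

lemma pade_fraction_unique:
  assumes "pade_fraction p q F N Q" "pade_fraction p q F N' Q'"
  shows "N * Q' = N' * Q"
proof (rule poly_eqI)
  fix v
  show "coeff (N * Q') v = coeff (N' * Q) v"
  proof (cases "v \<le> p + q")
    case True
    have "coeff (N * Q') v = fps_nth (fps_of_poly Q' * fps_of_poly N) v"
      by (simp flip: fps_of_poly_mult add: mult.commute)
    also have "\<dots> = fps_nth (fps_of_poly Q' * (fps_of_poly Q * F)) v"
      using assms True by (intro fps_mult_nth_cong[of "p + q"]) (auto simp: pade_fraction_def)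
    also have "\<dots> = fps_nth (fps_of_poly Q * (fps_of_poly Q' * F)) v"
      by (simp add: mult_ac)
    also have "\<dots> = fps_nth (fps_of_poly Q * fps_of_poly N') v"
      using assms True by (intro fps_mult_nth_cong[of "p + q"]) (auto simp: pade_fraction_def)
    also have "\<dots> = coeff (N' * Q) v"
      by (simp flip: fps_of_poly_mult add: mult.commute)
    finally show ?thesis .
  next
    case False
    moreover have "degree (N * Q') \<le> p + q" "degree (N' * Q) \<le> p + q"
      using assms degree_mult_le[of N Q'] degree_mult_le[of N' Q] unfolding pade_fraction_def by linarith+
    ultimately show ?thesis by (simp add: coeff_eq_0)
  qed
qed

text \<open>
  A common zero could be cancelled, which would turn the quotient denominator, multiplied by the
  variable, into a kernel vector of the Hankel matrix.
\<close>

lemma pade_fraction_no_common_zero: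
  assumes det: "Determinant.det (hankel_mat p q F) \<noteq> 0" and NQ: "pade_fraction p q F N Q"
    and zero: "poly N w = 0" "poly Q w = 0"
  shows False
proof -
  obtain N1 Q1 where f: "N = [:- w, 1:] * N1" "Q = [:- w, 1:] * Q1"
    using zero by (metis dvdE poly_eq_0_iff_dvd)
  let ?L = "[:- w, 1:]" and ?D = "[:0, 1:] * Q1"
  have "coeff Q 0 = 1" using NQ by (simp add: pade_fraction_def)
  hence Q1: "Q1 \<noteq> 0" and w: "w \<noteq> 0" by (auto simp: f)
  \<comment> \<open>The constant term 1 of \<open>Q\<close> forces \<open>w \<noteq> 0\<close>, so
    the linear factor is invertible as a series and can be cancelled without losing order.\<close>
  have inv: "inverse (fps_of_poly ?L) * fps_of_poly ?L = 1"
    using w by (intro inverse_mult_eq_1) simp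
  have eq: "fps_nth (fps_of_poly Q1 * F) v = coeff N1 v" if "v \<le> p + q" for v
  proof -
    have "fps_of_poly Q1 * F = inverse (fps_of_poly ?L) * (fps_of_poly Q * F)"
      using inv by (simp only: f fps_of_poly_mult) (simp add: mult.assoc[symmetric])
    also have "fps_nth \<dots> v = fps_nth (inverse (fps_of_poly ?L) * fps_of_poly N) v"
      using NQ that by (intro fps_mult_nth_cong[of "p + q"]) (auto simp: pade_fraction_def)
    also have "inverse (fps_of_poly ?L) * fps_of_poly N = fps_of_poly N1"
      using inv by (simp only: f fps_of_poly_mult) (simp add: mult.assoc[symmetric])
    finally show ?thesis by simp
  qed
  have "degree Q = Suc (degree Q1)" using Q1 by (simp only: f) (subst degree_mult_eq; simp)
  hence "degree ?D \<le> q" using NQ Q1 by (subst degree_mult_eq) (auto simp: pade_fraction_def)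
  \<comment> \<open>Cancellation lowers the degree of the numerator below \<open>p\<close>, while
    \<open>v - 1\<close> is at least \<open>p\<close>.\<close>
  moreover have "fps_nth (fps_of_poly ?D * F) v = 0" if "v \<in> {p+1..p+q}" for v
  proof -
    have "fps_of_poly ?D * F = fps_X * (fps_of_poly Q1 * F)"
      by (simp only: fps_of_poly_mult fps_of_poly_fps_X mult.assoc)
    hence "fps_nth (fps_of_poly ?D * F) v = fps_nth (fps_X * (fps_of_poly Q1 * F)) v" by (rule arg_cong)
    also have "\<dots> = fps_nth (fps_of_poly Q1 * F) (v - 1)"
      using that by simp
    also have "\<dots> = coeff N1 (v - 1)" using that by (intro eq) auto
    also have "\<dots> = 0"
    proof (cases "N1 = 0")
      case False
      hence "degree N = Suc (degree N1)" by (simp only: f) (subst degree_mult_eq; simp)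
      hence "degree N1 < v - 1" using that NQ by (auto simp: pade_fraction_def)
      thus ?thesis by (rule coeff_eq_0)
    qed simp
    finally show ?thesis .
  qed
  moreover have "coeff ?D 0 = 0" by simp
  ultimately have "?D = 0" using det[unfolded hankel_det_nonzero_iff] by blast
  thus False using Q1 by simp
qed

text \<open>For \<open>D\<close> in the Hankel kernel, let \<open>N\<close> be \<open>D * F\<close>
  cut at degree \<open>p\<close>. Then \<open>D * A = B * N\<close>, since both sides have degree at
  most \<open>p + q\<close>. Coprimality gives \<open>D = B * E\<close> and
  \<open>N = E * A\<close>; now \<open>degree A = p\<close> makes \<open>E\<close> constant, and the
  zero constant term of \<open>D\<close> makes it zero.\<close>

lemma pade_fraction_rational:
  assumes F: "fps_of_poly B * F = fps_of_poly A" and bezout: "u * A + v * B = 1"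
    and A0: "A \<noteq> 0" and deg: "degree A = p" "degree B \<le> q" and B0: "coeff B 0 \<noteq> 0"
  shows "Determinant.det (hankel_mat p q F) \<noteq> 0"
    and "pade_fraction p q F (Polynomial.smult (1 / coeff B 0) A) (Polynomial.smult (1 / coeff B 0) B)"
proof -
  show "Determinant.det (hankel_mat p q F) \<noteq> 0"
    unfolding hankel_det_nonzero_iff
  proof (intro allI impI)
    fix D assume D: "degree D \<le> q \<and> coeff D 0 = 0 \<and>
      (\<forall>v\<in>{p+1..p+q}. fps_nth (fps_of_poly D * F) v = 0)"
    define N where "N = (\<Sum>k\<le>p. monom (fps_nth (fps_of_poly D * F) k) k)"
    have N: "coeff N k = (if k \<le> p then fps_nth (fps_of_poly D * F) k else 0)" for k
      by (simp add: N_def coeff_sum)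
    have degN: "degree N \<le> p" by (rule degree_le) (simp add: N)
    have "D * A = B * N"
    proof (rule poly_eqI)
      fix k
      show "coeff (D * A) k = coeff (B * N) k"
      proof (cases "k \<le> p + q")
        case True
        have "coeff (D * A) k = fps_nth (fps_of_poly B * (fps_of_poly D * F)) k"
          by (simp flip: fps_of_poly_nth F add: fps_of_poly_mult mult_ac)
        also have "\<dots> = fps_nth (fps_of_poly B * fps_of_poly N) k"
          using True D by (intro fps_mult_nth_cong[of "p + q"]) (auto simp: N)
        finally show ?thesis by (simp flip: fps_of_poly_mult)
      next
        case False
        moreover have "degree (D * A) \<le> p + q" "degree (B * N) \<le> p + q"
          using D deg degN degree_mult_le[of D A] degree_mult_le[of B N] by linarith+
        ultimately show ?thesis by (simp add: coeff_eq_0)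
      qed
    qed
    hence DA: "D * A = B * N" .
    have "D = D * (u * A + v * B)" using bezout by simp
    also have "\<dots> = B * (u * N + v * D)" using DA by (simp add: algebra_simps)
    finally obtain E where E: "D = B * E" by blast
    have "B \<noteq> 0" using B0 by auto
    hence NE: "N = E * A" using DA by (simp add: E mult_ac)
    have "degree E = 0"
    proof (cases "E = 0")
      case False
      thus ?thesis using degN deg A0 by (simp add: NE degree_mult_eq)
    qed simp
    then obtain c where c: "E = [:c:]" by (metis degree_eq_zeroE)
    have "coeff D 0 = 0" using D by simp
    hence "c = 0" using B0 by (simp add: E c)
    thus "D = 0" by (simp add: E c)
  qed
  show "pade_fraction p q F (Polynomial.smult (1 / coeff B 0) A) (Polynomial.smult (1 / coeff B 0) B)"
    using deg B0 by (simp add: pade_fraction_def fps_of_poly_smult F mult.assoc)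
qed

section \<open>Continuous dependence of Pade polynomials on the series\<close>

lemma tendsto_det:
  fixes c :: "'b \<Rightarrow> nat \<Rightarrow> nat \<Rightarrow> complex"
  assumes "\<And>i j. i < q \<Longrightarrow> j < q \<Longrightarrow> ((\<lambda>x. c x i j) \<longlongrightarrow> c0 i j) G"
  shows "((\<lambda>x. Determinant.det (Matrix.mat q q (\<lambda>(i, j). c x i j))) \<longlongrightarrow>
    Determinant.det (Matrix.mat q q (\<lambda>(i, j). c0 i j))) G"
proof -
  have *: "Determinant.det (Matrix.mat q q (\<lambda>(i, j). d i j)) =
      (\<Sum>\<pi> | \<pi> permutes {0..<q}. signof \<pi> * (\<Prod>i=0..<q. d i (\<pi> i)))" for d :: "nat \<Rightarrow> nat \<Rightarrow> complex"
    by (subst det_def'[of _ q]) (auto intro!: sum.cong prod.cong simp: permutes_in_image)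
  show ?thesis unfolding *
    by (intro tendsto_intros assms) (auto simp: permutes_in_image)
qed

lemma tendsto_adj_mat:
  fixes c :: "'b \<Rightarrow> nat \<Rightarrow> nat \<Rightarrow> complex"
  assumes c: "\<And>i j. i < q \<Longrightarrow> j < q \<Longrightarrow> ((\<lambda>x. c x i j) \<longlongrightarrow> c0 i j) G" and ij: "i < q" "j < q"
  shows "((\<lambda>x. adj_mat (Matrix.mat q q (\<lambda>(i, j). c x i j)) $$ (i, j)) \<longlongrightarrow>
    adj_mat (Matrix.mat q q (\<lambda>(i, j). c0 i j)) $$ (i, j)) G"
proof -
  \<comment> \<open>Entries after deleting row \<open>j\<close> and column \<open>i\<close>; the
    roles are swapped because the adjugate is the transposed cofactor matrix.\<close>
  define del where "del d = (\<lambda>i' j'. d (if i' < j then i' else Suc i') (if j' < i then j' else Suc j'))"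
    for d :: "nat \<Rightarrow> nat \<Rightarrow> complex"
  have *: "adj_mat (Matrix.mat q q (\<lambda>(i, j). d i j)) $$ (i, j) =
      (- 1) ^ (j + i) * Determinant.det (Matrix.mat (q - 1) (q - 1) (\<lambda>(i', j'). del d i' j'))" for d
  proof -
    have "mat_delete (Matrix.mat q q (\<lambda>(i, j). d i j)) j i =
        Matrix.mat (q - 1) (q - 1) (\<lambda>(i', j'). del d i' j')"
      using ij by (intro eq_matI) (auto simp: mat_delete_def del_def)
    thus ?thesis using ij by (simp add: adj_mat_def cofactor_def)
  qed
  show ?thesis unfolding *
    by (intro tendsto_mult tendsto_const tendsto_det) (use c in \<open>auto simp: del_def\<close>)
qed

text \<open>The degree bound common to all \<open>x\<close> turns evaluation at a moving point into
  a sum of fixed length, so that coefficientwise convergence is enough.\<close>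

definition poly_tendsto :: "('b \<Rightarrow> complex poly) \<Rightarrow> complex poly \<Rightarrow> 'b filter \<Rightarrow> bool" where
  "poly_tendsto P P0 G \<longleftrightarrow> (\<exists>n. degree P0 \<le> n \<and> (\<forall>x. degree (P x) \<le> n)) \<and>
     (\<forall>i. ((\<lambda>x. coeff (P x) i) \<longlongrightarrow> coeff P0 i) G)"

lemma poly_tendsto_eval:
  assumes "poly_tendsto P P0 G" "(w \<longlongrightarrow> w0) G"
  shows "((\<lambda>x. poly (P x) (w x)) \<longlongrightarrow> poly P0 w0) G"
proof -
  obtain n where n: "degree P0 \<le> n" "\<And>x. degree (P x) \<le> n"
    using assms(1) unfolding poly_tendsto_def by blast
  have *: "poly A w = (\<Sum>i\<le>n. coeff A i * w ^ i)" if "degree A \<le> n" for A and w :: complex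
    unfolding poly_altdef by (rule sum.mono_neutral_left) (use that in \<open>auto simp: coeff_eq_0\<close>)
  show ?thesis unfolding *[OF n(1)] *[OF n(2)]
    by (intro tendsto_intros assms(2)) (use assms(1) in \<open>auto simp: poly_tendsto_def\<close>)
qed

lemma poly_tendsto_mult:
  assumes "poly_tendsto P P0 G" "poly_tendsto R R0 G"
  shows "poly_tendsto (\<lambda>x. P x * R x) (P0 * R0) G"
proof -
  obtain n m where "degree P0 \<le> n" "\<And>x. degree (P x) \<le> n" "degree R0 \<le> m" "\<And>x. degree (R x) \<le> m"
    using assms unfolding poly_tendsto_def by blast
  hence "degree (P0 * R0) \<le> n + m" "degree (P x * R x) \<le> n + m" for x
    by (auto intro!: order_trans[OF degree_mult_le] add_mono)
  moreover have "((\<lambda>x. coeff (P x * R x) i) \<longlongrightarrow> coeff (P0 * R0) i) G" for i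
    unfolding coeff_mult by (intro tendsto_intros) (use assms in \<open>auto simp: poly_tendsto_def\<close>)
  ultimately show ?thesis unfolding poly_tendsto_def by blast
qed

lemma poly_tendsto_diff:
  assumes "poly_tendsto P P0 G" "poly_tendsto R R0 G"
  shows "poly_tendsto (\<lambda>x. P x - R x) (P0 - R0) G"
proof -
  obtain n m where "degree P0 \<le> n" "\<And>x. degree (P x) \<le> n" "degree R0 \<le> m" "\<And>x. degree (R x) \<le> m"
    using assms unfolding poly_tendsto_def by blast
  hence "degree (P0 - R0) \<le> max n m" "degree (P x - R x) \<le> max n m" for x
    by (intro degree_diff_le; simp add: le_max_iff_disj)+
  moreover have "((\<lambda>x. coeff (P x - R x) i) \<longlongrightarrow> coeff (P0 - R0) i) G" for i
    unfolding coeff_diff by (intro tendsto_intros) (use assms in \<open>auto simp: poly_tendsto_def\<close>)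
  ultimately show ?thesis unfolding poly_tendsto_def by blast
qed

lemma poly_tendsto_smult:
  assumes "poly_tendsto P P0 G"
  shows "poly_tendsto (\<lambda>x. Polynomial.smult c (P x)) (Polynomial.smult c P0) G"
proof -
  obtain n where "degree P0 \<le> n" "\<And>x. degree (P x) \<le> n"
    using assms unfolding poly_tendsto_def by blast
  hence "degree (Polynomial.smult c P0) \<le> n" "degree (Polynomial.smult c (P x)) \<le> n" for x
    by (auto intro!: order_trans[OF degree_smult_le])
  moreover have "((\<lambda>x. coeff (Polynomial.smult c (P x)) i) \<longlongrightarrow> coeff (Polynomial.smult c P0) i) G" for i
    unfolding coeff_smult by (intro tendsto_intros) (use assms in \<open>auto simp: poly_tendsto_def\<close>)
  ultimately show ?thesis unfolding poly_tendsto_def by blast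
qed

lemma poly_tendsto_pderiv:
  assumes "poly_tendsto P P0 G"
  shows "poly_tendsto (\<lambda>x. pderiv (P x)) (pderiv P0) G"
proof -
  obtain n where "degree P0 \<le> n" "\<And>x. degree (P x) \<le> n"
    using assms unfolding poly_tendsto_def by blast
  hence "degree (pderiv P0) \<le> n" "degree (pderiv (P x)) \<le> n" for x
    by (auto simp: degree_pderiv intro: order_trans[OF diff_le_self])
  moreover have "((\<lambda>x. coeff (pderiv (P x)) i) \<longlongrightarrow> coeff (pderiv P0) i) G" for i
    unfolding coeff_pderiv by (intro tendsto_intros) (use assms in \<open>auto simp: poly_tendsto_def\<close>)
  ultimately show ?thesis unfolding poly_tendsto_def by blast
qed

text \<open>Numerator of the \<open>l\<close>-th derivative of \<open>N / Q\<close> over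
  \<open>Q ^ Suc l\<close>: the quotient rule with a factor \<open>Q ^ l\<close> cancelled.\<close>

fun rat_deriv_num :: "complex poly \<Rightarrow> complex poly \<Rightarrow> nat \<Rightarrow> complex poly" where
  "rat_deriv_num N Q 0 = N"
| "rat_deriv_num N Q (Suc l) =
     pderiv (rat_deriv_num N Q l) * Q - Polynomial.smult (of_nat (Suc l)) (rat_deriv_num N Q l * pderiv Q)"

lemma poly_tendsto_rat_deriv_num:
  assumes "poly_tendsto N N0 G" "poly_tendsto Q Q0 G"
  shows "poly_tendsto (\<lambda>x. rat_deriv_num (N x) (Q x) l) (rat_deriv_num N0 Q0 l) G"
  by (induction l)
    (auto intro!: assms poly_tendsto_mult poly_tendsto_diff poly_tendsto_smult poly_tendsto_pderiv
      simp del: of_nat_Suc)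

lemma higher_deriv_rational:
  assumes "poly Q (z - \<zeta>) \<noteq> 0"
  shows "(deriv ^^ l) (\<lambda>z. poly N (z - \<zeta>) / poly Q (z - \<zeta>)) z =
    poly (rat_deriv_num N Q l) (z - \<zeta>) / poly Q (z - \<zeta>) ^ Suc l"
  using assms
proof (induction l arbitrary: z)
  case (Suc l)
  let ?P = "rat_deriv_num N Q l" and ?w = "z - \<zeta>"
  have "open {z. poly Q (z - \<zeta>) \<noteq> 0}"
    by (intro open_Collect_neq continuous_intros)
  hence "\<forall>\<^sub>F z in nhds z. poly Q (z - \<zeta>) \<noteq> 0"
    using Suc.prems eventually_nhds_in_open by force
  hence "\<forall>\<^sub>F z in nhds z. (deriv ^^ l) (\<lambda>z. poly N (z - \<zeta>) / poly Q (z - \<zeta>)) z =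
      poly ?P (z - \<zeta>) / poly Q (z - \<zeta>) ^ Suc l"
    by eventually_elim (rule Suc.IH)
  hence "(deriv ^^ Suc l) (\<lambda>z. poly N (z - \<zeta>) / poly Q (z - \<zeta>)) z =
      deriv (\<lambda>z. poly ?P (z - \<zeta>) / poly Q (z - \<zeta>) ^ Suc l) z"
    unfolding funpow.simps o_def by (rule deriv_cong_ev) simp
  also have "\<dots> = poly (rat_deriv_num N Q (Suc l)) ?w / poly Q ?w ^ Suc (Suc l)"
  proof (rule DERIV_imp_deriv)
    have "((\<lambda>z. poly ?P (z - \<zeta>) / poly Q (z - \<zeta>) ^ Suc l) has_field_derivative
        ((poly (pderiv ?P) ?w * poly Q ?w ^ Suc l
          - poly ?P ?w * (of_nat (Suc l) * (poly (pderiv Q) ?w * poly Q ?w ^ l)))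
          / (poly Q ?w ^ Suc l * poly Q ?w ^ Suc l))) (at z)"
      using Suc.prems
      by (auto intro!: derivative_eq_intros DERIV_chain2[OF poly_DERIV] simp del: of_nat_Suc power_Suc)
    also have "(poly (pderiv ?P) ?w * poly Q ?w ^ Suc l
          - poly ?P ?w * (of_nat (Suc l) * (poly (pderiv Q) ?w * poly Q ?w ^ l)))
          / (poly Q ?w ^ Suc l * poly Q ?w ^ Suc l) =
        poly (rat_deriv_num N Q (Suc l)) ?w / poly Q ?w ^ Suc (Suc l)"
      using Suc.prems by (simp add: field_simps del: of_nat_Suc)
    finally show "((\<lambda>z. poly ?P (z - \<zeta>) / poly Q (z - \<zeta>) ^ Suc l) has_field_derivative
        poly (rat_deriv_num N Q (Suc l)) ?w / poly Q ?w ^ Suc (Suc l)) (at z)" .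
  qed
  finally show ?case .
qed simp

lemma
  assumes lim: "\<And>i. ((\<lambda>x. fps_nth (F x) i) \<longlongrightarrow> fps_nth F0 i) G"
  shows tendsto_hankel_det:
      "((\<lambda>x. Determinant.det (hankel_mat p q (F x))) \<longlongrightarrow> Determinant.det (hankel_mat p q F0)) G"
    and poly_tendsto_pade_den: "Determinant.det (hankel_mat p q F0) \<noteq> 0 \<Longrightarrow>
      poly_tendsto (\<lambda>x. pade_den p q (F x)) (pade_den p q F0) G"
    and poly_tendsto_pade_num: "Determinant.det (hankel_mat p q F0) \<noteq> 0 \<Longrightarrow>
      poly_tendsto (\<lambda>x. pade_num p q (F x)) (pade_num p q F0) G"
proof -
  have entry: "((\<lambda>x. let k = int p - int q + int i + int j + 1 in if k < 0 then 0 else fps_nth (F x) (nat k))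
      \<longlongrightarrow> (let k = int p - int q + int i + int j + 1 in if k < 0 then 0 else fps_nth F0 (nat k))) G" for i j
    by (simp add: Let_def lim)
  show det: "((\<lambda>x. Determinant.det (hankel_mat p q (F x))) \<longlongrightarrow> Determinant.det (hankel_mat p q F0)) G"
    unfolding hankel_mat_def by (intro tendsto_det entry)
  assume nz: "Determinant.det (hankel_mat p q F0) \<noteq> 0"
  have adj: "((\<lambda>x. adj_mat (hankel_mat p q (F x)) $$ (i, j)) \<longlongrightarrow> adj_mat (hankel_mat p q F0) $$ (i, j)) G"
    if "i < q" "j < q" for i j
    unfolding hankel_mat_def by (intro tendsto_adj_mat entry that)
  \<comment> \<open>This holds even where the determinant vanishes and the formula divides by zero,
    so the bound covers all \<open>x\<close> as \<open>poly_tendsto\<close> demands.\<close>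
  have "degree (pade_den p q A) \<le> q" for A by (rule degree_le) (simp add: coeff_pade_den)
  moreover have coeff: "((\<lambda>x. coeff (pade_den p q (F x)) i) \<longlongrightarrow> coeff (pade_den p q F0) i) G" for i
    unfolding coeff_pade_den
    by (cases "i = 0 \<or> q < i") (auto intro!: tendsto_intros adj det nz lim)
  ultimately show "poly_tendsto (\<lambda>x. pade_den p q (F x)) (pade_den p q F0) G"
    unfolding poly_tendsto_def by blast
  have "degree (pade_num p q A) \<le> p" for A by (rule degree_le) (simp add: coeff_pade_num)
  moreover have "((\<lambda>x. coeff (pade_num p q (F x)) i) \<longlongrightarrow> coeff (pade_num p q F0) i) G" for i
    unfolding coeff_pade_num fps_mult_nth fps_of_poly_nth
    by (cases "i \<le> p") (auto intro!: tendsto_intros coeff lim)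
  ultimately show "poly_tendsto (\<lambda>x. pade_num p q (F x)) (pade_num p q F0) G"
    unfolding poly_tendsto_def by blast
qed

section \<open>Pad\'e approximants of functions\<close>

definition taylor_fps :: "complex set \<Rightarrow> (complex \<Rightarrow> complex) \<Rightarrow> complex \<Rightarrow> complex fps" where
  "taylor_fps \<Omega> f \<zeta> = Abs_fps (\<lambda>i. ext_deriv \<Omega> i f \<zeta> / fact i)"

lemma fps_nth_taylor_fps [simp]: "fps_nth (taylor_fps \<Omega> f \<zeta>) i = ext_deriv \<Omega> i f \<zeta> / fact i"
  by (simp add: taylor_fps_def)

lemma pade_class_iff:
  "f \<in> pade_class \<Omega> p q \<zeta> \<longleftrightarrow> f \<in> A_inf \<Omega> \<and> Determinant.det (hankel_mat p q (taylor_fps \<Omega> f \<zeta>)) \<noteq> 0"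
  unfolding pade_class_def hankel_mat_def taylor_coeff_def Let_def fps_nth_taylor_fps by simp

lemma has_fps_expansion_poly: "poly A has_fps_expansion fps_of_poly A" for A :: "complex poly"
proof (induction A)
  case (pCons c A)
  have "(\<lambda>z. c + poly A z * z) has_fps_expansion fps_const c + fps_of_poly A * fps_X"
    by (intro fps_expansion_intros pCons.IH)
  thus ?case by (simp add: fps_of_poly_pCons mult.commute)
qed simp

lemma analytic_rational:
  "poly Q (z - \<zeta>) \<noteq> 0 \<Longrightarrow> (\<lambda>z. poly N (z - \<zeta>) / poly Q (z - \<zeta>)) analytic_on {z}"
  for N Q :: "complex poly"
  by (intro analytic_on_divide holomorphic_on_imp_analytic_at[of _ UNIV] holomorphic_intros) auto

lemma fps_expansion_rational:
  assumes "coeff Q 0 \<noteq> 0"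
  shows "fps_of_poly Q * fps_expansion (\<lambda>z. poly N (z - \<zeta>) / poly Q (z - \<zeta>)) \<zeta> = fps_of_poly N"
proof -
  let ?\<phi> = "\<lambda>z. poly N (z - \<zeta>) / poly Q (z - \<zeta>)"
  have Q0: "poly Q 0 \<noteq> 0" using assms by (simp add: poly_0_coeff_0)
  have "?\<phi> analytic_on {\<zeta>}" using Q0 by (intro analytic_rational) simp
  hence "(\<lambda>x. poly Q x * ?\<phi> (\<zeta> + x)) has_fps_expansion fps_of_poly Q * fps_expansion ?\<phi> \<zeta>"
    by (intro has_fps_expansion_mult has_fps_expansion_poly analytic_at_imp_has_fps_expansion)
  moreover have "\<forall>\<^sub>F x in nhds 0. poly Q x \<noteq> 0"
    using Q0 eventually_nhds_in_open[of "{x. poly Q x \<noteq> 0}" 0]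
    by (simp add: open_Collect_neq continuous_intros)
  hence "\<forall>\<^sub>F x in nhds 0. poly Q x * ?\<phi> (\<zeta> + x) = poly N x"
    by eventually_elim simp
  ultimately have "poly N has_fps_expansion fps_of_poly Q * fps_expansion ?\<phi> \<zeta>"
    using has_fps_expansion_cong[OF _ refl, of "\<lambda>x. poly Q x * ?\<phi> (\<zeta> + x)" "poly N"] by blast
  thus ?thesis using fps_expansion_unique_complex has_fps_expansion_poly by blast
qed

text \<open>At \<zeta> the denominator is 1, so \<open>remove_sings\<close> changes nothing near
  \<zeta> and the derivatives there give the Taylor series of \<open>N / Q\<close>. Multiplication
  by \<open>Q\<close>, or by its inverse series, passes between agreement of coefficients and the
  linear condition.\<close>

lemma is_pade_iff:
  "is_pade \<Omega> f \<zeta> p q R \<longleftrightarrow> (\<exists>N Q. pade_fraction p q (taylor_fps \<Omega> f \<zeta>) N Q \<and>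
     R = remove_sings (\<lambda>z. poly N (z - \<zeta>) / poly Q (z - \<zeta>)))"
proof -
  let ?F = "taylor_fps \<Omega> f \<zeta>"
  let ?R = "\<lambda>N Q :: complex poly. remove_sings (\<lambda>z. poly N (z - \<zeta>) / poly Q (z - \<zeta>))"
  have poly_sum: "(\<Sum>v\<le>n. coeff A v * x ^ v) = poly A x" if "degree A \<le> n" for A n and x :: complex
    unfolding poly_altdef by (rule sum.mono_neutral_right) (use that in \<open>auto simp: coeff_eq_0\<close>)
  have repr: "(\<exists>n d. d 0 = 1 \<and> R = remove_sings (\<lambda>z. (\<Sum>v\<le>p. n v * (z - \<zeta>) ^ v) / (\<Sum>v\<le>q. d v * (z - \<zeta>) ^ v)))
    \<longleftrightarrow> (\<exists>N Q. degree N \<le> p \<and> degree Q \<le> q \<and> coeff Q 0 = 1 \<and> R = ?R N Q)" (is "?lhs \<longleftrightarrow> ?rhs")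
  proof
    assume ?lhs
    then obtain n d where nd: "d 0 = 1"
      "R = remove_sings (\<lambda>z. (\<Sum>v\<le>p. n v * (z - \<zeta>) ^ v) / (\<Sum>v\<le>q. d v * (z - \<zeta>) ^ v))"
      by blast
    define N Q where "N = (\<Sum>v\<le>p. monom (n v) v)" and "Q = (\<Sum>v\<le>q. monom (d v) v)"
    have "coeff N v = (if v \<le> p then n v else 0)" "coeff Q v = (if v \<le> q then d v else 0)" for v
      by (simp_all add: N_def Q_def coeff_sum)
    hence "degree N \<le> p" "degree Q \<le> q" "coeff Q 0 = 1" using nd(1) by (auto intro!: degree_le)
    moreover have "R = ?R N Q" unfolding nd(2) N_def Q_def by (simp add: Polynomial.poly_sum poly_monom)
    ultimately show ?rhs by blast
  next
    assume ?rhs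
    then obtain N Q where "degree N \<le> p" "degree Q \<le> q" "coeff Q 0 = 1" "R = ?R N Q" by blast
    thus ?lhs
      by (intro exI[of _ "coeff N"] exI[of _ "coeff Q"]) (simp add: poly_sum)
  qed
  have taylor: "(\<forall>v\<le>p + q. (deriv ^^ v) (?R N Q) \<zeta> / fact v = taylor_coeff \<Omega> f \<zeta> (int v)) \<longleftrightarrow>
      (\<forall>v\<le>p + q. fps_nth (fps_of_poly Q * ?F) v = coeff N v)" (is "?lhs \<longleftrightarrow> ?rhs")
    if Q: "coeff Q 0 = 1" for N Q
  proof -
    let ?\<phi> = "\<lambda>z. poly N (z - \<zeta>) / poly Q (z - \<zeta>)"
    define E where "E = fps_expansion ?\<phi> \<zeta>"
    have QE: "fps_of_poly Q * E = fps_of_poly N"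
      unfolding E_def by (rule fps_expansion_rational) (simp add: Q)
    have inv: "inverse (fps_of_poly Q) * fps_of_poly Q = 1"
      by (rule inverse_mult_eq_1) (simp add: Q)
    have "(deriv ^^ v) (?R N Q) \<zeta> / fact v = fps_nth E v" for v
    proof -
      have "?\<phi> analytic_on {\<zeta>}" using Q by (intro analytic_rational) (simp add: poly_0_coeff_0)
      hence "(deriv ^^ v) (?R N Q) \<zeta> = (deriv ^^ v) ?\<phi> \<zeta>"
        by (intro higher_deriv_cong_ev eventually_remove_sings_eq_nhds) auto
      thus ?thesis by (simp add: E_def fps_expansion_def)
    qed
    moreover have "taylor_coeff \<Omega> f \<zeta> (int v) = fps_nth ?F v" for v by (simp add: taylor_coeff_def)
    ultimately have "?lhs \<longleftrightarrow> (\<forall>v\<le>p + q. fps_nth ?F v = fps_nth E v)" by auto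
    also have "\<dots> \<longleftrightarrow> ?rhs"
    proof (intro iffI allI impI)
      fix v assume "\<forall>v\<le>p + q. fps_nth ?F v = fps_nth E v" "v \<le> p + q"
      hence "fps_nth (fps_of_poly Q * ?F) v = fps_nth (fps_of_poly Q * E) v"
        by (intro fps_mult_nth_cong[of "p + q"]) auto
      thus "fps_nth (fps_of_poly Q * ?F) v = coeff N v" by (simp add: QE)
    next
      fix v assume *: "\<forall>v\<le>p + q. fps_nth (fps_of_poly Q * ?F) v = coeff N v" and v: "v \<le> p + q"
      have "fps_nth ?F v = fps_nth (inverse (fps_of_poly Q) * (fps_of_poly Q * ?F)) v"
        using inv by (simp add: mult.assoc[symmetric])
      also have "\<dots> = fps_nth (inverse (fps_of_poly Q) * (fps_of_poly Q * E)) v"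
        by (rule fps_mult_nth_cong[of "p + q"]) (use * v in \<open>auto simp: QE\<close>)
      also have "\<dots> = fps_nth E v"
        using inv by (simp add: mult.assoc[symmetric])
      finally show "fps_nth ?F v = fps_nth E v" .
    qed
    finally show ?thesis .
  qed
  show ?thesis
  proof
    assume "is_pade \<Omega> f \<zeta> p q R"
    hence R: "\<forall>v\<le>p + q. (deriv ^^ v) R \<zeta> / fact v = taylor_coeff \<Omega> f \<zeta> (int v)"
      and "\<exists>N Q. degree N \<le> p \<and> degree Q \<le> q \<and> coeff Q 0 = 1 \<and> R = ?R N Q"
      unfolding is_pade_def repr by simp_all
    then obtain N Q where NQ: "degree N \<le> p" "degree Q \<le> q" "coeff Q 0 = 1" "R = ?R N Q" by metis
    hence "pade_fraction p q ?F N Q"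
      using R taylor[OF NQ(3), of N] by (simp add: pade_fraction_def)
    thus "\<exists>N Q. pade_fraction p q ?F N Q \<and> R = ?R N Q" using NQ(4) by metis
  next
    assume "\<exists>N Q. pade_fraction p q ?F N Q \<and> R = ?R N Q"
    then obtain N Q where NQ: "pade_fraction p q ?F N Q" "R = ?R N Q" by metis
    hence "\<exists>N Q. degree N \<le> p \<and> degree Q \<le> q \<and> coeff Q 0 = 1 \<and> R = ?R N Q"
      unfolding pade_fraction_def by metis
    thus "is_pade \<Omega> f \<zeta> p q R"
      unfolding is_pade_def repr using NQ taylor[of Q N] by (simp add: pade_fraction_def)
  qed
qed

lemma eventually_poly_shift_nonzero:
  fixes Q :: "complex poly"
  assumes "Q \<noteq> 0"
  shows "\<forall>\<^sub>F z in at c. poly Q (z - \<zeta>) \<noteq> 0"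
proof -
  have "finite ((\<lambda>x. x + \<zeta>) ` {x. poly Q x = 0})" using assms poly_roots_finite by blast
  moreover have "{z. poly Q (z - \<zeta>) = 0} \<subseteq> (\<lambda>x. x + \<zeta>) ` {x. poly Q x = 0}"
    by (auto intro!: image_eqI[where x = "z - \<zeta>" for z])
  ultimately have "\<not> c islimpt {z. poly Q (z - \<zeta>) = 0}" using islimpt_finite finite_subset by metis
  thus ?thesis by (simp add: islimpt_iff_eventually)
qed

text \<open>Two Pade fractions agree wherever both denominators are nonzero, hence near every point
  except possibly at the point itself. \<open>remove_sings\<close> sees only punctured
  neighbourhoods, so the definite description in \<open>pade\<close> is justified.\<close>

lemma pade_eqI:
  assumes NQ: "pade_fraction p q (taylor_fps \<Omega> f \<zeta>) N Q"
  shows "pade \<Omega> f \<zeta> p q = remove_sings (\<lambda>z. poly N (z - \<zeta>) / poly Q (z - \<zeta>))"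
  unfolding pade_def
proof (rule the_equality)
  show "is_pade \<Omega> f \<zeta> p q (remove_sings (\<lambda>z. poly N (z - \<zeta>) / poly Q (z - \<zeta>)))"
    using NQ is_pade_iff by blast
next
  fix R assume "is_pade \<Omega> f \<zeta> p q R"
  then obtain N' Q' where NQ': "pade_fraction p q (taylor_fps \<Omega> f \<zeta>) N' Q'"
    and R: "R = remove_sings (\<lambda>z. poly N' (z - \<zeta>) / poly Q' (z - \<zeta>))"
    using is_pade_iff by blast
  have "R c = remove_sings (\<lambda>z. poly N (z - \<zeta>) / poly Q (z - \<zeta>)) c" for c
    unfolding R
  proof (rule remove_sings_cong[OF _ refl])
    have "\<forall>\<^sub>F z in at c. poly Q (z - \<zeta>) \<noteq> 0" "\<forall>\<^sub>F z in at c. poly Q' (z - \<zeta>) \<noteq> 0"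
      using NQ NQ' by (auto intro!: eventually_poly_shift_nonzero simp: pade_fraction_def)
    thus "\<forall>\<^sub>F z in at c. poly N' (z - \<zeta>) / poly Q' (z - \<zeta>) = poly N (z - \<zeta>) / poly Q (z - \<zeta>)"
    proof eventually_elim
      case (elim z)
      have "poly (N' * Q) (z - \<zeta>) = poly (N * Q') (z - \<zeta>)"
        using pade_fraction_unique[OF NQ NQ'] by simp
      thus ?case using elim by (simp add: field_simps)
    qed
  qed
  thus "R = remove_sings (\<lambda>z. poly N (z - \<zeta>) / poly Q (z - \<zeta>))" by blast
qed

lemma is_pole_remove_sings_rational:
  fixes N Q :: "complex poly"
  assumes "poly Q (z - \<zeta>) = 0 \<Longrightarrow> poly N (z - \<zeta>) \<noteq> 0" "Q \<noteq> 0"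
  shows "is_pole (remove_sings (\<lambda>z. poly N (z - \<zeta>) / poly Q (z - \<zeta>))) z \<longleftrightarrow> poly Q (z - \<zeta>) = 0"
    (is "is_pole (remove_sings ?\<phi>) z \<longleftrightarrow> _")
proof -
  have "filterlim (\<lambda>z. poly Q (z - \<zeta>)) (at 0) (at z)" if "poly Q (z - \<zeta>) = 0"
    unfolding filterlim_at
  proof
    show "\<forall>\<^sub>F z in at z. poly Q (z - \<zeta>) \<in> UNIV \<and> poly Q (z - \<zeta>) \<noteq> 0"
      using eventually_poly_shift_nonzero[OF assms(2)] by simp
    have "((\<lambda>z. poly Q (z - \<zeta>)) \<longlongrightarrow> poly Q (z - \<zeta>)) (at z)" by (intro tendsto_intros)
    thus "((\<lambda>z. poly Q (z - \<zeta>)) \<longlongrightarrow> 0) (at z)" using that by simp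
  qed
  hence pole: "is_pole ?\<phi> z" if "poly Q (z - \<zeta>) = 0"
    using that assms by (intro is_pole_divide continuous_intros) auto
  have "is_pole (remove_sings ?\<phi>) z \<longleftrightarrow> is_pole ?\<phi> z"
  proof (rule is_pole_cong[OF eventually_remove_sings_eq_at refl])
    show "isolated_singularity_at ?\<phi> z"
      by (intro isolated_singularity_at_divide isolated_singularity_at_analytic not_essential_analytic
          holomorphic_on_imp_analytic_at[of _ UNIV] holomorphic_intros) auto
  qed
  also have "\<dots> \<longleftrightarrow> poly Q (z - \<zeta>) = 0"
    using pole analytic_at_imp_no_pole[OF analytic_rational] by blast
  finally show ?thesis .
qed

text \<open>Series, displacement \<open>z - \<zeta>\<close> and target derivatives enter as
  independent arguments, and only polynomials are evaluated. In this form the condition is visibly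
  stable when all three vary at once.\<close>

definition pade_close ::
    "nat \<Rightarrow> real \<Rightarrow> nat \<Rightarrow> nat \<Rightarrow> complex fps \<Rightarrow> complex \<Rightarrow> (nat \<Rightarrow> complex) \<Rightarrow> bool" where
  "pade_close m \<epsilon> p q F w b \<longleftrightarrow> Determinant.det (hankel_mat p q F) \<noteq> 0 \<and> poly (pade_den p q F) w \<noteq> 0 \<and>
     (\<forall>l\<le>m. norm (poly (rat_deriv_num (pade_num p q F) (pade_den p q F) l) w /
        poly (pade_den p q F) w ^ Suc l - b l) < \<epsilon>)"

text \<open>A nonzero determinant excludes common zeros of numerator and denominator; a vanishing
  denominator therefore means a pole, that is, infinite error.\<close>

lemma pade_close_iff:
  assumes "f \<in> A_inf \<Omega>"
  shows "pade_close m \<epsilon> p q (taylor_fps \<Omega> f \<zeta>) (z - \<zeta>) (\<lambda>l. ext_deriv \<Omega> l f z) \<longleftrightarrow>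
    f \<in> pade_class \<Omega> p q \<zeta> \<and> (\<forall>l\<le>m. pade_error \<Omega> f p q l \<zeta> z < ennreal \<epsilon>)"
proof (cases "Determinant.det (hankel_mat p q (taylor_fps \<Omega> f \<zeta>)) = 0")
  case False
  let ?N = "pade_num p q (taylor_fps \<Omega> f \<zeta>)" and ?Q = "pade_den p q (taylor_fps \<Omega> f \<zeta>)"
  let ?\<phi> = "\<lambda>z. poly ?N (z - \<zeta>) / poly ?Q (z - \<zeta>)"
  note NQ = pade_fraction_pade_num_den[OF False]
  have Q0: "?Q \<noteq> 0" using NQ by (auto simp: pade_fraction_def)
  have pade: "pade \<Omega> f \<zeta> p q = remove_sings ?\<phi>" by (rule pade_eqI[OF NQ])
  have pole: "is_pole (pade \<Omega> f \<zeta> p q) z \<longleftrightarrow> poly ?Q (z - \<zeta>) = 0"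
    unfolding pade using pade_fraction_no_common_zero[OF False NQ] Q0
    by (intro is_pole_remove_sings_rational) auto
  have err: "pade_error \<Omega> f p q l \<zeta> z < ennreal \<epsilon> \<longleftrightarrow> poly ?Q (z - \<zeta>) \<noteq> 0 \<and>
      norm (poly (rat_deriv_num ?N ?Q l) (z - \<zeta>) / poly ?Q (z - \<zeta>) ^ Suc l - ext_deriv \<Omega> l f z) < \<epsilon>" for l
  proof (cases "poly ?Q (z - \<zeta>) = 0")
    case False
    have "(deriv ^^ l) (pade \<Omega> f \<zeta> p q) z = (deriv ^^ l) ?\<phi> z"
      unfolding pade by (intro higher_deriv_cong_ev eventually_remove_sings_eq_nhds analytic_rational False refl)
    also have "\<dots> = poly (rat_deriv_num ?N ?Q l) (z - \<zeta>) / poly ?Q (z - \<zeta>) ^ Suc l"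
      by (rule higher_deriv_rational[OF False])
    finally show ?thesis using False pole by (simp add: pade_error_def ennreal_less_iff)
  qed (simp add: pade_error_def pole)
  show ?thesis using assms False err by (auto simp: pade_close_def pade_class_iff)
qed (simp add: pade_close_def pade_class_iff)

text \<open>Finitely many strict conditions on quantities that are continuous as long as determinant
  and denominator do not vanish.\<close>

lemma eventually_pade_close:
  assumes F: "\<And>i. ((\<lambda>x. fps_nth (F x) i) \<longlongrightarrow> fps_nth F0 i) G" and w: "(w \<longlongrightarrow> w0) G"
    and b: "\<And>l. ((\<lambda>x. b x l) \<longlongrightarrow> b0 l) G" and close: "pade_close m \<epsilon> p q F0 w0 b0"
  shows "\<forall>\<^sub>F x in G. pade_close m \<epsilon> p q (F x) (w x) (b x)"
proof -
  have det: "Determinant.det (hankel_mat p q F0) \<noteq> 0" and Q0: "poly (pade_den p q F0) w0 \<noteq> 0"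
    using close by (auto simp: pade_close_def)
  note lim = poly_tendsto_pade_num[OF F det] poly_tendsto_pade_den[OF F det]
  have Q: "((\<lambda>x. poly (pade_den p q (F x)) (w x)) \<longlongrightarrow> poly (pade_den p q F0) w0) G"
    by (intro poly_tendsto_eval lim w)
  have "((\<lambda>x. norm (poly (rat_deriv_num (pade_num p q (F x)) (pade_den p q (F x)) l) (w x) /
        poly (pade_den p q (F x)) (w x) ^ Suc l - b x l)) \<longlongrightarrow>
      norm (poly (rat_deriv_num (pade_num p q F0) (pade_den p q F0) l) w0 /
        poly (pade_den p q F0) w0 ^ Suc l - b0 l)) G" for l
    using Q0 by (intro tendsto_intros poly_tendsto_eval poly_tendsto_rat_deriv_num lim w b) auto
  hence "\<forall>\<^sub>F x in G. norm (poly (rat_deriv_num (pade_num p q (F x)) (pade_den p q (F x)) l) (w x) /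
        poly (pade_den p q (F x)) (w x) ^ Suc l - b x l) < \<epsilon>" if "l \<le> m" for l
    using close that order_tendstoD(2) unfolding pade_close_def by blast
  hence "\<forall>\<^sub>F x in G. \<forall>l\<in>{..m}. norm (poly (rat_deriv_num (pade_num p q (F x)) (pade_den p q (F x)) l) (w x) /
        poly (pade_den p q (F x)) (w x) ^ Suc l - b x l) < \<epsilon>"
    by (intro eventually_ball_finite) auto
  moreover have "\<forall>\<^sub>F x in G. Determinant.det (hankel_mat p q (F x)) \<noteq> 0"
    by (rule tendsto_imp_eventually_ne[OF tendsto_hankel_det[OF F] det])
  moreover have "\<forall>\<^sub>F x in G. poly (pade_den p q (F x)) (w x) \<noteq> 0"
    by (rule tendsto_imp_eventually_ne[OF Q Q0])
  ultimately show ?thesis by eventually_elim (simp add: pade_close_def)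
qed

section \<open>Reduced fractions as their own approximants\<close>

lemma ext_deriv_restrict:
  assumes "open \<Omega>" "open U" "closure \<Omega> \<subseteq> U" "h holomorphic_on U" "z \<in> closure \<Omega>"
  shows "ext_deriv \<Omega> l (restrict h \<Omega>) z = (deriv ^^ l) h z"
proof (rule ext_deriv_unique[OF assms(1) _ _ assms(5)])
  show "continuous_on (closure \<Omega>) ((deriv ^^ l) h)"
    using assms by (meson continuous_on_subset holomorphic_higher_deriv holomorphic_on_imp_continuous_on)
  show "(deriv ^^ l) h z = (deriv ^^ l) (restrict h \<Omega>) z" if "z \<in> \<Omega>" for z
    using that assms(1) by (intro higher_deriv_cong_ev) (auto simp: eventually_nhds)
qed

lemma restrict_in_H_closure:
  "open U \<Longrightarrow> closure \<Omega> \<subseteq> U \<Longrightarrow> h holomorphic_on U \<Longrightarrow> restrict h \<Omega> \<in> H_closure \<Omega>"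
  by (auto simp: H_closure_def)

text \<open>Substituting \<open>[:\<zeta>, 1:]\<close> moves the centre to the origin and preserves
  degrees and the Bezout identity. The algebra at the origin thus applies to one and the same
  fraction at every centre.\<close>

lemma pade_rational:
  fixes A B :: "complex poly"
  defines "g \<equiv> \<lambda>z. poly A z / poly B z"
  assumes \<Omega>: "open \<Omega>" and B: "\<And>z. z \<in> closure \<Omega> \<Longrightarrow> poly B z \<noteq> 0"
    and bezout: "u * A + v * B = 1" and A0: "A \<noteq> 0" and deg: "degree A = p" "degree B \<le> q"
    and \<zeta>: "\<zeta> \<in> closure \<Omega>"
  shows "restrict g \<Omega> \<in> pade_class \<Omega> p q \<zeta>"
    and "z \<in> closure \<Omega> \<Longrightarrow> pade_error \<Omega> (restrict g \<Omega>) p q l \<zeta> z = 0"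
proof -
  let ?f = "restrict g \<Omega>" and ?L = "[:\<zeta>, 1:]"
  let ?A = "pcompose A ?L" and ?B = "pcompose B ?L"
  define U where "U = {z. poly B z \<noteq> 0}"
  have U: "open U" "closure \<Omega> \<subseteq> U" "g holomorphic_on U"
    unfolding U_def g_def
    by (auto intro!: open_Collect_neq continuous_intros holomorphic_intros dest: B)
  have f: "?f \<in> A_inf \<Omega>" using restrict_in_H_closure[OF U] H_closure_subset_A_inf[OF \<Omega>] by blast
  have g_eq: "g = (\<lambda>z. poly ?A (z - \<zeta>) / poly ?B (z - \<zeta>))" by (simp add: g_def poly_pcompose)
  have B0: "coeff ?B 0 \<noteq> 0" using B[OF \<zeta>] by (simp flip: poly_0_coeff_0 add: poly_pcompose)
  have "taylor_fps \<Omega> ?f \<zeta> = fps_expansion g \<zeta>"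
    by (simp add: fps_eq_iff fps_expansion_def ext_deriv_restrict[OF \<Omega> U \<zeta>])
  hence "fps_of_poly ?B * taylor_fps \<Omega> ?f \<zeta> = fps_of_poly ?A"
    using fps_expansion_rational[OF B0] g_eq by simp
  moreover have "pcompose u ?L * ?A + pcompose v ?L * ?B = 1"
    using arg_cong[OF bezout, of "\<lambda>P. pcompose P ?L"] by (simp add: pcompose_add pcompose_mult pcompose_1)
  moreover have "degree ?A = p" "degree ?B \<le> q" using deg by (simp_all add: degree_pcompose)
  moreover have "?A \<noteq> 0" using A0 by (simp add: pcompose_eq_0_iff)
  ultimately have det: "Determinant.det (hankel_mat p q (taylor_fps \<Omega> ?f \<zeta>)) \<noteq> 0"
    and frac: "pade_fraction p q (taylor_fps \<Omega> ?f \<zeta>)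
      (Polynomial.smult (1 / coeff ?B 0) ?A) (Polynomial.smult (1 / coeff ?B 0) ?B)"
    using pade_fraction_rational B0 by blast+
  show "?f \<in> pade_class \<Omega> p q \<zeta>" using det f by (simp add: pade_class_iff)
  show "pade_error \<Omega> ?f p q l \<zeta> z = 0" if z: "z \<in> closure \<Omega>"
  proof -
    have "pade \<Omega> ?f \<zeta> p q = remove_sings g"
      using pade_eqI[OF frac] B0 by (simp add: g_eq)
    moreover have an: "g analytic_on {z}"
      unfolding g_eq by (rule analytic_rational) (use B[OF z] in \<open>simp add: poly_pcompose\<close>)
    hence "\<forall>\<^sub>F w in at z. remove_sings g w = g w"
      using eventually_remove_sings_eq_nhds eventually_nhds_conv_at by blast
    hence "\<not> is_pole (remove_sings g) z"
      using is_pole_cong[OF _ refl] analytic_at_imp_no_pole[OF an] by blast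
    moreover have "(deriv ^^ l) (remove_sings g) z = (deriv ^^ l) g z"
      using an by (intro higher_deriv_cong_ev eventually_remove_sings_eq_nhds) auto
    ultimately show ?thesis by (simp add: pade_error_def ext_deriv_restrict[OF \<Omega> U z])
  qed
qed

section \<open>Topology, density and Baire category\<close>

lemma openin_A_inf_nbhd:
  assumes \<Omega>: "open \<Omega>" and K: "compact K" "K \<subseteq> closure \<Omega>" and f: "f \<in> A_inf \<Omega>"
  shows "openin (A_inf_topology \<Omega>) (A_inf_nbhd \<Omega> f K L \<epsilon>)"
  unfolding openin_A_inf_topology
proof (intro conjI ballI)
  fix g assume g: "g \<in> A_inf_nbhd \<Omega> f K L \<epsilon>"
  hence gA: "g \<in> A_inf \<Omega>" by (simp add: A_inf_nbhd_def)
  \<comment> \<open>A strict bound on a continuous function over a compact set leaves a gap below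
    \<epsilon>; with finitely many orders \<open>l\<close>, one \<delta> fits into all gaps.\<close>
  have "\<exists>c<\<epsilon>. \<forall>z\<in>K. norm (ext_deriv \<Omega> l g z - ext_deriv \<Omega> l f z) \<le> c" if l: "l \<le> L" for l
  proof (cases "K = {}")
    case True
    thus ?thesis by (intro exI[of _ "\<epsilon> - 1"]) auto
  next
    case False
    have "continuous_on K (\<lambda>z. norm (ext_deriv \<Omega> l g z - ext_deriv \<Omega> l f z))"
      by (intro continuous_intros continuous_on_subset[OF continuous_on_ext_deriv[OF \<Omega>] K(2)] f gA)
    from continuous_attains_sup[OF K(1) False this] obtain x where
      "x \<in> K" "\<forall>z\<in>K. norm (ext_deriv \<Omega> l g z - ext_deriv \<Omega> l f z) \<le> norm (ext_deriv \<Omega> l g x - ext_deriv \<Omega> l f x)"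
      by blast
    thus ?thesis using g l unfolding A_inf_nbhd_def by blast
  qed
  then obtain c where c: "\<And>l. l \<le> L \<Longrightarrow> c l < \<epsilon>"
    "\<And>l z. l \<le> L \<Longrightarrow> z \<in> K \<Longrightarrow> norm (ext_deriv \<Omega> l g z - ext_deriv \<Omega> l f z) \<le> c l"
    by metis
  define \<delta> where "\<delta> = \<epsilon> - Max (c ` {..L})"
  have "\<delta> > 0" using c(1) by (simp add: \<delta>_def)
  have cmax: "c l \<le> \<epsilon> - \<delta>" if "l \<le> L" for l using that by (simp add: \<delta>_def)
  have "A_inf_nbhd \<Omega> g K L \<delta> \<subseteq> A_inf_nbhd \<Omega> f K L \<epsilon>"
  proof
    fix h assume h: "h \<in> A_inf_nbhd \<Omega> g K L \<delta>"
    have "norm (ext_deriv \<Omega> l h z - ext_deriv \<Omega> l f z) < \<epsilon>" if "l \<le> L" "z \<in> K" for l z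
    proof -
      have "norm (ext_deriv \<Omega> l h z - ext_deriv \<Omega> l g z) < \<delta>"
        using h that by (simp add: A_inf_nbhd_def)
      hence "norm (ext_deriv \<Omega> l h z - ext_deriv \<Omega> l g z) + norm (ext_deriv \<Omega> l g z - ext_deriv \<Omega> l f z) < \<epsilon>"
        using c(2)[OF that] cmax[OF that(1)] by linarith
      from norm_triangle_lt[OF this] show ?thesis by simp
    qed
    thus "h \<in> A_inf_nbhd \<Omega> f K L \<epsilon>" using h by (simp add: A_inf_nbhd_def)
  qed
  thus "\<exists>K' L' \<epsilon>'. compact K' \<and> K' \<subseteq> closure \<Omega> \<and> \<epsilon>' > 0 \<and> A_inf_nbhd \<Omega> g K' L' \<epsilon>' \<subseteq> A_inf_nbhd \<Omega> f K L \<epsilon>"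
    using K \<open>\<delta> > 0\<close> by (intro exI[of _ K] exI[of _ L] exI[of _ \<delta>]) simp
qed (auto simp: A_inf_nbhd_def)

text \<open>Each order has a continuous limit on the closure. Inside \<Omega>, locally uniform
  limits of holomorphic functions may be differentiated termwise, so these limits are the
  derivatives of the one of order zero.\<close>

lemma A_inf_complete:
  assumes \<Omega>: "open \<Omega>" and fs: "\<And>n. fs n \<in> A_inf \<Omega>"
    and Cauchy: "\<And>l K. compact K \<Longrightarrow> K \<subseteq> closure \<Omega> \<Longrightarrow> uniformly_Cauchy_on K (\<lambda>n. ext_deriv \<Omega> l (fs n))"
  obtains f where "f \<in> A_inf \<Omega>" "limitin (A_inf_topology \<Omega>) fs f sequentially"
proof -
  define G where "G l z = lim (\<lambda>n. ext_deriv \<Omega> l (fs n) z)" for l z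
  have lim: "uniform_limit K (\<lambda>n. ext_deriv \<Omega> l (fs n)) (G l) sequentially"
    if "compact K" "K \<subseteq> closure \<Omega>" for l K
    using Cauchy_uniformly_convergent[OF Cauchy[OF that]]
    unfolding uniformly_convergent_uniform_limit_iff G_def by simp
  have pt: "(\<lambda>n. ext_deriv \<Omega> l (fs n) z) \<longlonglongrightarrow> G l z" if "z \<in> closure \<Omega>" for l z
    using tendsto_uniform_limitI[OF lim[of "{z}"]] that by simp
  have cont: "continuous_on (closure \<Omega>) (G l)" for l
    unfolding continuous_on_eq_continuous_within
  proof
    fix z assume z: "z \<in> closure \<Omega>"
    \<comment> \<open>A compact neighbourhood of \<open>z\<close> relative to the closure, as
      uniform convergence is known on compact sets only.\<close>
    define K where "K = closure \<Omega> \<inter> cball z 1"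
    have K: "compact K" "K \<subseteq> closure \<Omega>" unfolding K_def by (auto intro: closed_Int_compact)
    have "continuous_on K (G l)"
      by (rule uniform_limit_theorem[OF _ lim[OF K]])
        (auto intro!: always_eventually continuous_on_subset[OF continuous_on_ext_deriv[OF \<Omega> fs] K(2)])
    hence "continuous (at z within K) (G l)"
      using z by (simp add: continuous_on_eq_continuous_within K_def)
    moreover have "at z within K = at z within closure \<Omega>"
      by (rule at_within_nhd[of _ "ball z 1"]) (auto simp: K_def)
    ultimately show "continuous (at z within closure \<Omega>) (G l)" by simp
  qed
  have sub: "\<Omega> \<subseteq> closure \<Omega>" by (rule closure_subset)
  have limD: "uniform_limit (cball z r) fs (G 0) sequentially" if "cball z r \<subseteq> \<Omega>" for z r
  proof -
    have "uniform_limit (cball z r) (\<lambda>n. ext_deriv \<Omega> 0 (fs n)) (G 0) sequentially"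
      using that sub by (intro lim) auto
    thus ?thesis
      by (rule uniform_limit_cong'[THEN iffD1, rotated -1])
        (use that in \<open>auto simp: ext_deriv_eq[OF \<Omega> fs]\<close>)
  qed
  have fs_hol: "fs n holomorphic_on \<Omega>" for n using fs by (simp add: A_inf_def)
  have "G 0 holomorphic_on \<Omega>"
  proof (rule holomorphic_uniform_sequence[OF \<Omega> fs_hol])
    fix x assume "x \<in> \<Omega>"
    then obtain d where "d > 0" "cball x d \<subseteq> \<Omega>" using \<Omega> open_contains_cball by blast
    thus "\<exists>d>0. cball x d \<subseteq> \<Omega> \<and> uniform_limit (cball x d) fs (G 0) sequentially" using limD by blast
  qed
  define f where "f = restrict (G 0) \<Omega>"
  have deriv: "G l z = (deriv ^^ l) f z" if z: "z \<in> \<Omega>" for l z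
  proof -
    obtain d where d: "d > 0" "cball z d \<subseteq> \<Omega>" using z \<Omega> open_contains_cball by blast
    have "(\<lambda>n. (deriv ^^ l) (fs n) z) \<longlonglongrightarrow> (deriv ^^ l) (G 0) z"
    proof (rule higher_deriv_complex_uniform_limit)
      show "uniform_limit (ball z d) fs (G 0) sequentially"
        using limD[OF d(2)] uniform_limit_on_subset ball_subset_cball by blast
      show "\<forall>\<^sub>F n in sequentially. fs n holomorphic_on ball z d"
        using d(2) by (intro always_eventually allI holomorphic_on_subset[OF fs_hol]) auto
    qed (use d in auto)
    moreover have "(\<lambda>n. (deriv ^^ l) (fs n) z) \<longlonglongrightarrow> G l z"
      using pt[of z l] z sub ext_deriv_eq[OF \<Omega> fs z] by auto
    ultimately have "(deriv ^^ l) (G 0) z = G l z" by (rule LIMSEQ_unique)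
    also have "(deriv ^^ l) (G 0) z = (deriv ^^ l) f z"
      using z \<Omega> by (intro higher_deriv_cong_ev) (auto simp: f_def eventually_nhds)
    finally show ?thesis ..
  qed
  have "f holomorphic_on \<Omega>"
    using \<open>G 0 holomorphic_on \<Omega>\<close> by (rule holomorphic_transform) (simp add: f_def)
  hence f: "f \<in> A_inf \<Omega>"
    unfolding A_inf_def using cont deriv by (auto simp: f_def)
  have ext: "ext_deriv \<Omega> l f z = G l z" if "z \<in> closure \<Omega>" for l z
    by (rule ext_deriv_unique[OF \<Omega> cont deriv that])
  have "limitin (A_inf_topology \<Omega>) fs f sequentially"
    unfolding limitin_A_inf_topology[OF fs f]
  proof (intro allI impI)
    fix l K assume K: "compact K \<and> K \<subseteq> closure \<Omega>"
    hence "uniform_limit K (\<lambda>n. ext_deriv \<Omega> l (fs n)) (G l) sequentially" by (intro lim) auto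
    thus "uniform_limit K (\<lambda>n. ext_deriv \<Omega> l (fs n)) (ext_deriv \<Omega> l f) sequentially"
      by (rule uniform_limit_cong'[THEN iffD1, rotated -1]) (use K ext in auto)
  qed
  with f that show ?thesis by blast
qed

section \<open>Compact exhaustion and Baire category\<close>

definition exhaustion :: "complex set \<Rightarrow> nat \<Rightarrow> complex set" where
  "exhaustion \<Omega> m = closure \<Omega> \<inter> cball 0 (real m)"

lemma compact_exhaustion: "compact (exhaustion \<Omega> m)"
  and exhaustion_subset: "exhaustion \<Omega> m \<subseteq> closure \<Omega>"
  and exhaustion_mono: "m \<le> n \<Longrightarrow> exhaustion \<Omega> m \<subseteq> exhaustion \<Omega> n"
  by (auto simp: exhaustion_def closed_Int_compact)

lemma compact_subset_exhaustion:
  assumes "compact K" "K \<subseteq> closure \<Omega>"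
  obtains m where "K \<subseteq> exhaustion \<Omega> m"
proof -
  obtain M where "\<And>z. z \<in> K \<Longrightarrow> norm z \<le> M"
    using assms compact_imp_bounded bounded_iff by metis
  moreover obtain m where "M \<le> real m" using real_arch_simple by blast
  ultimately have "K \<subseteq> exhaustion \<Omega> m" using assms unfolding exhaustion_def by force
  thus ?thesis using that by blast
qed

text \<open>The factor 2 makes room for limits of points of the neighbourhood of radius
  \<open>r\<close>, for which the bound is no longer strict. \<open>m0\<close> and \<open>r0\<close>
  let the Baire construction push orders up and radii down.\<close>

lemma A_inf_nbhd_base:
  assumes "openin (A_inf_topology \<Omega>) W" "f \<in> W" "r0 > 0"
  obtains m r where "m \<ge> m0" "0 < r" "r \<le> r0" "A_inf_nbhd \<Omega> f (exhaustion \<Omega> m) m (2 * r) \<subseteq> W"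
proof -
  obtain K L \<epsilon> where K: "compact K" "K \<subseteq> closure \<Omega>" "\<epsilon> > 0" "A_inf_nbhd \<Omega> f K L \<epsilon> \<subseteq> W"
    using assms unfolding openin_A_inf_topology by meson
  obtain k where k: "K \<subseteq> exhaustion \<Omega> k" using compact_subset_exhaustion[OF K(1,2)] .
  define m where "m = max m0 (max k L)"
  have "A_inf_nbhd \<Omega> f (exhaustion \<Omega> m) m (2 * min r0 (\<epsilon> / 2)) \<subseteq> A_inf_nbhd \<Omega> f K L \<epsilon>"
  proof (rule A_inf_nbhd_mono)
    have "k \<le> m" by (simp add: m_def)
    thus "K \<subseteq> exhaustion \<Omega> m" using k exhaustion_mono by blast
  qed (auto simp: m_def)
  with K assms(3) show ?thesis
    by (intro that[of m "min r0 (\<epsilon> / 2)"]) (auto simp: m_def)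
qed

text \<open>The nested-ball argument, a triple holding centre, order and radius. Growing orders and
  radii at most \<open>(1 / 2) ^ n\<close> make the centres Cauchy in every seminorm; closedness
  keeps their limit in \<open>X\<close>.\<close>

lemma A_inf_Baire:
  fixes G :: "nat \<Rightarrow> (complex \<Rightarrow> complex) set"
  assumes \<Omega>: "open \<Omega>" and X: "closedin (A_inf_topology \<Omega>) X"
    and G: "\<And>n. openin (A_inf_topology \<Omega>) (G n)"
    and dense: "\<And>n W. openin (A_inf_topology \<Omega>) W \<Longrightarrow> W \<inter> X \<noteq> {} \<Longrightarrow> W \<inter> X \<inter> G n \<noteq> {}"
    and W: "openin (A_inf_topology \<Omega>) W" "W \<inter> X \<noteq> {}"
  shows "W \<inter> X \<inter> (\<Inter>n. G n) \<noteq> {}"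
proof -
  have XA: "X \<subseteq> A_inf \<Omega>" using closedin_subset[OF X] by simp
  define B where "B = (\<lambda>(f, m, r). A_inf_nbhd \<Omega> f (exhaustion \<Omega> m) m r)"
  define P where "P n = (\<lambda>(f, m, r). f \<in> X \<and> n \<le> m \<and> 0 < r \<and> r \<le> (1 / 2) ^ n \<and> B (f, m, 2 * r) \<subseteq> W)" for n :: nat
  \<comment> \<open>The new neighbourhood fits with doubled radius into the old one with single
    radius. Limits of points of \<open>B (f, m, r)\<close> satisfy only \<open>\<le> r\<close>, but
    that places them in \<open>B (f, m, 2 * r)\<close>.\<close>
  define Q where "Q n = (\<lambda>(f, m, r) (f', m', r'). B (f', m', 2 * r') \<subseteq> B (f, m, r) \<inter> G n)" for n :: nat
  have B_mono: "r \<le> r' \<Longrightarrow> B (f, m, r) \<subseteq> B (f, m, r')" for f m r r'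
    unfolding B_def prod.case by (intro A_inf_nbhd_mono) auto
  have self: "f \<in> B (f, m, r)" if "f \<in> X" "r > 0" for f m r
    using that XA by (auto simp: B_def A_inf_nbhd_def)
  have "\<exists>s. P 0 s"
  proof -
    obtain f where f: "f \<in> W" "f \<in> X" using W by blast
    obtain m r where "m \<ge> 0" "0 < r" "r \<le> 1" "A_inf_nbhd \<Omega> f (exhaustion \<Omega> m) m (2 * r) \<subseteq> W"
      using A_inf_nbhd_base[OF W(1) f(1), of 1 0] by auto
    thus ?thesis using f by (intro exI[of _ "(f, m, r)"]) (simp add: P_def B_def)
  qed
  moreover have "\<exists>s'. P (Suc n) s' \<and> Q n s s'" if "P n s" for s n
  proof -
    obtain f m r where s: "s = (f, m, r)" by (cases s) auto
    have f: "f \<in> X" "0 < r" "B (f, m, 2 * r) \<subseteq> W" using that by (auto simp: s P_def)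
    have op: "openin (A_inf_topology \<Omega>) (B (f, m, r))"
      unfolding B_def prod.case using f XA
      by (intro openin_A_inf_nbhd \<Omega> compact_exhaustion exhaustion_subset) auto
    obtain f' where f': "f' \<in> B (f, m, r) \<inter> G n" "f' \<in> X"
      using dense[OF op] self[OF f(1,2)] f(1) by blast
    obtain m' r' where m': "m' \<ge> Suc n" "0 < r'" "r' \<le> (1 / 2) ^ Suc n"
      "A_inf_nbhd \<Omega> f' (exhaustion \<Omega> m') m' (2 * r') \<subseteq> B (f, m, r) \<inter> G n"
      using A_inf_nbhd_base[OF openin_Int[OF op G] f'(1), of "(1 / 2) ^ Suc n" "Suc n"] by auto
    have "B (f, m, r) \<subseteq> W" using B_mono[of r "2 * r" f m] f by auto
    with m' f' show ?thesis
      by (intro exI[of _ "(f', m', r')"]) (auto simp: P_def Q_def s B_def)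
  qed
  ultimately obtain s where s: "\<And>n. P n (s n)" "\<And>n. Q n (s n) (s (Suc n))"
    using dependent_nat_choice[of P Q] by blast
  define fs ms rs where "fs n = fst (s n)" and "ms n = fst (snd (s n))" and "rs n = snd (snd (s n))" for n
  have sn: "s n = (fs n, ms n, rs n)" for n by (simp add: fs_def ms_def rs_def)
  have P: "fs n \<in> X" "n \<le> ms n" "0 < rs n" "rs n \<le> (1 / 2) ^ n" "B (fs n, ms n, 2 * rs n) \<subseteq> W" for n
    using s(1)[of n] by (simp_all add: sn P_def)
  have Q: "B (fs (Suc n), ms (Suc n), 2 * rs (Suc n)) \<subseteq> B (fs n, ms n, rs n) \<inter> G n" for n
    using s(2)[of n] by (simp add: sn Q_def)
  have "B (fs (n + k), ms (n + k), 2 * rs (n + k)) \<subseteq> B (fs n, ms n, 2 * rs n)" for n k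
  proof (induction k)
    case (Suc k)
    have "B (fs (n + k), ms (n + k), rs (n + k)) \<subseteq> B (fs (n + k), ms (n + k), 2 * rs (n + k))"
      using P(3)[of "n + k"] by (intro B_mono) simp
    thus ?case using Q[of "n + k"] Suc.IH by auto
  qed simp
  hence nested: "B (fs k, ms k, 2 * rs k) \<subseteq> B (fs n, ms n, 2 * rs n)" if "n \<le> k" for n k
    using le_Suc_ex[OF that] by metis
  have fs_mem: "fs k \<in> B (fs n, ms n, rs n)" if "n < k" for n k
  proof -
    have "fs k \<in> B (fs k, ms k, 2 * rs k)" using P by (intro self) auto
    also have "\<dots> \<subseteq> B (fs (Suc n), ms (Suc n), 2 * rs (Suc n))" using that by (intro nested) auto
    finally show ?thesis using Q[of n] by blast
  qed
  have near: "norm (ext_deriv \<Omega> l (fs k) z - ext_deriv \<Omega> l (fs n) z) \<le> rs n"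
    if "n \<le> k" "l \<le> ms n" "z \<in> exhaustion \<Omega> (ms n)" for n k l z
  proof (cases "n = k")
    case False
    thus ?thesis using fs_mem[of n k] that by (auto simp: B_def A_inf_nbhd_def less_imp_le)
  qed (use P(3)[of n] in simp)
  have fsA: "fs n \<in> A_inf \<Omega>" for n using P XA by blast
  have ucauchy: "uniformly_Cauchy_on K (\<lambda>n. ext_deriv \<Omega> l (fs n))" if K: "compact K" "K \<subseteq> closure \<Omega>" for l K
  proof (rule uniformly_Cauchy_onI)
    fix e :: real assume "e > 0"
    obtain k where k: "K \<subseteq> exhaustion \<Omega> k" using compact_subset_exhaustion[OF K] .
    obtain N0 where N0: "(1 / 2) ^ N0 < e / 2" using real_arch_pow_inv[of "e / 2" "1 / 2"] \<open>e > 0\<close> by auto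
    define N where "N = max N0 (max k l)"
    have "rs N \<le> (1 / 2) ^ N" using P by blast
    also have "\<dots> \<le> (1 / 2) ^ N0" by (rule power_decreasing) (auto simp: N_def)
    finally have r: "rs N < e / 2" using N0 by simp
    have "k \<le> ms N" "l \<le> ms N" using P(2)[of N] by (simp_all add: N_def)
    have close: "norm (ext_deriv \<Omega> l (fs n) z - ext_deriv \<Omega> l (fs N) z) < e / 2" if "n \<ge> N" "z \<in> K" for n z
    proof -
      have "z \<in> exhaustion \<Omega> (ms N)" using that(2) k exhaustion_mono[OF \<open>k \<le> ms N\<close>] by blast
      from near[OF that(1) \<open>l \<le> ms N\<close> this] r show ?thesis by linarith
    qed
    have "dist (ext_deriv \<Omega> l (fs m) z) (ext_deriv \<Omega> l (fs n) z) < e" if "z \<in> K" "m \<ge> N" "n \<ge> N" for z m n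
      using dist_triangle_half_l[OF close[OF that(2,1), folded dist_norm] close[OF that(3,1), folded dist_norm]] .
    thus "\<exists>M. \<forall>x\<in>K. \<forall>m\<ge>M. \<forall>n\<ge>M. dist (ext_deriv \<Omega> l (fs m) x) (ext_deriv \<Omega> l (fs n) x) < e"
      by (intro exI[of _ N] ballI allI impI)
  qed
  obtain f where f: "f \<in> A_inf \<Omega>" "limitin (A_inf_topology \<Omega>) fs f sequentially"
    by (rule A_inf_complete[OF \<Omega> fsA ucauchy])
  have fB: "f \<in> B (fs n, ms n, 2 * rs n)" for n
  proof -
    have "norm (ext_deriv \<Omega> l f z - ext_deriv \<Omega> l (fs n) z) < 2 * rs n"
      if lz: "l \<le> ms n" "z \<in> exhaustion \<Omega> (ms n)" for l z
    proof -
      have "compact {z} \<and> {z} \<subseteq> closure \<Omega>" using lz exhaustion_subset[of \<Omega> "ms n"] by auto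
      hence "uniform_limit {z} (\<lambda>m. ext_deriv \<Omega> l (fs m)) (ext_deriv \<Omega> l f) sequentially"
        by (rule f(2)[unfolded limitin_A_inf_topology[OF fsA f(1)], rule_format])
      hence "(\<lambda>m. ext_deriv \<Omega> l (fs m) z) \<longlonglongrightarrow> ext_deriv \<Omega> l f z"
        by (rule tendsto_uniform_limitI) simp
      hence "(\<lambda>m. norm (ext_deriv \<Omega> l (fs m) z - ext_deriv \<Omega> l (fs n) z)) \<longlonglongrightarrow>
          norm (ext_deriv \<Omega> l f z - ext_deriv \<Omega> l (fs n) z)"
        by (intro tendsto_intros)
      hence "norm (ext_deriv \<Omega> l f z - ext_deriv \<Omega> l (fs n) z) \<le> rs n"
        by (rule LIMSEQ_le_const2) (use near lz in blast)
      thus ?thesis using P(3)[of n] by simp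
    qed
    thus ?thesis using f by (simp add: B_def A_inf_nbhd_def)
  qed
  have "f \<in> W" using fB[of 0] P(5)[of 0] by blast
  moreover have "f \<in> G n" for n using fB[of "Suc n"] Q[of n] by blast
  moreover have "f \<in> X"
    using limitin_closedin[OF f(2) X] P(1) by auto
  ultimately show ?thesis by blast
qed

text \<open>One index \<open>m\<close> governs compact set, number of derivatives and tolerance, so
  that a countable intersection captures convergence of all derivatives on all compact sets.\<close>

definition pade_set :: "complex set \<Rightarrow> nat \<Rightarrow> nat \<Rightarrow> nat \<Rightarrow> (complex \<Rightarrow> complex) set" where
  "pade_set \<Omega> m p q = {f \<in> A_inf \<Omega>. \<forall>\<zeta>\<in>exhaustion \<Omega> m. \<forall>z\<in>exhaustion \<Omega> m.
     pade_close m (1 / Suc m) p q (taylor_fps \<Omega> f \<zeta>) (z - \<zeta>) (\<lambda>l. ext_deriv \<Omega> l f z)}"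

text \<open>Centre and argument range over a compact product. Failures in ever smaller
  neighbourhoods of \<open>f\<close> would have a subsequence converging to a pair at which
  \<open>f\<close> satisfies the condition, against the stability of
  \<open>pade_close\<close>.\<close>

lemma openin_pade_set:
  assumes \<Omega>: "open \<Omega>"
  shows "openin (A_inf_topology \<Omega>) (pade_set \<Omega> m p q)"
  unfolding openin_A_inf_topology
proof (intro conjI ballI)
  fix f assume f: "f \<in> pade_set \<Omega> m p q"
  hence fA: "f \<in> A_inf \<Omega>" by (simp add: pade_set_def)
  let ?K = "exhaustion \<Omega> m"
  define close where "close g \<zeta> z \<longleftrightarrow>
    pade_close m (1 / Suc m) p q (taylor_fps \<Omega> g \<zeta>) (z - \<zeta>) (\<lambda>l. ext_deriv \<Omega> l g z)" for g \<zeta> z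
  have "\<exists>n. A_inf_nbhd \<Omega> f ?K n (1 / Suc n) \<subseteq> pade_set \<Omega> m p q"
  proof (rule ccontr)
    assume neg: "\<not> ?thesis"
    \<comment> \<open>The order \<open>n\<close> grows while the tolerance shrinks, so each single
      Taylor coefficient converges, uniformly on \<open>?K\<close>.\<close>
    have "\<exists>g \<zeta> z. g \<in> A_inf_nbhd \<Omega> f ?K n (1 / Suc n) \<and> \<zeta> \<in> ?K \<and> z \<in> ?K \<and> \<not> close g \<zeta> z" for n
    proof -
      obtain g where g: "g \<in> A_inf_nbhd \<Omega> f ?K n (1 / Suc n)" "g \<notin> pade_set \<Omega> m p q" using neg by blast
      hence "g \<in> A_inf \<Omega>" by (simp add: A_inf_nbhd_def)
      with g(2) obtain \<zeta> z where "\<zeta> \<in> ?K" "z \<in> ?K" "\<not> close g \<zeta> z" unfolding pade_set_def close_def by auto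
      with g(1) show ?thesis by (intro exI conjI)
    qed
    then obtain g \<zeta> z where g: "\<And>n. g n \<in> A_inf_nbhd \<Omega> f ?K n (1 / Suc n)"
      and \<zeta>z: "\<And>n. \<zeta> n \<in> ?K" "\<And>n. z n \<in> ?K" and bad: "\<And>n. \<not> close (g n) (\<zeta> n) (z n)"
      by metis
    have "seq_compact (?K \<times> ?K)" by (intro compact_imp_seq_compact compact_Times compact_exhaustion)
    moreover have "\<forall>n. (\<zeta> n, z n) \<in> ?K \<times> ?K" using \<zeta>z by simp
    ultimately obtain l r where l: "l \<in> ?K \<times> ?K" "strict_mono r" "((\<lambda>n. (\<zeta> n, z n)) \<circ> r) \<longlonglongrightarrow> l"
      by (rule seq_compactE)
    obtain \<zeta>0 z0 where l_eq: "l = (\<zeta>0, z0)" by (cases l)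
    have mem: "\<zeta>0 \<in> ?K" "z0 \<in> ?K" using l(1) l_eq by auto
    have conv: "(\<lambda>n. \<zeta> (r n)) \<longlonglongrightarrow> \<zeta>0" "(\<lambda>n. z (r n)) \<longlonglongrightarrow> z0"
      using tendsto_fst[OF l(3)] tendsto_snd[OF l(3)] by (simp_all add: l_eq o_def)
    have lim: "(\<lambda>n. ext_deriv \<Omega> i (g (r n)) (x (r n))) \<longlonglongrightarrow> ext_deriv \<Omega> i f x0"
      if x: "\<And>n. x n \<in> ?K" "(\<lambda>n. x (r n)) \<longlonglongrightarrow> x0" "x0 \<in> ?K" for i x x0
    proof -
      have "(\<lambda>n. ext_deriv \<Omega> i f (x (r n))) \<longlonglongrightarrow> ext_deriv \<Omega> i f x0"
        by (rule continuous_on_tendsto_compose[OF continuous_on_ext_deriv[OF \<Omega> fA] x(2)])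
          (use x exhaustion_subset[of \<Omega> m] in \<open>auto intro!: always_eventually\<close>)
      moreover have "(\<lambda>n. ext_deriv \<Omega> i (g (r n)) (x (r n)) - ext_deriv \<Omega> i f (x (r n))) \<longlonglongrightarrow> 0"
      proof (rule Lim_null_comparison)
        have "norm (ext_deriv \<Omega> i (g (r n)) (x (r n)) - ext_deriv \<Omega> i f (x (r n))) \<le> 1 / Suc n" if "n \<ge> i" for n
        proof -
          have rn: "n \<le> r n" using l(2) by (rule seq_suble)
          have "norm (ext_deriv \<Omega> i (g (r n)) (x (r n)) - ext_deriv \<Omega> i f (x (r n))) < 1 / Suc (r n)"
            using g[of "r n"] that rn x(1)[of "r n"] unfolding A_inf_nbhd_def by auto
          also have "\<dots> \<le> 1 / Suc n" using rn by (intro frac_le) auto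
          finally show ?thesis by simp
        qed
        thus "\<forall>\<^sub>F n in sequentially. norm (ext_deriv \<Omega> i (g (r n)) (x (r n)) - ext_deriv \<Omega> i f (x (r n))) \<le> 1 / Suc n"
          unfolding eventually_sequentially by blast
        show "(\<lambda>n. 1 / real (Suc n)) \<longlonglongrightarrow> 0" using LIMSEQ_inverse_real_of_nat by (simp add: inverse_eq_divide)
      qed
      ultimately show ?thesis using tendsto_add by fastforce
    qed
    have "\<forall>\<^sub>F n in sequentially. close (g (r n)) (\<zeta> (r n)) (z (r n))"
      unfolding close_def
    proof (rule eventually_pade_close)
      show "pade_close m (1 / Suc m) p q (taylor_fps \<Omega> f \<zeta>0) (z0 - \<zeta>0) (\<lambda>l. ext_deriv \<Omega> l f z0)"
        using f mem by (simp add: pade_set_def)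
      show "(\<lambda>n. fps_nth (taylor_fps \<Omega> (g (r n)) (\<zeta> (r n))) i) \<longlonglongrightarrow> fps_nth (taylor_fps \<Omega> f \<zeta>0) i" for i
        unfolding fps_nth_taylor_fps by (intro tendsto_divide tendsto_const lim \<zeta>z conv mem) auto
      show "(\<lambda>n. z (r n) - \<zeta> (r n)) \<longlonglongrightarrow> z0 - \<zeta>0" by (intro tendsto_diff conv)
      show "(\<lambda>n. ext_deriv \<Omega> l (g (r n)) (z (r n))) \<longlonglongrightarrow> ext_deriv \<Omega> l f z0" for l
        by (intro lim \<zeta>z conv mem)
    qed
    thus False using bad by (simp add: eventually_sequentially)
  qed
  then obtain n where "A_inf_nbhd \<Omega> f ?K n (1 / Suc n) \<subseteq> pade_set \<Omega> m p q" by blast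
  thus "\<exists>K L \<epsilon>. compact K \<and> K \<subseteq> closure \<Omega> \<and> \<epsilon> > 0 \<and> A_inf_nbhd \<Omega> f K L \<epsilon> \<subseteq> pade_set \<Omega> m p q"
    using compact_exhaustion exhaustion_subset
    by (intro exI[of _ ?K] exI[of _ n] exI[of _ "1 / real (Suc n)"]) auto
qed (auto simp: pade_set_def)

text \<open>A pair picked for each \<open>m\<close> already forms the required sequence, since any
  compact set and any order are covered from some index on. Conversely, a late member of a given
  sequence meets the finitely many bounds for \<open>m\<close>.\<close>

lemma pade_approximable_iff:
  assumes f: "f \<in> A_inf \<Omega>"
  shows "pade_approximable \<Omega> F f \<longleftrightarrow> (\<forall>m. \<exists>(p, q)\<in>F. f \<in> pade_set \<Omega> m p q)"
proof
  assume "pade_approximable \<Omega> F f"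
  then obtain p q where F: "\<forall>n. (p n, q n) \<in> F" and
    lim: "\<forall>K. compact K \<and> K \<subseteq> closure \<Omega> \<longrightarrow>
      (\<exists>N. \<forall>n\<ge>N. \<forall>\<zeta>\<in>K. f \<in> pade_class \<Omega> (p n) (q n) \<zeta>) \<and>
      (\<forall>l. (\<lambda>n. SUP \<zeta>\<in>K. SUP z\<in>K. pade_error \<Omega> f (p n) (q n) l \<zeta> z) \<longlonglongrightarrow> 0)"
    unfolding pade_approximable_def by (elim exE conjE)
  note lim = lim[THEN spec, THEN mp, OF conjI, OF compact_exhaustion exhaustion_subset]
  note cls = lim[THEN conjunct1] and err = lim[THEN conjunct2, THEN spec]
  show "\<forall>m. \<exists>(p, q)\<in>F. f \<in> pade_set \<Omega> m p q"
  proof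
    fix m
    let ?K = "exhaustion \<Omega> m"
    have "\<forall>\<^sub>F n in sequentially. \<forall>\<zeta>\<in>?K. f \<in> pade_class \<Omega> (p n) (q n) \<zeta>"
      unfolding eventually_sequentially by (rule cls)
    moreover have "\<forall>\<^sub>F n in sequentially. \<forall>l\<in>{..m}.
        (SUP \<zeta>\<in>?K. SUP z\<in>?K. pade_error \<Omega> f (p n) (q n) l \<zeta> z) < ennreal (1 / Suc m)"
      by (intro eventually_ball_finite ballI order_tendstoD(2)[OF err]) auto
    ultimately have "\<forall>\<^sub>F n in sequentially. f \<in> pade_set \<Omega> m (p n) (q n)"
    proof eventually_elim
      case (elim n)
      have "pade_error \<Omega> f (p n) (q n) l \<zeta> z < ennreal (1 / Suc m)" if "l \<le> m" "\<zeta> \<in> ?K" "z \<in> ?K" for l \<zeta> z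
      proof -
        have "pade_error \<Omega> f (p n) (q n) l \<zeta> z \<le> (SUP \<zeta>\<in>?K. SUP z\<in>?K. pade_error \<Omega> f (p n) (q n) l \<zeta> z)"
          using that by (intro SUP_upper2[of \<zeta>] SUP_upper2[of z]) auto
        also have "\<dots> < ennreal (1 / Suc m)" using elim(2) that(1) by auto
        finally show ?thesis .
      qed
      thus ?case using elim(1) f by (auto simp: pade_set_def pade_close_iff)
    qed
    then obtain n where "f \<in> pade_set \<Omega> m (p n) (q n)" by (auto simp: eventually_sequentially)
    thus "\<exists>(p, q)\<in>F. f \<in> pade_set \<Omega> m p q" using F by blast
  qed
next
  assume "\<forall>m. \<exists>(p, q)\<in>F. f \<in> pade_set \<Omega> m p q"
  hence "\<forall>m. \<exists>p q. (p, q) \<in> F \<and> f \<in> pade_set \<Omega> m p q" by blast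
  then obtain p q where F: "\<And>n. (p n, q n) \<in> F" and mem: "\<And>n. f \<in> pade_set \<Omega> n (p n) (q n)" by metis
  have *: "f \<in> pade_class \<Omega> (p n) (q n) \<zeta> \<and> (\<forall>l\<le>n. pade_error \<Omega> f (p n) (q n) l \<zeta> z < ennreal (1 / Suc n))"
    if "\<zeta> \<in> exhaustion \<Omega> n" "z \<in> exhaustion \<Omega> n" for n \<zeta> z
    using mem[of n] that f by (simp add: pade_set_def pade_close_iff)
  show "pade_approximable \<Omega> F f"
    unfolding pade_approximable_def
  proof (rule exI[of _ p], rule exI[of _ q], intro conjI allI impI)
    fix K assume K: "compact K \<and> K \<subseteq> closure \<Omega>"
    then obtain k where k: "K \<subseteq> exhaustion \<Omega> k" using compact_subset_exhaustion by metis
    hence sub: "K \<subseteq> exhaustion \<Omega> n" if "n \<ge> k" for n using exhaustion_mono[OF that] by blast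
    show "\<exists>N. \<forall>n\<ge>N. \<forall>\<zeta>\<in>K. f \<in> pade_class \<Omega> (p n) (q n) \<zeta>"
      using * sub by (intro exI[of _ k]) blast
    fix l
    have bound: "(SUP \<zeta>\<in>K. SUP z\<in>K. pade_error \<Omega> f (p n) (q n) l \<zeta> z) \<le> ennreal (1 / Suc n)"
      if "n \<ge> max k l" for n
      using * sub[of n] that by (intro SUP_least less_imp_le) auto
    have "(\<lambda>n. ennreal (1 / Suc n)) \<longlonglongrightarrow> ennreal 0"
      using LIMSEQ_inverse_real_of_nat by (intro tendsto_ennrealI) (simp add: inverse_eq_divide)
    hence lim: "(\<lambda>n. ennreal (1 / Suc n)) \<longlonglongrightarrow> 0" by simp
    show "(\<lambda>n. SUP \<zeta>\<in>K. SUP z\<in>K. pade_error \<Omega> f (p n) (q n) l \<zeta> z) \<longlonglongrightarrow> 0"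
      by (rule tendsto_sandwich[OF always_eventually eventually_sequentiallyI[of "max k l", OF bound] tendsto_const lim]) simp_all
  qed (rule F)
qed

text \<open>Euclid's algorithm. The common divisor is delivered as a linear combination, because
  dividing that identity by it yields the coprimality certificate used for fractions.\<close>

lemma euclidean_bezout:
  fixes a b :: "'a :: euclidean_ring"
  shows "\<exists>u v. u * a + v * b dvd a \<and> u * a + v * b dvd b"
proof (induction "euclidean_size b" arbitrary: a b rule: less_induct)
  case less
  show ?case
  proof (cases "b = 0")
    case True
    thus ?thesis by (intro exI[of _ 1] exI[of _ 0]) simp
  next
    case False
    then obtain u v where uv: "u * b + v * (a mod b) dvd b" "u * b + v * (a mod b) dvd a mod b"
      using less[of "a mod b" b] mod_size_less[OF False] by blast
    have "u * b + v * (a mod b) = v * a + (u - v * (a div b)) * b"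
      by (simp add: algebra_simps flip: minus_div_mult_eq_mod)
    moreover have "u * b + v * (a mod b) dvd a" using uv dvd_mod_imp_dvd by blast
    ultimately show ?thesis using uv(1) by metis
  qed
qed

lemma pade_set_dense:
  assumes \<Omega>: "open \<Omega>" and F: "\<And>n. (pt n, qt n) \<in> F"
    and lim: "filterlim pt at_top sequentially" "filterlim qt at_top sequentially"
    and W: "openin (A_inf_topology \<Omega>) W" "W \<inter> X_inf \<Omega> \<noteq> {}"
  shows "\<exists>(p, q)\<in>F. W \<inter> X_inf \<Omega> \<inter> pade_set \<Omega> m p q \<noteq> {}"
proof -
  have HX: "H_closure \<Omega> \<subseteq> X_inf \<Omega>"
    unfolding X_inf_def by (rule closure_of_subset) (simp add: H_closure_subset_A_inf[OF \<Omega>])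
  obtain f where "f \<in> W" "f \<in> A_inf_topology \<Omega> closure_of H_closure \<Omega>"
    using W(2) unfolding X_inf_def by blast
  then obtain h where h: "h \<in> H_closure \<Omega>" "h \<in> W"
    using W(1) unfolding in_closure_of by blast
  have hA: "h \<in> A_inf \<Omega>" using h H_closure_subset_A_inf[OF \<Omega>] by blast
  show ?thesis
  \<comment> \<open>For empty \<Omega> the condition is void; otherwise a point of the closure shows
    \<open>B0 \<noteq> 0\<close>, so a common divisor is nonzero and can be cancelled.\<close>
  proof (cases "\<Omega> = {}")
    case True
    hence "h \<in> pade_set \<Omega> m (pt 0) (qt 0)" using hA by (simp add: pade_set_def exhaustion_def)
    thus ?thesis using h HX F[of 0] by blast
  next
    case False
    obtain h0 U where h0: "h = restrict h0 \<Omega>" "open U" "closure \<Omega> \<subseteq> U" "h0 holomorphic_on U"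
      using h by (auto simp: H_closure_def)
    obtain K L \<epsilon> where K: "compact K" "K \<subseteq> closure \<Omega>" "\<epsilon> > 0" "A_inf_nbhd \<Omega> h K L \<epsilon> \<subseteq> W"
      using W(1) h(2) unfolding openin_A_inf_topology by meson
    have "\<epsilon> / 2 > 0" using K by simp
    obtain A0 B0 where AB0: "\<And>z. z \<in> closure \<Omega> \<Longrightarrow> poly B0 z \<noteq> 0"
      "\<And>l z. l \<le> L \<Longrightarrow> z \<in> K \<Longrightarrow>
        norm ((deriv ^^ l) (\<lambda>z. poly A0 z / poly B0 z) z - (deriv ^^ l) h0 z) < \<epsilon> / 2"
      by (rule Runge_higher_deriv[OF h0(2,3,4) K(1,2) \<open>\<epsilon> / 2 > 0\<close>, where L = L]) (rule that)
    have "B0 \<noteq> 0" using AB0(1) False closure_subset by fastforce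
    obtain u v where uv: "u * A0 + v * B0 dvd A0" "u * A0 + v * B0 dvd B0"
      using euclidean_bezout by blast
    define d where "d = u * A0 + v * B0"
    from uv obtain A B where AB: "A0 = d * A" "B0 = d * B" unfolding d_def[symmetric] by (elim dvdE)
    have "d \<noteq> 0" using \<open>B0 \<noteq> 0\<close> AB by auto
    moreover have "d * (u * A + v * B) = d * 1"
      unfolding distrib_left mult.left_commute[of d] AB[symmetric] by (simp add: d_def)
    ultimately have bezout: "u * A + v * B = 1" by (rule mult_left_cancel[THEN iffD1])
    have B: "poly B z \<noteq> 0" if "z \<in> closure \<Omega>" for z using AB0(1)[OF that] by (auto simp: AB)
    \<comment> \<open>Cancelling \<open>d\<close> is safe where \<open>B0\<close> is nonzero,
      whereas \<open>x / 0 = 0\<close> may spoil it elsewhere. Equality on this open set suffices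
      for derivatives.\<close>
    define V where "V = {z. poly B0 z \<noteq> 0}"
    have V: "open V" "closure \<Omega> \<subseteq> V" using AB0 by (auto simp: V_def open_Collect_neq continuous_intros)
    define r where "r z = poly A z / poly B z" for z
    have r_eq: "r z = poly A0 z / poly B0 z" if "z \<in> V" for z
      using that by (simp add: V_def r_def AB)
    have r: "norm ((deriv ^^ l) r z - (deriv ^^ l) h0 z) < \<epsilon> / 2" if "l \<le> L" "z \<in> K" for l z
    proof -
      have "z \<in> V" using that K V by blast
      from eventually_nhds_in_open[OF V(1) this]
      have "\<forall>\<^sub>F z in nhds z. r z = poly A0 z / poly B0 z"
        by eventually_elim (rule r_eq)
      hence "(deriv ^^ l) r z = (deriv ^^ l) (\<lambda>z. poly A0 z / poly B0 z) z"
        by (rule higher_deriv_cong_ev) simp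
      thus ?thesis using AB0(2)[OF that] by simp
    qed
    \<comment> \<open>With \<open>degree A < p\<close> the numerator cannot disturb the leading term
      of the perturbation, and \<open>degree B \<le> p\<close> makes \<open>k\<close> a true
      difference.\<close>
    have "\<forall>\<^sub>F n in sequentially. pt n \<ge> Suc (degree A) + degree B \<and> qt n \<ge> degree B"
      using lim unfolding filterlim_at_top by (auto intro: eventually_conj)
    then obtain n where n: "pt n \<ge> Suc (degree A) + degree B" "qt n \<ge> degree B"
      by (auto simp: eventually_sequentially)
    define p q k where "p = pt n" and "q = qt n" and "k = pt n - degree B"
    have "\<exists>M. \<forall>z\<in>K. norm ((deriv ^^ l) (\<lambda>z. z ^ k) z) \<le> M" for l
    proof -
      have "continuous_on K ((deriv ^^ l) (\<lambda>z. z ^ k))"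
        by (intro holomorphic_on_imp_continuous_on holomorphic_on_subset[OF holomorphic_higher_deriv[of _ UNIV]]
            holomorphic_intros) auto
      hence "bounded ((deriv ^^ l) (\<lambda>z. z ^ k) ` K)" using K(1) compact_continuous_image compact_imp_bounded by blast
      thus ?thesis unfolding bounded_iff by blast
    qed
    then obtain M where M: "\<And>l z. z \<in> K \<Longrightarrow> norm ((deriv ^^ l) (\<lambda>z. z ^ k) z) \<le> M l" by metis
    define S where "S = 1 + (\<Sum>l\<le>L. \<bar>M l\<bar>)"
    have "S > 0" unfolding S_def by (intro add_pos_nonneg sum_nonneg) auto
    have S: "norm ((deriv ^^ l) (\<lambda>z. z ^ k) z) < S" if "l \<le> L" "z \<in> K" for l z
    proof -
      have "norm ((deriv ^^ l) (\<lambda>z. z ^ k) z) \<le> \<bar>M l\<bar>" using M[OF that(2), of l] by linarith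
      also have "\<dots> \<le> (\<Sum>l\<le>L. \<bar>M l\<bar>)" using that by (intro member_le_sum) auto
      finally show ?thesis by (simp add: S_def)
    qed
    \<comment> \<open>Half of \<epsilon> goes to Runge's theorem and half to the monomial; the
      summand 1 in \<open>S\<close> guards against dividing by zero.\<close>
    define c :: complex where "c = of_real (\<epsilon> / (2 * S))"
    have c: "c \<noteq> 0" "norm c = \<epsilon> / (2 * S)" using K \<open>S > 0\<close> unfolding c_def norm_of_real by auto

    define A' where "A' = A + monom c k * B"
    define g where "g z = poly A' z / poly B z" for z
    have B0: "B \<noteq> 0" using \<open>B0 \<noteq> 0\<close> by (auto simp: AB)
    hence "degree (monom c k * B) = p"
      using c n by (simp add: degree_mult_eq degree_monom_eq monom_eq_0_iff k_def p_def)
    hence deg: "degree A' = p" unfolding A'_def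
      using n by (subst degree_add_eq_right) (auto simp: p_def)
    hence "A' \<noteq> 0" using n by (auto simp: p_def)
    \<comment> \<open>Since \<open>A'\<close> differs from \<open>A\<close> by a multiple of
      \<open>B\<close>, the second Bezout coefficient absorbs the change.\<close>
    have bezout': "u * A' + (v - u * monom c k) * B = 1"
      using bezout by (simp add: A'_def algebra_simps)
    define V' where "V' = {z. poly B z \<noteq> 0}"
    have V': "open V'" "closure \<Omega> \<subseteq> V'" using B by (auto simp: V'_def open_Collect_neq continuous_intros)
    have hol: "r holomorphic_on V'" "g holomorphic_on V'" "(\<lambda>z. c * z ^ k) holomorphic_on V'"
      by (auto simp: r_def[abs_def] g_def[abs_def] V'_def intro!: holomorphic_intros)
    have g_deriv: "(deriv ^^ l) g z = (deriv ^^ l) r z + c * (deriv ^^ l) (\<lambda>z. z ^ k) z" if z: "z \<in> V'" for l z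
    proof -
      have "\<forall>\<^sub>F z in nhds z. g z = r z + c * z ^ k"
        using eventually_nhds_in_open[OF V'(1) z]
        by eventually_elim (simp add: V'_def g_def r_def A'_def poly_monom field_simps)
      hence "(deriv ^^ l) g z = (deriv ^^ l) (\<lambda>z. r z + c * z ^ k) z"
        by (rule higher_deriv_cong_ev) simp
      also have "\<dots> = (deriv ^^ l) r z + (deriv ^^ l) (\<lambda>z. c * z ^ k) z"
        by (rule higher_deriv_add[OF hol(1,3) V'(1) z])
      also have "(deriv ^^ l) (\<lambda>z. c * z ^ k) z = c * (deriv ^^ l) (\<lambda>z. z ^ k) z"
        by (rule higher_deriv_cmult[OF _ z V'(1)]) (intro holomorphic_intros)
      finally show ?thesis .
    qed
    have gH: "restrict g \<Omega> \<in> H_closure \<Omega>" by (rule restrict_in_H_closure[OF V' hol(2)])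
    hence gA: "restrict g \<Omega> \<in> A_inf \<Omega>" using H_closure_subset_A_inf[OF \<Omega>] by blast
    have "norm (ext_deriv \<Omega> l (restrict g \<Omega>) z - ext_deriv \<Omega> l h z) < \<epsilon>" if l: "l \<le> L" "z \<in> K" for l z
    proof -
      have z: "z \<in> closure \<Omega>" using l K by blast
      have "ext_deriv \<Omega> l (restrict g \<Omega>) z - ext_deriv \<Omega> l h z =
          ((deriv ^^ l) r z - (deriv ^^ l) h0 z) + c * (deriv ^^ l) (\<lambda>z. z ^ k) z"
        unfolding h0(1) ext_deriv_restrict[OF \<Omega> V' hol(2) z] ext_deriv_restrict[OF \<Omega> h0(2-4) z]
        using g_deriv V' z by auto
      moreover have "norm (c * (deriv ^^ l) (\<lambda>z. z ^ k) z) \<le> \<epsilon> / 2"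
      proof -
        have "norm (c * (deriv ^^ l) (\<lambda>z. z ^ k) z) \<le> \<epsilon> / (2 * S) * S"
          unfolding norm_mult c(2) using S[OF l] K \<open>S > 0\<close> by (intro mult_left_mono) auto
        thus ?thesis using \<open>S > 0\<close> by simp
      qed
      hence "norm ((deriv ^^ l) r z - (deriv ^^ l) h0 z) + norm (c * (deriv ^^ l) (\<lambda>z. z ^ k) z) < \<epsilon>"
        using r[OF l] by linarith
      ultimately show ?thesis using norm_triangle_lt by metis
    qed
    hence gW: "restrict g \<Omega> \<in> W" using gA K(4) by (auto simp: A_inf_nbhd_def)
    have "restrict g \<Omega> \<in> pade_set \<Omega> m p q"
    proof -
      have "restrict g \<Omega> \<in> pade_class \<Omega> p q \<zeta>" "pade_error \<Omega> (restrict g \<Omega>) p q l \<zeta> z = 0"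
        if "\<zeta> \<in> closure \<Omega>" "z \<in> closure \<Omega>" for \<zeta> z l
        using pade_rational[OF \<Omega> B bezout' \<open>A' \<noteq> 0\<close> deg n(2) that(1)] that(2)
        by (auto simp: g_def[abs_def] q_def)
      thus ?thesis
        using exhaustion_subset[of \<Omega> m] gA by (auto simp: pade_set_def pade_close_iff subset_eq)
    qed
    thus ?thesis using gW gH HX F[of n] unfolding p_def q_def by blast
  qed
qed

theorem theorem6p6:
  fixes \<Omega> :: "complex set" and F :: "(nat \<times> nat) set" and pt qt :: "nat \<Rightarrow> nat"
  assumes "open \<Omega>"
    and "\<And>n. (pt n, qt n) \<in> F"
    and "filterlim pt at_top sequentially"
    and "filterlim qt at_top sequentially"
  shows "(\<exists>f \<in> A_inf \<Omega>. pade_approximable \<Omega> F f) \<and>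
    gdelta_in (X_inf_topology \<Omega>) {f \<in> X_inf \<Omega>. pade_approximable \<Omega> F f} \<and>
    X_inf_topology \<Omega> closure_of {f \<in> X_inf \<Omega>. pade_approximable \<Omega> F f} = X_inf \<Omega>"
proof -
  let ?T = "A_inf_topology \<Omega>" and ?X = "X_inf \<Omega>" and ?S = "{f \<in> X_inf \<Omega>. pade_approximable \<Omega> F f}"
  define G where "G m = (\<Union>(p, q)\<in>F. pade_set \<Omega> m p q)" for m
  have X: "closedin ?T ?X" by (simp add: X_inf_def)
  have XA: "?X \<subseteq> A_inf \<Omega>" using closedin_subset[OF X] by simp
  have "f \<in> G m \<longleftrightarrow> (\<exists>(p, q)\<in>F. f \<in> pade_set \<Omega> m p q)" for f m
    unfolding G_def by auto
  hence "pade_approximable \<Omega> F f \<longleftrightarrow> (\<forall>m. f \<in> G m)" if "f \<in> ?X" for f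
    using that XA pade_approximable_iff[of f \<Omega> F] by auto
  hence S: "?S = ?X \<inter> (\<Inter>m. G m)" by auto
  have G: "openin ?T (G m)" for m
    unfolding G_def by (intro openin_Union) (auto intro: openin_pade_set assms(1))
  \<comment> \<open>Open sets of \<open>X_inf\<close> are traces \<open>W \<inter> ?X\<close>, so
    density is stated through the ambient topology, where completeness is available.\<close>
  have dense: "W \<inter> ?X \<inter> (\<Inter>m. G m) \<noteq> {}" if "openin ?T W" "W \<inter> ?X \<noteq> {}" for W
  proof (rule A_inf_Baire[OF assms(1) X G _ that])
    fix m W' assume "openin ?T W'" "W' \<inter> ?X \<noteq> {}"
    from pade_set_dense[OF assms this, of m] show "W' \<inter> ?X \<inter> G m \<noteq> {}"
      unfolding G_def by blast
  qed
  have "gdelta_in (X_inf_topology \<Omega>) ?S"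
  proof -
    have "?S = \<Inter>(range (\<lambda>m. ?X \<inter> G m))" unfolding S by auto
    moreover have "openin (X_inf_topology \<Omega>) (?X \<inter> G m)" for m
      unfolding X_inf_topology_def by (rule openin_subtopology_Int2[OF G])
    hence "gdelta_in (X_inf_topology \<Omega>) (\<Inter>(range (\<lambda>m. ?X \<inter> G m)))"
      by (intro gdelta_in_Inter) (auto intro: open_imp_gdelta_in)
    ultimately show ?thesis by simp
  qed
  moreover have "X_inf_topology \<Omega> closure_of ?S = ?X"
  proof
    show "X_inf_topology \<Omega> closure_of ?S \<subseteq> ?X"
      using closure_of_subset_topspace[of "X_inf_topology \<Omega>" ?S] by simp
    show "?X \<subseteq> X_inf_topology \<Omega> closure_of ?S"
    proof
      fix f assume f: "f \<in> ?X"
      have "\<exists>g. g \<in> ?S \<and> g \<in> W" if W: "f \<in> W" "openin (X_inf_topology \<Omega>) W" for W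
      proof -
        obtain W' where W': "openin ?T W'" "W = W' \<inter> ?X"
          using W(2) unfolding X_inf_topology_def openin_subtopology by blast
        hence "W' \<inter> ?X \<noteq> {}" using W(1) by blast
        thus ?thesis using dense[OF W'(1)] unfolding S W'(2) by blast
      qed
      thus "f \<in> X_inf_topology \<Omega> closure_of ?S" using f by (auto simp: in_closure_of)
    qed
  qed
  moreover have "\<exists>f\<in>A_inf \<Omega>. pade_approximable \<Omega> F f"
  proof -
    \<comment> \<open>The zero function makes \<open>X_inf\<close> nonempty, so density with the
      whole space as \<open>W\<close> produces a function with the property.\<close>
    have "restrict (\<lambda>z. 0) \<Omega> \<in> H_closure \<Omega>" by (rule restrict_in_H_closure[of UNIV]) auto
    hence "restrict (\<lambda>z. 0) \<Omega> \<in> ?X"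
      unfolding X_inf_def using H_closure_subset_A_inf[OF assms(1)] closure_of_subset[of "H_closure \<Omega>" ?T] by auto
    hence "topspace ?T \<inter> ?X \<noteq> {}" using XA by auto
    from dense[OF openin_topspace this] have "?S \<noteq> {}" unfolding S by blast
    thus ?thesis using XA by blast
  qed
  ultimately show ?thesis by blast
qed

end
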